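(* Let $f$ be possibly non-convex and let $T>1$ be an integer. Run the two-phase procedure described in the context, with $V=T^{1/3}$ and $\eta=T^{-2/3}$ in the first phase, and let $\overline x_T:=\frac1T\sum_{t=0}^{T-1}x_t$ denote the time average of the decisions $x_0,\dots,x_{T-1}$ made in the second phase. Then $$\mathbb E\big[\mathcal G(\mathbb E_\alpha[\overline x_T])\big]\le\Big(2K+B^2+\frac{LD^2}{2}+(2DL+M)(\sqrt2+1)D\Big)\frac1{T^{1/3}},$$ $$\langle\mathbf a_i,\mathbb E[\overline x_T]\rangle-b_i\le\Big(\sqrt{2MD+4K+B^2+LD^2}+\|\mathbf a_i\|(\sqrt2+2)D\Big)\frac1{T^{1/3}},\qquad\forall i\in\{1,\dots,N\},$$ where $\mathbb E_\alpha[\cdot]$ denotes the conditional expectation given the randomness of the first phase (the first $T$ slots together with $\alpha$) that generates $\gamma_\alpha$.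
   Context: Setting. Let $m,d,N\ge1$ be integers, $\langle\cdot,\cdot\rangle$ the dot product, $\|\cdot\|$ the Euclidean norm; vector inequalities are entrywise. $\mathcal B\subseteq\mathbb R^d$ is compact and convex. $\{S[t]\}_{t\ge0}$ is an i.i.d. sequence of random vectors with values in a set $\mathcal S\subseteq\mathbb R^m$. For each $s\in\mathcal S$, $\mathcal X_s\subseteq\mathcal B$ is a (nonempty) compact set, the decision options when the state is $s$. At each slot $t\in\{0,1,2,\dots\}$ the controller observes $S[t]$ and chooses $x_t\in\mathcal X_{S[t]}$. The history $\mathcal H_t$ consists of $S[0],\dots,S[t-1],x_0,\dots,x_{t-1}$. A randomized stationary algorithm chooses $x_t\in\mathcal X_{S[t]}$ as a stationary randomized function of $S[t]$ (the same conditional distribution given the same value of $S[t]$), independently of $\mathcal H_t$. $\Gamma^*\subseteq\mathbb R^d$ is the set of all expectations $\mathbb E[x_t]$ achievable at a slot by randomized stationary algorithms, and $\overline\Gamma^*$ is its closure; $\overline\Gamma^*$ is a convex subset of $\mathcal B$. Assume $0\in\overline\Gamma^*$. Given $\mathbf a_1,\dots,\mathbf a_N\in\mathbb R^d$ and $b_1,\dots,b_N\in\mathbb R$, put $\mathbf A=[\mathbf a_1,\dots,\mathbf a_N]^T$, $\mathbf b=[b_1,\dots,b_N]^T$. The problem is to minimize $f(\gamma)$ subject to $\gamma\in\overline\Gamma^*$ and $\mathbf A\gamma\le\mathbf b$, assumed feasible. Assumptions on $f$. $f:\mathcal B\to\mathbb R$ is differentiable with $\|\nabla f(x)-\nabla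 f(y)\|\le L\|x-y\|$ for all $x,y\in\mathcal B$, and there are constants with $\sup_{\gamma\in\mathcal B}\|\nabla f(\gamma)\|\le M$, $\sup_{\gamma\in\mathcal B}|f(\gamma)|\le K$, $\sup_{\gamma\in\mathcal B}\sum_{i=1}^N|\langle\mathbf a_i,\gamma\rangle-b_i|^2\le B^2$, and $\|x-y\|\le D$ for all $x,y\in\mathcal B$. First phase ($T$ slots; parameters $V>0$, $0<\eta<1$). Set $\gamma_{-1}=0$ and $Q_i(0)=0$ for all $i$; $\mathbf Q(t)=[Q_1(t),\dots,Q_N(t)]$. At each slot $t=0,\dots,T-1$: observe $S[t]$ and choose $x_t\in\mathcal X_{S[t]}$ minimizing $V\langle\nabla f(\gamma_{t-1}),x\rangle+\sum_{i=1}^NQ_i(t)\langle\mathbf a_i,x\rangle$ over $x\in\mathcal X_{S[t]}$ ($x_t$ is determined, measurably, by $\gamma_{t-1},\mathbf Q(t),S[t]$); set $\gamma_t=(1-\eta)\gamma_{t-1}+\eta x_t$ and $Q_i(t+1)=\max\{Q_i(t)+\langle\mathbf a_i,x_t\rangle-b_i,0\}$ for all $i$. Draw $\alpha$ uniformly from $\{-1,0,\dots,T-2\}$, independently of everything else, and output $\gamma_\alpha$. Second phase (the next $T$ slots, with fresh i.i.d. states independent of the first phase; the time index, $x_t$ and $\gamma_t$ are restarted, while $\gamma_\alpha$ stays the fixed output of the first phase). Set $\gamma_{-1}=0$, $\eta_t=1/(t+1)$. At each slot $t=0,\dots,T-1$: observe $S[t]$, choose $x_t\in\mathcal X_{S[t]}$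 minimizing $\langle\gamma_{t-1}-\gamma_\alpha,x\rangle$ over $x\in\mathcal X_{S[t]}$ (measurably determined by $\gamma_{t-1},\gamma_\alpha,S[t]$), and set $\gamma_t=(1-\eta_t)\gamma_{t-1}+\eta_tx_t$. Definition. $\mathcal G(\gamma):=\sup_{\{v\in\overline\Gamma^*:\mathbf Av\le\mathbf b\}}\langle\nabla f(\gamma),\gamma-v\rangle$ (Frank-Wolfe gap). *)

theory Defs
  imports "HOL-Probability.Probability"
begin

text \<open>
  \<open>\<mu>\<close> is the law of a state, a measure whose space is the state set \<open>\<S>\<close>; \<open>X s\<close> is the set of options
  in state \<open>s\<close>.  A randomized stationary algorithm is a Markov kernel \<open>\<kappa>\<close>: given that the state is \<open>s\<close>,
  the decision is drawn from \<open>\<kappa> s\<close>, which is concentrated on \<open>X s\<close>.  The decision then has law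
  \<open>\<mu> \<bind> \<kappa>\<close>.
\<close>

definition stationary_kernels ::
    "'s measure \<Rightarrow> ('s \<Rightarrow> 'x::euclidean_space set) \<Rightarrow> ('s \<Rightarrow> 'x measure) set" where
  "stationary_kernels \<mu> X =
     {\<kappa> \<in> \<mu> \<rightarrow>\<^sub>M prob_algebra borel. \<forall>s\<in>space \<mu>. AE x in \<kappa> s. x \<in> X s}"

definition Gamma_star ::
    "'s measure \<Rightarrow> ('s \<Rightarrow> 'x::euclidean_space set) \<Rightarrow> 'x set" where
  "Gamma_star \<mu> X = {(\<integral>x. x \<partial>(\<mu> \<bind> \<kappa>)) | \<kappa>. \<kappa> \<in> stationary_kernels \<mu> X}"

definition feasible_set ::
    "(real^'d) set \<Rightarrow> real^'d^'n \<Rightarrow> real^'n \<Rightarrow> (real^'d) set" where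
  "feasible_set \<Gamma> A b = {v \<in> closure \<Gamma>. A *v v \<le> b}"

text \<open>
  The Frank-Wolfe gap over the feasible set \<open>C\<close>, for a gradient field \<open>Df\<close> that is only meaningful
  on the compact convex domain \<open>\<B>\<close> of the objective.  A conditional expectation of a \<open>\<B>\<close>-valued
  random point lies in \<open>\<B>\<close> almost surely, but a version of it may leave \<open>\<B>\<close> on a null set; the value
  \<open>0\<close> off \<open>\<B>\<close> does not affect the expected gap and keeps the gap measurable.
\<close>

definition FW_gap ::
    "'x::euclidean_space set \<Rightarrow> ('x \<Rightarrow> 'x) \<Rightarrow> 'x set \<Rightarrow> 'x \<Rightarrow> real" where
  "FW_gap \<B> Df C \<gamma> = (if \<gamma> \<in> \<B> then (SUP v\<in>C. Df \<gamma> \<bullet> (\<gamma> - v)) else 0)"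

definition vec_cond_exp ::
    "'w measure \<Rightarrow> 'w measure \<Rightarrow> ('w \<Rightarrow> real^'d) \<Rightarrow> 'w \<Rightarrow> real^'d" where
  "vec_cond_exp M F Y \<omega> = (\<chi> j. real_cond_exp M F (\<lambda>\<omega>. Y \<omega> $ j) \<omega>)"

text \<open>The sigma-algebra generated by the states of the first \<open>T\<close> slots and the random index \<open>\<alpha>\<close>.\<close>

definition first_phase_algebra ::
    "'w measure \<Rightarrow> nat \<Rightarrow> 's measure \<Rightarrow> (nat \<Rightarrow> 'w \<Rightarrow> 's) \<Rightarrow> ('w \<Rightarrow> int) \<Rightarrow> 'w measure" where
  "first_phase_algebra M T N S \<alpha> =
     vimage_algebra (space M) (\<lambda>\<omega>. (\<lambda>t\<in>{..<T}. S t \<omega>, \<alpha> \<omega>))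
       (PiM {..<T} (\<lambda>_. N) \<Otimes>\<^sub>M count_space {-1..int T - 2})"

end

theory Submission
  imports Defs
begin

text \<open>
  The algorithm never knows the law of the states.  What replaces it is a single observation: the
  history before slot \<open>t\<close> is independent of the state of slot \<open>t\<close>.  So if a decision minimizes a
  linear functional \<open>w\<close> over the current options, with \<open>w\<close> determined by the history, then given the
  history its mean is a point \<open>c\<close> with \<open>w \<bullet> c \<le> w \<bullet> v\<close> for every \<open>v\<close> in the closure of \<open>\<Gamma>\<close>
  (\<open>Gamma_star_support\<close>), and inside an expectation against any bounded history-measurable vector
  the decision may be exchanged for \<open>c\<close> (\<open>compensator\<close>).  Here \<open>c\<close> is an explicit integral over the
  law of one state, and the inequality holds at each sample point.  So \<open>v\<close> may be chosen after the
  history, as the maximizer in the Frank-Wolfe gap is.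

  First phase.  The weight \<open>w = V \<nabla>f(\<gamma>\<^bsub>t-1\<^esub>) + A\<^sup>T Q(t)\<close> adds the Frank-Wolfe direction to the
  drift of the queues.  Comparison with a feasible \<open>v\<close> bounds \<open>V\<close> times the gap at \<open>\<gamma>\<^bsub>t-1\<^esub>\<close> by
  the expected decrease of \<open>V f / \<eta>\<close> and of \<open>\<parallel>Q\<parallel>\<^sup>2 / 2\<close>, up to the constants
  \<open>V \<eta> L D\<^sup>2 / 2 + B\<^sup>2 / 2\<close>.  Both decreases telescope (\<open>first_phase_drift\<close>).
  Dropping \<open>\<parallel>Q(T)\<parallel>\<^sup>2\<close> bounds the average gap, which is the expected gap at \<open>\<gamma>\<^sub>\<alpha>\<close> because
  \<open>\<alpha>\<close> is uniform and independent.  Bounding the gap below by \<open>-M D\<close> bounds \<open>\<parallel>Q(T)\<parallel>\<close>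
  in mean square, and \<open>Q\<^sub>i(T)\<close> dominates the total violation of the \<open>i\<close>-th constraint.

  Second phase.  The point \<open>\<gamma>\<^sub>\<alpha>\<close> is an average of random decisions and need not lie in the closure
  of \<open>\<Gamma>\<close>.  Replacing each decision by its mean given the past gives a convex combination
  of achievable points, and the difference is a martingale with geometric weights, of mean
  square at most \<open>\<eta> D\<^sup>2\<close> (\<open>mean_iterate_close\<close>).  The second phase runs Frank-Wolfe on
  \<open>\<parallel>g - \<gamma>\<^sub>\<alpha>\<parallel>\<^sup>2 / 2\<close> with step \<open>1 / (t + 1)\<close>, whose iterate is the running average of its decisions.
  In \<open>L\<^sup>2\<close> the average ends within \<open>\<surd>\<eta> D + D / \<surd>T\<close> of \<open>\<gamma>\<^sub>\<alpha>\<close> (\<open>time_average_close\<close>):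
  the first term is the distance of \<open>\<gamma>\<^sub>\<alpha>\<close> to achievable points, the second comes from the
  squared diameters that the single decisions add.

  Conclusion.  Conditional expectation given the first phase contracts the \<open>L\<^sup>2\<close> distance to the
  known vector \<open>\<gamma>\<^sub>\<alpha>\<close> and keeps values in the convex set \<open>\<B>\<close>; the gap is Lipschitz on \<open>\<B>\<close>.
  So the bounds at \<open>\<gamma>\<^sub>\<alpha>\<close> pass to the averaged output.  With \<open>r = T\<^bsup>1/3\<^esup>\<close>, \<open>V = r\<close> and \<open>\<eta> = 1 / r\<^sup>2\<close>
  every term is at most a multiple of \<open>1 / r\<close>.
\<close>

section \<open>Moments, components and smooth functions\<close>

lemma borel_measurable_vec_component [measurable (raw)]:
  fixes f :: "'a \<Rightarrow> real^'n"
  assumes "f \<in> borel_measurable M"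
  shows "(\<lambda>x. f x $ i) \<in> borel_measurable M"
  by (rule measurable_compose[OF assms borel_measurable_nth])

lemma borel_measurable_vec_iff:
  fixes f :: "'a \<Rightarrow> real^'n"
  shows "f \<in> borel_measurable M \<longleftrightarrow> (\<forall>i. (\<lambda>x. f x $ i) \<in> borel_measurable M)"
proof
  assume "\<forall>i. (\<lambda>x. f x $ i) \<in> borel_measurable M"
  then have "(\<lambda>x. f x \<bullet> i) \<in> borel_measurable M" if "i \<in> Basis" for i
    using that by (auto simp: Basis_vec_def inner_axis)
  then show "f \<in> borel_measurable M" by (subst borel_measurable_euclidean_space) auto
qed measurable

text \<open>
  The decision rules are controlled only for arguments in \<open>\<B>\<close> and nonnegative queues.  Restricting
  the spaces of the arguments turns such conditional bounds into bounds on a whole space.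
\<close>

lemma measurable_restrict_arguments:
  fixes \<theta> :: "'g::topological_space \<Rightarrow> 'h::topological_space \<Rightarrow> 's \<Rightarrow> 'x::topological_space"
  assumes "(\<lambda>(g, h, s). \<theta> g h s) \<in> borel \<Otimes>\<^sub>M borel \<Otimes>\<^sub>M N \<rightarrow>\<^sub>M borel"
  shows "(\<lambda>((g, h), s). \<theta> g h s)
    \<in> borel_measurable ((restrict_space borel Y \<Otimes>\<^sub>M restrict_space borel Z) \<Otimes>\<^sub>M N)"
proof -
  have i: "(\<lambda>x. x) \<in> restrict_space borel Y \<rightarrow>\<^sub>M borel" for Y :: "'z::topological_space set"
    by (rule measurable_restrict_space1) simp
  have "(\<lambda>p. (fst (fst p), snd (fst p), snd p))
      \<in> (restrict_space borel Y \<Otimes>\<^sub>M restrict_space borel Z) \<Otimes>\<^sub>M N \<rightarrow>\<^sub>M borel \<Otimes>\<^sub>M borel \<Otimes>\<^sub>M N"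
    by (intro measurable_Pair measurable_compose[OF measurable_compose[OF measurable_fst measurable_fst] i]
          measurable_compose[OF measurable_compose[OF measurable_fst measurable_snd] i] measurable_snd)
  from measurable_compose[OF this assms] show ?thesis
    by (simp add: case_prod_unfold)
qed

text \<open>
  The derivative is only taken within the convex set, so the estimate is made along the segment from
  \<open>x\<close> to \<open>y\<close>: a function that subtracts the claimed majorant has nonpositive derivative there, by
  the Lipschitz bound on the gradient.
\<close>

lemma smooth_descent:
  fixes f :: "'x::euclidean_space \<Rightarrow> real" and Df :: "'x \<Rightarrow> 'x"
  assumes S: "convex S" "x \<in> S" "y \<in> S"
    and gradient: "\<And>z. z \<in> S \<Longrightarrow> (f has_derivative (\<lambda>h. Df z \<bullet> h)) (at z within S)"
    and smooth: "L-lipschitz_on S Df"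
  shows "f y \<le> f x + Df x \<bullet> (y - x) + L / 2 * (norm (y - x))\<^sup>2"
proof -
  define d where "d = y - x"
  define p where "p s = x + s *\<^sub>R d" for s
  define k where "k s = f (p s) - s * (Df x \<bullet> d) - L * s\<^sup>2 / 2 * (norm d)\<^sup>2" for s
  have pS: "p s \<in> S" if "0 \<le> s" "s \<le> 1" for s
  proof -
    have "(1 - s) *\<^sub>R x + s *\<^sub>R y \<in> S" using S that by (intro convexD) auto
    then show ?thesis by (simp add: p_def d_def algebra_simps)
  qed
  have der: "(k has_real_derivative (Df (p s) \<bullet> d - Df x \<bullet> d - L * s * (norm d)\<^sup>2)) (at s within {0..1})"
    if s: "s \<in> {0..1}" for s
  proof -
    have "(p has_derivative (\<lambda>h. h *\<^sub>R d)) (at s within {0..1})"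
      unfolding p_def by (auto intro!: derivative_eq_intros)
    then have "((\<lambda>s. f (p s)) has_derivative (\<lambda>h. Df (p s) \<bullet> (h *\<^sub>R d))) (at s within {0..1})"
    proof (rule has_derivative_in_compose)
      show "(f has_derivative (\<lambda>h. Df (p s) \<bullet> h)) (at (p s) within p ` {0..1})"
        by (rule has_derivative_subset[OF gradient]) (use pS s in auto)
    qed
    then have "((\<lambda>s. f (p s)) has_real_derivative (Df (p s) \<bullet> d)) (at s within {0..1})"
      by (simp add: has_field_derivative_def mult.commute[of _ "Df (p s) \<bullet> d"])
    then show ?thesis
      unfolding k_def by (auto intro!: derivative_eq_intros)
  qed
  \<comment> \<open>The claim is \<open>k 1 \<le> k 0\<close>.\<close>
  have "\<exists>s\<in>{0<..<1}. k 1 - k 0 = (\<lambda>h. h * (Df (p s) \<bullet> d - Df x \<bullet> d - L * s * (norm d)\<^sup>2)) (1 - 0)"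
  proof (rule mvt_simple)
    fix s :: real assume "0 \<le> s" "s \<le> 1"
    then have "s \<in> {0..1}" by auto
    from der[OF this] show "(k has_derivative
        (\<lambda>h. h * (Df (p s) \<bullet> d - Df x \<bullet> d - L * s * (norm d)\<^sup>2))) (at s within {0..1})"
      by (simp add: has_field_derivative_def mult_commute_abs)
  qed simp
  then obtain s where s: "0 < s" "s < 1"
    and eq: "k 1 - k 0 = Df (p s) \<bullet> d - Df x \<bullet> d - L * s * (norm d)\<^sup>2" by auto
  have "Df (p s) \<bullet> d - Df x \<bullet> d = (Df (p s) - Df x) \<bullet> d" by (simp add: inner_diff_left)
  also have "\<dots> \<le> norm (Df (p s) - Df x) * norm d" by (rule norm_cauchy_schwarz)
  also have "\<dots> \<le> (L * norm (p s - x)) * norm d"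
    using lipschitz_onD[OF smooth pS S(2), of s] s
    by (intro mult_right_mono) (auto simp: dist_norm)
  also have "\<dots> = L * s * (norm d)\<^sup>2" using s by (simp add: p_def power2_eq_square)
  finally have "k 1 \<le> k 0" using eq by simp
  then show ?thesis by (simp add: k_def p_def d_def)
qed

text \<open>
  The Cauchy-Schwarz inequality for vector-valued functions, from
  \<open>2 u \<bullet> v \<le> c \<parallel>u\<parallel>\<^sup>2 + \<parallel>v\<parallel>\<^sup>2 / c\<close>.
\<close>

lemma (in prob_space) integral_inner_le_L2:
  fixes U V :: "'a \<Rightarrow> 'x::euclidean_space"
  assumes UV: "integrable M (\<lambda>\<omega>. U \<omega> \<bullet> V \<omega>)"
    and U: "U \<in> borel_measurable M" "integrable M (\<lambda>\<omega>. (norm (U \<omega>))\<^sup>2)"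
    and V: "V \<in> borel_measurable M" "integrable M (\<lambda>\<omega>. (norm (V \<omega>))\<^sup>2)"
  shows "(\<integral>\<omega>. U \<omega> \<bullet> V \<omega> \<partial>M) \<le> sqrt (\<integral>\<omega>. (norm (U \<omega>))\<^sup>2 \<partial>M) * sqrt (\<integral>\<omega>. (norm (V \<omega>))\<^sup>2 \<partial>M)"
proof -
  define a where "a = (\<integral>\<omega>. (norm (U \<omega>))\<^sup>2 \<partial>M)"
  define b where "b = (\<integral>\<omega>. (norm (V \<omega>))\<^sup>2 \<partial>M)"
  have a0: "a \<ge> 0" and b0: "b \<ge> 0" by (auto simp: a_def b_def)
  consider "a = 0" | "b = 0" | "a > 0" "b > 0" using a0 b0 by linarith
  then show ?thesis
  proof cases
    case 1
    then have "AE \<omega> in M. (norm (U \<omega>))\<^sup>2 = 0"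
      using integral_nonneg_eq_0_iff_AE[OF U(2)] by (simp add: a_def)
    then have "(\<integral>\<omega>. U \<omega> \<bullet> V \<omega> \<partial>M) = 0" by (intro integral_eq_zero_AE) auto
    then show ?thesis using a0 b0 by (simp add: a_def[symmetric] b_def[symmetric])
  next
    case 2
    then have "AE \<omega> in M. (norm (V \<omega>))\<^sup>2 = 0"
      using integral_nonneg_eq_0_iff_AE[OF V(2)] by (simp add: b_def)
    then have "(\<integral>\<omega>. U \<omega> \<bullet> V \<omega> \<partial>M) = 0" by (intro integral_eq_zero_AE) auto
    then show ?thesis using a0 b0 by (simp add: a_def[symmetric] b_def[symmetric])
  next
    case 3
    \<comment> \<open>The value of \<open>c\<close> that minimizes \<open>c a + b / c\<close>.\<close>
    define c where "c = sqrt b / sqrt a"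
    have c: "c > 0" using 3 by (simp add: c_def)
    have "2 * (u \<bullet> v) \<le> c * (norm u)\<^sup>2 + (norm v)\<^sup>2 / c" for u v :: 'x
    proof -
      have "0 \<le> (c * norm u - norm v)\<^sup>2 / c" using c by simp
      also have "\<dots> = c * (norm u)\<^sup>2 + (norm v)\<^sup>2 / c - 2 * (norm u * norm v)"
        using c by (simp add: power2_eq_square field_simps)
      finally show ?thesis using norm_cauchy_schwarz[of u v] by linarith
    qed
    then have "(\<integral>\<omega>. 2 * (U \<omega> \<bullet> V \<omega>) \<partial>M) \<le> (\<integral>\<omega>. c * (norm (U \<omega>))\<^sup>2 + (norm (V \<omega>))\<^sup>2 / c \<partial>M)"
      using UV U V by (intro integral_mono) auto
    then have "2 * (\<integral>\<omega>. U \<omega> \<bullet> V \<omega> \<partial>M) \<le> c * a + b / c"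
      using U V UV by (simp add: a_def b_def)
    also have "c * a = sqrt a * sqrt b"
      using 3 real_sqrt_mult_self[of a] by (simp add: c_def field_simps)
    also have "b / c = sqrt a * sqrt b"
      using 3 real_sqrt_mult_self[of b] by (simp add: c_def field_simps)
    finally show ?thesis by (simp add: a_def b_def)
  qed
qed

lemma (in prob_space) integral_le_sqrt_integral_square:
  fixes g :: "'a \<Rightarrow> real"
  assumes g: "integrable M g" and g2: "integrable M (\<lambda>\<omega>. (g \<omega>)\<^sup>2)"
  shows "(\<integral>\<omega>. g \<omega> \<partial>M) \<le> sqrt (\<integral>\<omega>. (g \<omega>)\<^sup>2 \<partial>M)"
  using integral_inner_le_L2[of g "\<lambda>_. 1::real"] assms
  by (simp add: prob_space)

lemma (in prob_space) expectation_in_closed_convex: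
  fixes Y :: "'a \<Rightarrow> 'x::euclidean_space"
  assumes C: "convex C" "closed C" and Y: "integrable M Y" and in_C: "AE \<omega> in M. Y \<omega> \<in> C"
  shows "(\<integral>\<omega>. Y \<omega> \<partial>M) \<in> C"
proof (rule ccontr)
  assume "(\<integral>\<omega>. Y \<omega> \<partial>M) \<notin> C"
  from separating_hyperplane_closed_point[OF C this] obtain a c where
    ac: "a \<bullet> (\<integral>\<omega>. Y \<omega> \<partial>M) < c" "\<And>z. z \<in> C \<Longrightarrow> a \<bullet> z > c" by auto
  have "c = (\<integral>\<omega>. c \<partial>M)" by (simp add: prob_space)
  also have "\<dots> \<le> (\<integral>\<omega>. a \<bullet> Y \<omega> \<partial>M)"
    using Y in_C ac(2) by (intro integral_mono_AE) (auto intro: less_imp_le elim: eventually_mono)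
  also have "\<dots> = a \<bullet> (\<integral>\<omega>. Y \<omega> \<partial>M)" using Y by simp
  finally show False using ac(1) by simp
qed

section \<open>Histories of an independent sequence\<close>

text \<open>
  The information before slot \<open>n\<close> of a second phase includes the random index \<open>\<alpha>\<close>.  For uniformity
  \<open>\<alpha>\<close> belongs to the history from the start: it is independent of all states, so it cannot help the
  first phase.  For \<open>n = T\<close> this is the algebra generated by the first phase.
\<close>

definition history ::
    "'w measure \<Rightarrow> nat \<Rightarrow> 's measure \<Rightarrow> (nat \<Rightarrow> 'w \<Rightarrow> 's) \<Rightarrow> 'k measure \<Rightarrow> ('w \<Rightarrow> 'k) \<Rightarrow> 'w measure" where
  "history M n N Z K \<alpha> =
     vimage_algebra (space M) (\<lambda>\<omega>. (\<lambda>t\<in>{..<n}. Z t \<omega>, \<alpha> \<omega>)) (PiM {..<n} (\<lambda>_. N) \<Otimes>\<^sub>M K)"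

lemma space_history [simp]: "space (history M n N Z K \<alpha>) = space M"
  by (simp add: history_def)

lemma history_measurable:
  assumes Z: "\<And>t. Z t \<in> M \<rightarrow>\<^sub>M N" and \<alpha>: "\<alpha> \<in> M \<rightarrow>\<^sub>M K"
  shows "t < n \<Longrightarrow> Z t \<in> history M n N Z K \<alpha> \<rightarrow>\<^sub>M N"
    and "\<alpha> \<in> history M n N Z K \<alpha> \<rightarrow>\<^sub>M K"
    and "subalgebra M (history M n N Z K \<alpha>)"
proof -
  let ?h = "\<lambda>\<omega>. (\<lambda>t\<in>{..<n}. Z t \<omega>, \<alpha> \<omega>)"
  have h: "?h \<in> M \<rightarrow>\<^sub>M PiM {..<n} (\<lambda>_. N) \<Otimes>\<^sub>M K"
    using Z \<alpha> by measurable
  have f: "?h \<in> history M n N Z K \<alpha> \<rightarrow>\<^sub>M PiM {..<n} (\<lambda>_. N) \<Otimes>\<^sub>M K"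
    unfolding history_def by (rule measurable_vimage_algebra1) (use measurable_space[OF h] in auto)
  show "t < n \<Longrightarrow> Z t \<in> history M n N Z K \<alpha> \<rightarrow>\<^sub>M N"
  proof -
    assume "t < n"
    then have "(\<lambda>\<omega>. fst (?h \<omega>) t) \<in> history M n N Z K \<alpha> \<rightarrow>\<^sub>M N"
      by (intro measurable_compose[OF measurable_compose[OF f measurable_fst]
            measurable_component_singleton]) auto
    then show ?thesis using \<open>t < n\<close> by simp
  qed
  show "\<alpha> \<in> history M n N Z K \<alpha> \<rightarrow>\<^sub>M K"
    using measurable_compose[OF f measurable_snd] by simp
  have "sets (history M n N Z K \<alpha>) \<subseteq> sets M"
    unfolding history_def
    by (subst sets_vimage_algebra2) (use measurable_space[OF h] measurable_sets[OF h] in auto)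
  then show "subalgebra M (history M n N Z K \<alpha>)"
    by (simp add: subalgebra_def)
qed

text \<open>
  The rectangles \<open>{\<alpha> \<in> k} \<inter> {(Z 0, \<dots>, Z (n - 1)) \<in> a}\<close> are a generator of the history
  that is stable under intersection.  On them the product rule follows from two separate
  independences: \<open>\<alpha>\<close> against the whole sequence, then the first \<open>n\<close> states against the next one.
\<close>

lemma (in prob_space) indep_history:
  fixes Z :: "nat \<Rightarrow> 'a \<Rightarrow> 's"
  assumes Z: "indep_vars (\<lambda>_. N) Z UNIV" and \<alpha>: "random_variable K \<alpha>"
    and ind: "indep_set (sets (vimage_algebra (space M) \<alpha> K))
                (sets (vimage_algebra (space M) (\<lambda>\<omega> t. Z t \<omega>) (PiM UNIV (\<lambda>_. N))))"
  shows "indep_set (sets (history M n N Z K \<alpha>)) (sets (vimage_algebra (space M) (Z n) N))"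
proof -
  define G where "G = vimage_algebra (space M) (\<lambda>\<omega> t. Z t \<omega>) (PiM UNIV (\<lambda>_. N))"
  let ?H = "\<lambda>\<omega>. \<lambda>t\<in>{..<n}. Z t \<omega>"
  let ?P = "PiM {..<n} (\<lambda>_. N)"
  have rv: "Z t \<in> M \<rightarrow>\<^sub>M N" for t using Z by (auto simp: indep_vars_def)
  have [simp]: "space G = space M" by (simp add: G_def)
  have ZG: "Z t \<in> G \<rightarrow>\<^sub>M N" for t
  proof -
    have "(\<lambda>\<omega> t. Z t \<omega>) \<in> G \<rightarrow>\<^sub>M PiM UNIV (\<lambda>_. N)"
      unfolding G_def using measurable_space[OF rv]
      by (intro measurable_vimage_algebra1) (auto simp: space_PiM)
    from measurable_compose[OF this measurable_component_singleton[of t]] show ?thesis by simp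
  qed
  have HG: "?H \<in> G \<rightarrow>\<^sub>M ?P" using ZG by measurable
  have "indep_var ?P ?H (PiM {n} (\<lambda>_. N)) (\<lambda>\<omega>. \<lambda>t\<in>{n}. Z t \<omega>)"
    using indep_var_restrict[OF Z, of "{..<n}" "{n}"] by auto
  then have indH: "indep_set (sigma_sets (space M) {?H -` a \<inter> space M | a. a \<in> sets ?P})
      (sigma_sets (space M) {(\<lambda>\<omega>. \<lambda>t\<in>{n}. Z t \<omega>) -` c \<inter> space M | c. c \<in> sets (PiM {n} (\<lambda>_. N))})"
    unfolding indep_var_eq by blast
  have HZ: "prob ((?H -` a \<inter> space M) \<inter> (Z n -` c \<inter> space M))
      = prob (?H -` a \<inter> space M) * prob (Z n -` c \<inter> space M)" if "a \<in> sets ?P" "c \<in> sets N" for a c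
  proof -
    let ?c = "(\<lambda>f. f n) -` c \<inter> space (PiM {n} (\<lambda>_. N))"
    have "?c \<in> sets (PiM {n} (\<lambda>_. N))"
      using that by (intro measurable_sets[OF measurable_component_singleton]) auto
    moreover have "Z n -` c \<inter> space M = (\<lambda>\<omega>. \<lambda>t\<in>{n}. Z t \<omega>) -` ?c \<inter> space M"
      using measurable_space[OF rv] by (auto simp: space_PiM)
    ultimately show ?thesis using that by (intro indep_setD[OF indH]) blast+
  qed
  let ?A = "{(\<lambda>\<omega>. (?H \<omega>, \<alpha> \<omega>)) -` R \<inter> space M | R. R \<in> {a \<times> k | a k. a \<in> sets ?P \<and> k \<in> sets K}}"
  let ?B = "{Z n -` c \<inter> space M | c. c \<in> sets N}"
  have h: "(\<lambda>\<omega>. (?H \<omega>, \<alpha> \<omega>)) \<in> M \<rightarrow>\<^sub>M ?P \<Otimes>\<^sub>M K" using rv \<alpha> by measurable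
  have sH: "sets (history M n N Z K \<alpha>) = sigma_sets (space M) ?A"
  proof -
    have "sets (history M n N Z K \<alpha>) = {(\<lambda>\<omega>. (?H \<omega>, \<alpha> \<omega>)) -` R \<inter> space M | R. R \<in> sets (?P \<Otimes>\<^sub>M K)}"
      unfolding history_def
      by (rule sets_vimage_algebra2) (use measurable_space[OF h] in auto)
    also have "\<dots> = sigma_sets (space M) ?A"
      unfolding sets_pair_measure
      by (rule sigma_sets_vimage_commute)
         (use measurable_space[OF h] in \<open>auto simp: space_pair_measure\<close>)
    finally show ?thesis .
  qed
  have sZ: "sets (vimage_algebra (space M) (Z n) N) = sigma_sets (space M) ?B"
    unfolding sets_vimage_algebra ..
  have B': "sets (vimage_algebra (space M) (Z n) N) = ?B"
    by (rule sets_vimage_algebra2) (use measurable_space[OF rv] in auto)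
  show ?thesis unfolding sH sZ
  proof (rule indep_set_sigma_sets)
    show "indep_set ?A ?B"
    proof (rule indep_setI)
      show "?A \<subseteq> events" using measurable_sets[OF h] by (auto intro!: pair_measureI)
      show "?B \<subseteq> events" using measurable_sets[OF rv] by auto
      fix E F assume "E \<in> ?A" "F \<in> ?B"
      then obtain a k c where e: "a \<in> sets ?P" "k \<in> sets K" "c \<in> sets N"
        "E = (\<lambda>\<omega>. (?H \<omega>, \<alpha> \<omega>)) -` (a \<times> k) \<inter> space M" "F = Z n -` c \<inter> space M" by blast
      let ?Ha = "?H -` a \<inter> space M" and ?\<alpha>k = "\<alpha> -` k \<inter> space M"
      have E: "E = ?\<alpha>k \<inter> ?Ha" using e(4) by auto
      have inG: "?Ha \<in> sets G" "?Ha \<inter> F \<in> sets G"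
        using measurable_sets[OF HG e(1)] measurable_sets[OF ZG[of n] e(3)] e(5) by auto
      have ak: "?\<alpha>k \<in> sets (vimage_algebra (space M) \<alpha> K)"
        by (rule in_vimage_algebra[OF e(2)])
      have "prob (E \<inter> F) = prob (?\<alpha>k \<inter> (?Ha \<inter> F))" unfolding E by (simp add: Int_assoc)
      also have "\<dots> = prob ?\<alpha>k * prob (?Ha \<inter> F)"
        using indep_setD[OF ind ak] inG unfolding G_def by blast
      also have "\<dots> = prob ?\<alpha>k * prob ?Ha * prob F" using HZ[OF e(1) e(3)] e(5) by simp
      also have "\<dots> = prob E * prob F"
        using indep_setD[OF ind ak inG(1)[unfolded G_def]] unfolding E by simp
      finally show "prob (E \<inter> F) = prob E * prob F" .
    qed
    show "Int_stable ?A"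
    proof (rule Int_stableI)
      fix E F assume "E \<in> ?A" "F \<in> ?A"
      then obtain a k a' k' where "a \<in> sets ?P" "k \<in> sets K" "a' \<in> sets ?P" "k' \<in> sets K"
        "E = (\<lambda>\<omega>. (?H \<omega>, \<alpha> \<omega>)) -` (a \<times> k) \<inter> space M" "F = (\<lambda>\<omega>. (?H \<omega>, \<alpha> \<omega>)) -` (a' \<times> k') \<inter> space M"
        by blast
      then show "E \<inter> F \<in> ?A"
        by (intro CollectI exI[of _ "(a \<inter> a') \<times> (k \<inter> k')"]) auto
    qed
    show "Int_stable ?B" unfolding B'[symmetric] by (rule sets.Int_stable)
  qed
qed

text \<open>
  Independence is expressed between sigma-algebras, because \<open>U\<close> and \<open>Z\<close> have values of
  different types.
\<close>

lemma (in prob_space) distr_pair_indep: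
  assumes ind: "indep_set (sets F) (sets (vimage_algebra (space M) Z N))"
    and F: "subalgebra M F" and U: "U \<in> F \<rightarrow>\<^sub>M P" and Z: "random_variable N Z"
  shows "distr M P U \<Otimes>\<^sub>M distr M N Z = distr M (P \<Otimes>\<^sub>M N) (\<lambda>\<omega>. (U \<omega>, Z \<omega>))"
proof -
  have sp: "space F = space M" using F by (simp add: subalgebra_def)
  have UM [measurable]: "U \<in> M \<rightarrow>\<^sub>M P" by (rule measurable_from_subalg[OF F U])
  note Z [measurable]
  interpret X: prob_space "distr M P U" by (rule prob_space_distr) measurable
  interpret Y: prob_space "distr M N Z" by (rule prob_space_distr) measurable
  show ?thesis
  proof (rule pair_measure_eqI)
    fix A B assume A: "A \<in> sets (distr M P U)" and B: "B \<in> sets (distr M N Z)"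
    have "(\<lambda>\<omega>. (U \<omega>, Z \<omega>)) -` (A \<times> B) \<inter> space M = (U -` A \<inter> space M) \<inter> (Z -` B \<inter> space M)"
      by auto
    moreover have "prob ((U -` A \<inter> space M) \<inter> (Z -` B \<inter> space M))
        = prob (U -` A \<inter> space M) * prob (Z -` B \<inter> space M)"
      using measurable_sets[OF U] A B sp by (intro indep_setD[OF ind] in_vimage_algebra) auto
    ultimately show "emeasure (distr M P U) A * emeasure (distr M N Z) B =
        emeasure (distr M (P \<Otimes>\<^sub>M N) (\<lambda>\<omega>. (U \<omega>, Z \<omega>))) (A \<times> B)"
      using A B by (simp add: emeasure_distr emeasure_eq_measure ennreal_mult)
  qed (auto intro: X.sigma_finite_measure_axioms Y.sigma_finite_measure_axioms)
qed

text \<open>Fubini\<close>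

text \<open>
  Fubini's theorem for the product law: an expectation may first be taken over \<open>Z\<close>, with the history
  frozen.
\<close>

lemma (in prob_space) integral_indep_pair:
  fixes g :: "'u \<times> 's \<Rightarrow> real"
  assumes ind: "indep_set (sets F) (sets (vimage_algebra (space M) Z N))"
    and F: "subalgebra M F" and U: "U \<in> F \<rightarrow>\<^sub>M P" and Z: "random_variable N Z"
    and g: "g \<in> borel_measurable (P \<Otimes>\<^sub>M N)"
    and bound: "\<And>p. p \<in> space (P \<Otimes>\<^sub>M N) \<Longrightarrow> \<bar>g p\<bar> \<le> C"
  shows "(\<integral>\<omega>. g (U \<omega>, Z \<omega>) \<partial>M) = (\<integral>\<omega>. (\<integral>s. g (U \<omega>, s) \<partial>distr M N Z) \<partial>M)"
proof -
  have [measurable]: "U \<in> M \<rightarrow>\<^sub>M P" "Z \<in> M \<rightarrow>\<^sub>M N"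
    using measurable_from_subalg[OF F U] Z by auto
  have eq: "distr M P U \<Otimes>\<^sub>M distr M N Z = distr M (P \<Otimes>\<^sub>M N) (\<lambda>\<omega>. (U \<omega>, Z \<omega>))"
    by (rule distr_pair_indep[OF ind F U Z])
  interpret dU: prob_space "distr M P U" by (rule prob_space_distr) measurable
  interpret dZ: prob_space "distr M N Z" by (rule prob_space_distr) measurable
  interpret pair_prob_space "distr M P U" "distr M N Z" ..
  have gm: "g \<in> borel_measurable (distr M P U \<Otimes>\<^sub>M distr M N Z)" using g by simp
  have int: "integrable (distr M P U \<Otimes>\<^sub>M distr M N Z) g"
    by (rule P.integrable_const_bound[of _ C])
       (use gm bound in \<open>auto simp: space_pair_measure intro!: AE_I2\<close>)
  have "(\<integral>\<omega>. g (U \<omega>, Z \<omega>) \<partial>M) = (\<integral>p. g p \<partial>distr M (P \<Otimes>\<^sub>M N) (\<lambda>\<omega>. (U \<omega>, Z \<omega>)))"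
    by (subst integral_distr) (use g in auto)
  also have "\<dots> = (\<integral>u. (\<integral>s. g (u, s) \<partial>distr M N Z) \<partial>distr M P U)"
    unfolding eq[symmetric] by (rule integral_fst'[OF int, symmetric])
  also have "\<dots> = (\<integral>\<omega>. (\<integral>s. g (U \<omega>, s) \<partial>distr M N Z) \<partial>M)"
    by (subst integral_distr) (use gm in \<open>auto intro!: dZ.borel_measurable_lebesgue_integral\<close>)
  finally show ?thesis .
qed

lemma compensator_measurable:
  fixes \<theta> :: "'u \<times> 's \<Rightarrow> 'x::euclidean_space"
  assumes "prob_space \<mu>" and "\<theta> \<in> borel_measurable (P \<Otimes>\<^sub>M \<mu>)" and "U \<in> F \<rightarrow>\<^sub>M P"
  shows "(\<lambda>\<omega>. \<integral>s. \<theta> (U \<omega>, s) \<partial>\<mu>) \<in> borel_measurable F"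
proof -
  interpret prob_space \<mu> by fact
  have "(\<lambda>u. \<integral>s. \<theta> (u, s) \<partial>\<mu>) \<in> borel_measurable P"
    using assms(2) by (intro borel_measurable_lebesgue_integral) simp
  then show ?thesis by (rule measurable_compose[OF assms(3)])
qed

text \<open>
  The inner integral is the conditional mean of the decision \<open>\<theta> (U, Z)\<close> given the history.  Writing it
  as an integral over the law of \<open>Z\<close> gives a version that is defined at each sample point, so that
  pointwise optimality of the decisions can be used later.
\<close>

lemma (in prob_space) integral_inner_compensator:
  fixes \<theta> :: "'u \<times> 's \<Rightarrow> 'x::euclidean_space"
  assumes ind: "indep_set (sets F) (sets (vimage_algebra (space M) Z N))"
    and F: "subalgebra M F" and U: "U \<in> F \<rightarrow>\<^sub>M P" and Z: "random_variable N Z"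
    and \<theta>: "\<theta> \<in> borel_measurable (P \<Otimes>\<^sub>M N)"
    and \<theta>_bound: "\<And>u s. u \<in> space P \<Longrightarrow> s \<in> space N \<Longrightarrow> norm (\<theta> (u, s)) \<le> R"
    and W: "W \<in> borel_measurable F" and W_bound: "\<And>\<omega>. \<omega> \<in> space M \<Longrightarrow> norm (W \<omega>) \<le> C"
  shows "(\<integral>\<omega>. W \<omega> \<bullet> \<theta> (U \<omega>, Z \<omega>) \<partial>M)
       = (\<integral>\<omega>. W \<omega> \<bullet> (\<integral>s. \<theta> (U \<omega>, s) \<partial>distr M N Z) \<partial>M)"
proof -
  \<comment> \<open>The vector \<open>W\<close> joins the history variable, with its bound built into the space.\<close>
  let ?Q = "P \<Otimes>\<^sub>M restrict_space borel (cball (0::'x) C)"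
  let ?g = "\<lambda>p. snd (fst p) \<bullet> \<theta> (fst (fst p), snd p)"
  have sp: "space F = space M" using F by (simp add: subalgebra_def)
  interpret dZ: prob_space "distr M N Z" by (rule prob_space_distr[OF Z])
  have UW: "(\<lambda>\<omega>. (U \<omega>, W \<omega>)) \<in> F \<rightarrow>\<^sub>M ?Q"
    using W_bound sp by (intro measurable_Pair U measurable_restrict_space2 W) auto
  have s: "(\<lambda>p. snd (fst p)) \<in> borel_measurable (?Q \<Otimes>\<^sub>M N)"
    by (intro measurable_compose[OF measurable_compose[OF measurable_fst measurable_snd]]
          measurable_restrict_space1) simp
  have t: "(\<lambda>p. \<theta> (fst (fst p), snd p)) \<in> borel_measurable (?Q \<Otimes>\<^sub>M N)"
    by (intro measurable_compose[OF _ \<theta>]) measurable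
  have g: "?g \<in> borel_measurable (?Q \<Otimes>\<^sub>M N)"
    by (intro borel_measurable_inner s t)
  have b: "\<bar>?g p\<bar> \<le> C * R" if "p \<in> space (?Q \<Otimes>\<^sub>M N)" for p
  proof -
    from that obtain u w s where p: "p = ((u, w), s)" "u \<in> space P" "norm w \<le> C" "s \<in> space N"
      by (auto simp: space_pair_measure space_restrict_space)
    have "\<bar>w \<bullet> \<theta> (u, s)\<bar> \<le> norm w * norm (\<theta> (u, s))" by (rule Cauchy_Schwarz_ineq2)
    also have "\<dots> \<le> C * R"
      by (rule mult_mono) (use p \<theta>_bound[of u s] norm_ge_zero[of w] in \<open>auto intro: order_trans[OF norm_ge_zero]\<close>)
    finally show ?thesis using p by simp
  qed
  have i: "integrable (distr M N Z) (\<lambda>s. \<theta> (U \<omega>, s))" if "\<omega> \<in> space M" for \<omega>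
  proof (rule dZ.integrable_const_bound[of _ R])
    have u: "U \<omega> \<in> space P" using measurable_space[OF U] that sp by auto
    show "AE s in distr M N Z. norm (\<theta> (U \<omega>, s)) \<le> R"
      using \<theta>_bound[OF u] by (auto intro!: AE_I2)
    show "(\<lambda>s. \<theta> (U \<omega>, s)) \<in> borel_measurable (distr M N Z)"
      using measurable_compose_Pair1[OF u \<theta>] by simp
  qed
  have "(\<integral>\<omega>. W \<omega> \<bullet> \<theta> (U \<omega>, Z \<omega>) \<partial>M)
      = (\<integral>\<omega>. (\<integral>s. W \<omega> \<bullet> \<theta> (U \<omega>, s) \<partial>distr M N Z) \<partial>M)"
    using integral_indep_pair[OF ind F UW Z g b] by simp
  also have "\<dots> = (\<integral>\<omega>. W \<omega> \<bullet> (\<integral>s. \<theta> (U \<omega>, s) \<partial>distr M N Z) \<partial>M)"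
    using i by (intro Bochner_Integration.integral_cong) (auto intro!: integral_inner_right)
  finally show ?thesis .
qed

text \<open>
  Identical distribution lets every slot use the same law \<open>\<mu>\<close> for the inner integral.
\<close>

locale iid_history = prob_space M for M :: "'w measure" +
  fixes N :: "'s measure" and S :: "nat \<Rightarrow> 'w \<Rightarrow> 's" and J :: "'k measure" and \<alpha> :: "'w \<Rightarrow> 'k"
  assumes S_indep: "indep_vars (\<lambda>_. N) S UNIV"
    and S_ident: "\<And>t. distr M N (S t) = distr M N (S 0)"
    and \<alpha>_measurable: "\<alpha> \<in> M \<rightarrow>\<^sub>M J"
    and \<alpha>_indep: "indep_set (sets (vimage_algebra (space M) \<alpha> J))
          (sets (vimage_algebra (space M) (\<lambda>\<omega> t. S t \<omega>) (PiM UNIV (\<lambda>_. N))))"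
begin

abbreviation "\<mu> \<equiv> distr M N (S 0)"
abbreviation "H n \<equiv> history M n N S J \<alpha>"

lemma S_measurable: "S t \<in> M \<rightarrow>\<^sub>M N"
  using S_indep by (auto simp: indep_vars_def)

lemma S_in_space: "\<omega> \<in> space M \<Longrightarrow> S t \<omega> \<in> space N"
  using measurable_space[OF S_measurable] .

lemma prob_space_\<mu>: "prob_space \<mu>"
  by (rule prob_space_distr[OF S_measurable])

lemmas H_measurable = history_measurable[OF S_measurable \<alpha>_measurable]

lemma H_imp_M: "g \<in> H n \<rightarrow>\<^sub>M P \<Longrightarrow> g \<in> M \<rightarrow>\<^sub>M P"
  by (rule measurable_from_subalg[OF H_measurable(3)])

lemma bounded_integrable:
  fixes g :: "'w \<Rightarrow> 'x::{banach, second_countable_topology}"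
  assumes "g \<in> borel_measurable M" "\<And>\<omega>. \<omega> \<in> space M \<Longrightarrow> norm (g \<omega>) \<le> C"
  shows "integrable M g"
  using assms by (intro integrable_const_bound[of _ C]) (auto intro!: AE_I2)

lemma compensator:
  fixes \<theta> :: "'u \<times> 's \<Rightarrow> 'x::euclidean_space"
  assumes "U \<in> H n \<rightarrow>\<^sub>M P" and "\<theta> \<in> borel_measurable (P \<Otimes>\<^sub>M N)"
    and "\<And>u s. u \<in> space P \<Longrightarrow> s \<in> space N \<Longrightarrow> norm (\<theta> (u, s)) \<le> R"
    and "W \<in> borel_measurable (H n)" and "\<And>\<omega>. \<omega> \<in> space M \<Longrightarrow> norm (W \<omega>) \<le> C"
  shows "(\<integral>\<omega>. W \<omega> \<bullet> \<theta> (U \<omega>, S n \<omega>) \<partial>M) = (\<integral>\<omega>. W \<omega> \<bullet> (\<integral>s. \<theta> (U \<omega>, s) \<partial>\<mu>) \<partial>M)"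
  using integral_inner_compensator[OF indep_history[OF S_indep \<alpha>_measurable \<alpha>_indep]
      H_measurable(3) assms(1) S_measurable assms(2-5)]
  by (simp add: S_ident[of n])

end

section \<open>Conditional expectations of vectors\<close>

context finite_measure_subalgebra
begin

lemma vec_cond_exp_measurable: "vec_cond_exp M F Y \<in> borel_measurable F"
  by (subst borel_measurable_vec_iff) (simp add: vec_cond_exp_def)

text \<open>
  A crude bound, only used to make products with the conditional expectation integrable.
\<close>

lemma norm_vec_cond_exp_le:
  fixes Y :: "'a \<Rightarrow> real^'d"
  assumes Y: "Y \<in> borel_measurable M" "\<forall>\<omega>\<in>space M. norm (Y \<omega>) \<le> R"
  shows "AE \<omega> in M. norm (vec_cond_exp M F Y \<omega>) \<le> real CARD('d) * R"
proof -
  have Yj: "\<bar>Y \<omega> $ j\<bar> \<le> R" if "\<omega> \<in> space M" for \<omega> j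
    using component_le_norm_cart[of "Y \<omega>" j] bspec[OF Y(2) that] by linarith
  have i: "integrable M (\<lambda>\<omega>. Y \<omega> $ j)" for j
    using Y Yj by (intro integrable_const_bound[of _ R] borel_measurable_vec_component) (auto intro!: AE_I2)
  have "AE \<omega> in M. \<forall>j. \<bar>real_cond_exp M F (\<lambda>\<omega>. Y \<omega> $ j) \<omega>\<bar> \<le> R"
  proof (subst AE_all_countable, intro allI)
    fix j
    have u: "Y \<omega> $ j \<le> R" and l: "- R \<le> Y \<omega> $ j" if "\<omega> \<in> space M" for \<omega>
      using Yj[OF that, of j] by auto
    have "AE \<omega> in M. Y \<omega> $ j \<le> R" "AE \<omega> in M. - R \<le> Y \<omega> $ j"
      using u l by (auto intro!: AE_I2)
    from real_cond_exp_le_c[OF i this(1)] real_cond_exp_ge_c[OF i this(2)]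
    show "AE \<omega> in M. \<bar>real_cond_exp M F (\<lambda>\<omega>. Y \<omega> $ j) \<omega>\<bar> \<le> R"
      by eventually_elim auto
  qed
  then show ?thesis
  proof eventually_elim
    fix \<omega> assume *: "\<forall>j. \<bar>real_cond_exp M F (\<lambda>\<omega>. Y \<omega> $ j) \<omega>\<bar> \<le> R"
    have "norm (vec_cond_exp M F Y \<omega>) \<le> (\<Sum>j\<in>UNIV. \<bar>vec_cond_exp M F Y \<omega> $ j\<bar>)"
      by (rule norm_le_l1_cart)
    also have "\<dots> \<le> (\<Sum>j\<in>(UNIV::'d set). R)"
      using * by (intro sum_mono) (auto simp: vec_cond_exp_def)
    finally show "norm (vec_cond_exp M F Y \<omega>) \<le> real CARD('d) * R" by simp
  qed
qed

text \<open>
  The defining property of conditional expectation, tested against vectors instead of sets.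
\<close>

lemma integral_inner_vec_cond_exp:
  fixes Y W :: "'a \<Rightarrow> real^'d"
  assumes Y: "Y \<in> borel_measurable M" "\<forall>\<omega>\<in>space M. norm (Y \<omega>) \<le> R"
    and W: "W \<in> borel_measurable F" "AE \<omega> in M. norm (W \<omega>) \<le> C"
  shows "integrable M (\<lambda>\<omega>. W \<omega> \<bullet> vec_cond_exp M F Y \<omega>)"
    and "(\<integral>\<omega>. W \<omega> \<bullet> vec_cond_exp M F Y \<omega> \<partial>M) = (\<integral>\<omega>. W \<omega> \<bullet> Y \<omega> \<partial>M)"
proof -
  have WM: "W \<in> borel_measurable M" by (rule measurable_from_subalg[OF subalg W(1)])
  have i: "integrable M (\<lambda>\<omega>. W \<omega> $ j * Y \<omega> $ j)" for j
  proof (rule integrable_const_bound[of _ "C * R"])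
    show "AE \<omega> in M. norm (W \<omega> $ j * Y \<omega> $ j) \<le> C * R"
      using W(2) AE_space
    proof eventually_elim
      fix \<omega> assume a: "norm (W \<omega>) \<le> C" "\<omega> \<in> space M"
      have "\<bar>W \<omega> $ j\<bar> \<le> C" "\<bar>Y \<omega> $ j\<bar> \<le> R"
        using component_le_norm_cart[of "W \<omega>" j] component_le_norm_cart[of "Y \<omega>" j] bspec[OF Y(2) a(2)] a(1)
        by linarith+
      then show "norm (W \<omega> $ j * Y \<omega> $ j) \<le> C * R"
        by (simp add: abs_mult) (intro mult_mono, auto intro: order_trans[OF abs_ge_zero])
    qed
  qed (use WM Y in measurable)
  have Wj: "(\<lambda>\<omega>. W \<omega> $ j) \<in> borel_measurable F" "(\<lambda>\<omega>. Y \<omega> $ j) \<in> borel_measurable M" for j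
    using W Y by measurable
  note c = real_cond_exp_intg[OF i Wj]
  show "integrable M (\<lambda>\<omega>. W \<omega> \<bullet> vec_cond_exp M F Y \<omega>)"
    using c(1) by (simp add: inner_vec_def vec_cond_exp_def)
  show "(\<integral>\<omega>. W \<omega> \<bullet> vec_cond_exp M F Y \<omega> \<partial>M) = (\<integral>\<omega>. W \<omega> \<bullet> Y \<omega> \<partial>M)"
    using c i by (simp add: inner_vec_def vec_cond_exp_def Bochner_Integration.integral_sum)
qed

text \<open>
  Let \<open>p\<close> be the projection of \<open>E = E[Y|F]\<close> to \<open>\<B>\<close>.  The direction \<open>E - p\<close> is \<open>F\<close>-measurable and
  makes an obtuse angle with \<open>Y - p\<close>.  Testing against it replaces \<open>Y\<close> by \<open>E\<close> and gives
  \<open>\<integral> \<parallel>E - p\<parallel>\<^sup>2 \<le> 0\<close>.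
\<close>

lemma vec_cond_exp_in_convex:
  fixes Y :: "'a \<Rightarrow> real^'d"
  assumes Y: "Y \<in> borel_measurable M" "\<And>\<omega>. \<omega> \<in> space M \<Longrightarrow> Y \<omega> \<in> \<B>"
    and B: "compact \<B>" "convex \<B>" "\<B> \<noteq> {}"
  shows "AE \<omega> in M. vec_cond_exp M F Y \<omega> \<in> \<B>"
proof -
  let ?E = "vec_cond_exp M F Y"
  define p where "p \<omega> = closest_point \<B> (?E \<omega>)" for \<omega>
  note cl = compact_imp_closed[OF B(1)]
  obtain R where R: "\<And>z. z \<in> \<B> \<Longrightarrow> norm z \<le> R"
    using compact_imp_bounded[OF B(1)] by (auto simp: bounded_iff)
  have YR: "\<forall>\<omega>\<in>space M. norm (Y \<omega>) \<le> R" using R Y(2) by blast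
  have pB: "p \<omega> \<in> \<B>" for \<omega> unfolding p_def by (rule closest_point_in_set[OF cl B(3)])
  have E: "?E \<in> borel_measurable F" by (rule vec_cond_exp_measurable)
  have p: "p \<in> borel_measurable F" unfolding p_def
    by (intro measurable_compose[OF E] borel_measurable_continuous_onI continuous_on_closest_point B(2) cl B(3))
  let ?W = "\<lambda>\<omega>. ?E \<omega> - p \<omega>"
  have W: "?W \<in> borel_measurable F" using E p by measurable
  have WM: "?W \<in> borel_measurable M" by (rule measurable_from_subalg[OF subalg W])
  have pM: "p \<in> borel_measurable M" by (rule measurable_from_subalg[OF subalg p])
  have Wb: "AE \<omega> in M. norm (?W \<omega>) \<le> real CARD('d) * R + R"
    using norm_vec_cond_exp_le[OF Y(1) YR]
  proof eventually_elim
    fix \<omega> assume "norm (?E \<omega>) \<le> real CARD('d) * R"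
    then show "norm (?W \<omega>) \<le> real CARD('d) * R + R"
      using norm_triangle_ineq4[of "?E \<omega>" "p \<omega>"] R[OF pB[of \<omega>]] by linarith
  qed
  note WE = integral_inner_vec_cond_exp[OF Y(1) YR W Wb]
  have bdd: "integrable M (\<lambda>\<omega>. ?W \<omega> \<bullet> Q \<omega>)" if "Q \<in> borel_measurable M" "\<And>\<omega>. \<omega> \<in> space M \<Longrightarrow> Q \<omega> \<in> \<B>" for Q
  proof (rule integrable_const_bound[of _ "(real CARD('d) * R + R) * R"])
    show "AE \<omega> in M. norm (?W \<omega> \<bullet> Q \<omega>) \<le> (real CARD('d) * R + R) * R"
      using Wb AE_space
    proof eventually_elim
      fix \<omega> assume a: "norm (?W \<omega>) \<le> real CARD('d) * R + R" "\<omega> \<in> space M"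
      have "norm (?W \<omega> \<bullet> Q \<omega>) \<le> norm (?W \<omega>) * norm (Q \<omega>)" by (simp add: Cauchy_Schwarz_ineq2)
      also have "\<dots> \<le> (real CARD('d) * R + R) * R"
        using a R[OF that(2)] by (intro mult_mono) (auto intro: order_trans[OF norm_ge_zero])
      finally show "norm (?W \<omega> \<bullet> Q \<omega>) \<le> (real CARD('d) * R + R) * R" .
    qed
  qed (use WM that in measurable)
  have iY: "integrable M (\<lambda>\<omega>. ?W \<omega> \<bullet> Y \<omega>)" and ip: "integrable M (\<lambda>\<omega>. ?W \<omega> \<bullet> p \<omega>)"
    using Y pM pB by (auto intro: bdd)
  have sq: "(norm (?W \<omega>))\<^sup>2 = ?W \<omega> \<bullet> ?E \<omega> - ?W \<omega> \<bullet> p \<omega>" for \<omega>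
    by (simp add: power2_norm_eq_inner inner_diff_right)
  have i2: "integrable M (\<lambda>\<omega>. (norm (?W \<omega>))\<^sup>2)" unfolding sq using WE(1) ip by simp
  have "(\<integral>\<omega>. (norm (?W \<omega>))\<^sup>2 \<partial>M) = (\<integral>\<omega>. ?W \<omega> \<bullet> Y \<omega> - ?W \<omega> \<bullet> p \<omega> \<partial>M)"
    unfolding sq using WE ip iY by simp
  also have "\<dots> \<le> (\<integral>\<omega>. 0 \<partial>M)"
  proof (rule integral_mono)
    fix \<omega> assume "\<omega> \<in> space M"
    then show "?W \<omega> \<bullet> Y \<omega> - ?W \<omega> \<bullet> p \<omega> \<le> 0"
      using closest_point_dot[OF B(2) cl Y(2)[of \<omega>], of "?E \<omega>"] by (simp add: p_def inner_diff_right)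
  qed (use iY ip in auto)
  finally have "(\<integral>\<omega>. (norm (?W \<omega>))\<^sup>2 \<partial>M) = 0"
    by (intro antisym) (auto intro: integral_nonneg_AE)
  then have "AE \<omega> in M. (norm (?W \<omega>))\<^sup>2 = 0" using integral_nonneg_eq_0_iff_AE[OF i2] by simp
  then show ?thesis
  proof eventually_elim
    fix \<omega> assume "(norm (?W \<omega>))\<^sup>2 = 0"
    then show "?E \<omega> \<in> \<B>" using pB[of \<omega>] by simp
  qed
qed

text \<open>
  Pythagoras: \<open>E[Y|F] - h\<close> is \<open>F\<close>-measurable, hence orthogonal to \<open>Y - E[Y|F]\<close>.
\<close>

lemma vec_cond_exp_contraction:
  fixes Y h :: "'a \<Rightarrow> real^'d"
  assumes Y: "Y \<in> borel_measurable M" "\<forall>\<omega>\<in>space M. norm (Y \<omega>) \<le> R"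
    and h: "h \<in> borel_measurable F" "\<forall>\<omega>\<in>space M. norm (h \<omega>) \<le> R"
  shows "integrable M (\<lambda>\<omega>. (norm (vec_cond_exp M F Y \<omega> - h \<omega>))\<^sup>2)"
    and "(\<integral>\<omega>. (norm (vec_cond_exp M F Y \<omega> - h \<omega>))\<^sup>2 \<partial>M) \<le> (\<integral>\<omega>. (norm (Y \<omega> - h \<omega>))\<^sup>2 \<partial>M)"
proof -
  let ?E = "vec_cond_exp M F Y" and ?W = "\<lambda>\<omega>. vec_cond_exp M F Y \<omega> - h \<omega>"
  let ?C = "real CARD('d) * R + R"
  have W: "?W \<in> borel_measurable F" using vec_cond_exp_measurable h(1) by measurable
  have WM: "?W \<in> borel_measurable M" by (rule measurable_from_subalg[OF subalg W])
  have hM: "h \<in> borel_measurable M" by (rule measurable_from_subalg[OF subalg h(1)])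
  have Wb: "AE \<omega> in M. norm (?W \<omega>) \<le> ?C"
    using norm_vec_cond_exp_le[OF Y] AE_space
  proof eventually_elim
    fix \<omega> assume "norm (?E \<omega>) \<le> real CARD('d) * R" and \<omega>: "\<omega> \<in> space M"
    then show "norm (?W \<omega>) \<le> ?C"
      using norm_triangle_ineq4[of "?E \<omega>" "h \<omega>"] bspec[OF h(2) \<omega>] by linarith
  qed
  note WE = integral_inner_vec_cond_exp[OF Y W Wb]
  show i2: "integrable M (\<lambda>\<omega>. (norm (?W \<omega>))\<^sup>2)"
  proof (rule integrable_const_bound[of _ "?C\<^sup>2"])
    show "AE \<omega> in M. norm ((norm (?W \<omega>))\<^sup>2) \<le> ?C\<^sup>2"
      using Wb by eventually_elim (auto intro!: power_mono)
  qed (use WM in measurable)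
  have iWY: "integrable M (\<lambda>\<omega>. ?W \<omega> \<bullet> Y \<omega>)"
  proof (rule integrable_const_bound[of _ "?C * R"])
    show "AE \<omega> in M. norm (?W \<omega> \<bullet> Y \<omega>) \<le> ?C * R"
      using Wb AE_space
    proof eventually_elim
      fix \<omega> assume a: "norm (?W \<omega>) \<le> ?C" "\<omega> \<in> space M"
      have "norm (?W \<omega> \<bullet> Y \<omega>) \<le> norm (?W \<omega>) * norm (Y \<omega>)" by (simp add: Cauchy_Schwarz_ineq2)
      also have "\<dots> \<le> ?C * R"
        using a Y(2) by (intro mult_mono) (auto intro: order_trans[OF norm_ge_zero])
      finally show "norm (?W \<omega> \<bullet> Y \<omega>) \<le> ?C * R" .
    qed
  qed (use WM Y in measurable)
  have i3: "integrable M (\<lambda>\<omega>. (norm (Y \<omega> - h \<omega>))\<^sup>2)"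
  proof (rule integrable_const_bound[of _ "(2 * R)\<^sup>2"])
    have "norm ((norm (Y \<omega> - h \<omega>))\<^sup>2) \<le> (2 * R)\<^sup>2" if "\<omega> \<in> space M" for \<omega>
    proof -
      have "norm (Y \<omega> - h \<omega>) \<le> 2 * R"
        using norm_triangle_ineq4[of "Y \<omega>" "h \<omega>"] bspec[OF Y(2) that] bspec[OF h(2) that] by linarith
      then show ?thesis using power_mono[of "norm (Y \<omega> - h \<omega>)" "2 * R" 2] by simp
    qed
    then show "AE \<omega> in M. norm ((norm (Y \<omega> - h \<omega>))\<^sup>2) \<le> (2 * R)\<^sup>2" by (rule AE_I2)
  qed (use Y hM in measurable)
  have pw: "(norm (?W \<omega>))\<^sup>2 + 2 * (?W \<omega> \<bullet> Y \<omega> - ?W \<omega> \<bullet> ?E \<omega>) \<le> (norm (Y \<omega> - h \<omega>))\<^sup>2" for \<omega>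
  proof -
    have "(norm (Y \<omega> - h \<omega>))\<^sup>2 = (norm (?W \<omega>))\<^sup>2 + 2 * (?W \<omega> \<bullet> (Y \<omega> - ?E \<omega>)) + (norm (Y \<omega> - ?E \<omega>))\<^sup>2"
      unfolding power2_norm_eq_inner by (simp add: inner_diff_left inner_diff_right inner_commute)
    then show ?thesis by (simp add: inner_diff_right)
  qed
  have "(\<integral>\<omega>. (norm (?W \<omega>))\<^sup>2 \<partial>M) = (\<integral>\<omega>. (norm (?W \<omega>))\<^sup>2 + 2 * (?W \<omega> \<bullet> Y \<omega> - ?W \<omega> \<bullet> ?E \<omega>) \<partial>M)"
    using WE i2 iWY by simp
  also have "\<dots> \<le> (\<integral>\<omega>. (norm (Y \<omega> - h \<omega>))\<^sup>2 \<partial>M)"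
    using WE(1) i2 iWY i3 pw by (intro integral_mono) auto
  finally show "(\<integral>\<omega>. (norm (?W \<omega>))\<^sup>2 \<partial>M) \<le> (\<integral>\<omega>. (norm (Y \<omega> - h \<omega>))\<^sup>2 \<partial>M)" .
qed

end

section \<open>Expected decisions of stationary algorithms\<close>

lemma stationary_law:
  fixes X :: "'s \<Rightarrow> 'x::euclidean_space set"
  assumes \<mu>: "prob_space \<mu>" and B: "compact \<B>"
    and XB: "\<forall>s\<in>space \<mu>. X s \<subseteq> \<B>"
    and \<kappa>: "\<kappa> \<in> stationary_kernels \<mu> X"
  shows "prob_space (\<mu> \<bind> \<kappa>)" and "sets (\<mu> \<bind> \<kappa>) = sets borel"
    and "AE x in \<mu> \<bind> \<kappa>. x \<in> \<B>" and "integrable (\<mu> \<bind> \<kappa>) (\<lambda>x. x)"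
proof -
  have km: "\<kappa> \<in> \<mu> \<rightarrow>\<^sub>M prob_algebra borel" and kX: "\<And>s. s \<in> space \<mu> \<Longrightarrow> AE x in \<kappa> s. x \<in> X s"
    using \<kappa> by (auto simp: stationary_kernels_def)
  let ?\<nu> = "\<mu> \<bind> \<kappa>"
  have sp: "\<mu> \<in> space (prob_algebra \<mu>)" using \<mu> by (simp add: space_prob_algebra)
  show p: "prob_space ?\<nu>" by (rule prob_space_bind'[OF sp km])
  interpret \<nu>: prob_space ?\<nu> by (rule p)
  show s\<nu> [measurable_cong]: "sets ?\<nu> = sets borel" by (rule sets_bind'[OF sp km])
  obtain R where R: "\<And>z. z \<in> \<B> \<Longrightarrow> norm z \<le> R"
    using compact_imp_bounded[OF B] by (auto simp: bounded_iff)
  have "AE s in \<mu>. AE x in \<kappa> s. x \<in> \<B>"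
  proof (rule AE_I2)
    fix s assume "s \<in> space \<mu>"
    with kX[OF this] bspec[OF XB this] show "AE x in \<kappa> s. x \<in> \<B>" by (auto elim: eventually_mono)
  qed
  then show \<nu>B: "AE x in ?\<nu>. x \<in> \<B>"
    using compact_imp_closed[OF B]
    by (subst AE_bind[OF measurable_prob_algebraD[OF km]]) (auto simp: pred_def)
  show "integrable ?\<nu> (\<lambda>x. x)"
    using \<nu>B R by (intro \<nu>.integrable_const_bound[of _ R]) (auto elim: eventually_mono)
qed

text \<open>
  A pointwise minimizer of \<open>w\<close> over the options is at least as good as a draw from any kernel, state by
  state; integration over the state gives the inequality on \<open>\<Gamma>\<close>, and half-spaces are closed.
\<close>

lemma Gamma_star_support:
  fixes X :: "'s \<Rightarrow> 'x::euclidean_space set"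
  assumes \<mu>: "prob_space \<mu>" and B: "compact \<B>"
    and XB: "\<And>s. s \<in> space \<mu> \<Longrightarrow> X s \<subseteq> \<B>"
    and v: "v \<in> closure (Gamma_star \<mu> X)"
    and g: "g \<in> borel_measurable \<mu>"
    and g_min: "\<And>s. s \<in> space \<mu> \<Longrightarrow> g s \<in> X s \<and> (\<forall>z\<in>X s. w \<bullet> g s \<le> w \<bullet> z)"
  shows "w \<bullet> (\<integral>s. g s \<partial>\<mu>) \<le> w \<bullet> v"
proof -
  interpret prob_space \<mu> by fact
  obtain R where R: "\<And>z. z \<in> \<B> \<Longrightarrow> norm z \<le> R"
    using compact_imp_bounded[OF B] by (auto simp: bounded_iff)
  have gB: "norm (g s) \<le> R" if "s \<in> space \<mu>" for s using g_min XB R that by blast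
  have g_int: "integrable \<mu> g"
    using g gB by (intro integrable_const_bound[of _ R]) (auto intro!: AE_I2)
  \<comment> \<open>Shifting by \<open>c\<close> makes the functional nonnegative, so that the integral over \<open>\<mu> \<bind> \<kappa>\<close> can be
    iterated as a nonnegative integral.\<close>
  define c where "c = norm w * R"
  have lower: "w \<bullet> z + c \<ge> 0" if "norm z \<le> R" for z
  proof -
    have "norm w * norm z \<le> c" unfolding c_def by (intro mult_left_mono that) auto
    then show ?thesis using Cauchy_Schwarz_ineq2[of w z] by linarith
  qed
  have main: "w \<bullet> (\<integral>s. g s \<partial>\<mu>) \<le> w \<bullet> (\<integral>x. x \<partial>(\<mu> \<bind> \<kappa>))"
    if k: "\<kappa> \<in> stationary_kernels \<mu> X" for \<kappa>
  proof -
    have km: "\<kappa> \<in> \<mu> \<rightarrow>\<^sub>M prob_algebra borel" and kX: "\<And>s. s \<in> space \<mu> \<Longrightarrow> AE x in \<kappa> s. x \<in> X s"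
      using k by (auto simp: stationary_kernels_def)
    let ?\<nu> = "\<mu> \<bind> \<kappa>"
    have XB': "\<forall>s\<in>space \<mu>. X s \<subseteq> \<B>" using XB by blast
    interpret \<nu>: prob_space ?\<nu> by (rule stationary_law(1)[OF \<mu> B XB' k])
    note s\<nu> [measurable_cong] = stationary_law(2)[OF \<mu> B XB' k]
    note \<nu>B = stationary_law(3)[OF \<mu> B XB' k] and \<nu>_int = stationary_law(4)[OF \<mu> B XB' k]
    have ks: "prob_space (\<kappa> s)" "sets (\<kappa> s) = sets borel" if "s \<in> space \<mu>" for s
      using measurable_space[OF km that] by (auto simp: space_prob_algebra)
    have pos: "AE x in ?\<nu>. 0 \<le> w \<bullet> x + c"
      using \<nu>B by eventually_elim (rule lower[OF R])
    have "ennreal (\<integral>s. w \<bullet> g s + c \<partial>\<mu>) = (\<integral>\<^sup>+s. ennreal (w \<bullet> g s + c) \<partial>\<mu>)"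
      using g_int gB lower by (intro nn_integral_eq_integral[symmetric]) (auto intro!: AE_I2)
    also have "\<dots> \<le> (\<integral>\<^sup>+s. \<integral>\<^sup>+x. ennreal (w \<bullet> x + c) \<partial>\<kappa> s \<partial>\<mu>)"
    proof (rule nn_integral_mono)
      fix s assume s: "s \<in> space \<mu>"
      interpret ks: prob_space "\<kappa> s" by (rule ks(1)[OF s])
      have "ennreal (w \<bullet> g s + c) = (\<integral>\<^sup>+x. ennreal (w \<bullet> g s + c) \<partial>\<kappa> s)"
        by (simp add: ks.emeasure_space_1)
      also have "\<dots> \<le> (\<integral>\<^sup>+x. ennreal (w \<bullet> x + c) \<partial>\<kappa> s)"
      proof (rule nn_integral_mono_AE)
        show "AE x in \<kappa> s. ennreal (w \<bullet> g s + c) \<le> ennreal (w \<bullet> x + c)"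
          using kX[OF s] by eventually_elim (use g_min[OF s] in \<open>auto intro!: ennreal_leI\<close>)
      qed
      finally show "ennreal (w \<bullet> g s + c) \<le> (\<integral>\<^sup>+x. ennreal (w \<bullet> x + c) \<partial>\<kappa> s)" .
    qed
    also have "\<dots> = (\<integral>\<^sup>+x. ennreal (w \<bullet> x + c) \<partial>?\<nu>)"
      by (rule nn_integral_bind[OF _ measurable_prob_algebraD[OF km], symmetric]) measurable
    also have "\<dots> = ennreal (\<integral>x. w \<bullet> x + c \<partial>?\<nu>)"
      using \<nu>_int pos by (intro nn_integral_eq_integral) auto
    finally have le: "ennreal (\<integral>s. w \<bullet> g s + c \<partial>\<mu>) \<le> ennreal (\<integral>x. w \<bullet> x + c \<partial>?\<nu>)" .
    have "0 \<le> (\<integral>x. w \<bullet> x + c \<partial>?\<nu>)"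
      using pos by (rule integral_nonneg_AE)
    with le have "(\<integral>s. w \<bullet> g s + c \<partial>\<mu>) \<le> (\<integral>x. w \<bullet> x + c \<partial>?\<nu>)"
      by (simp add: ennreal_le_iff)
    then show ?thesis using g_int \<nu>_int by (simp add: prob_space \<nu>.prob_space)
  qed
  have "closure (Gamma_star \<mu> X) \<subseteq> {v. w \<bullet> (\<integral>s. g s \<partial>\<mu>) \<le> w \<bullet> v}"
    by (rule closure_minimal) (auto simp: Gamma_star_def intro!: main closed_halfspace_ge)
  then show ?thesis using v by blast
qed

lemma closure_Gamma_star_subset:
  fixes X :: "'s \<Rightarrow> 'x::euclidean_space set"
  assumes \<mu>: "prob_space \<mu>" and B: "compact \<B>" "convex \<B>"
    and XB: "\<And>s. s \<in> space \<mu> \<Longrightarrow> X s \<subseteq> \<B>"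
  shows "closure (Gamma_star \<mu> X) \<subseteq> \<B>"
proof (rule closure_minimal)
  show "closed \<B>" by (rule compact_imp_closed[OF B(1)])
  show "Gamma_star \<mu> X \<subseteq> \<B>"
  proof
    fix v assume "v \<in> Gamma_star \<mu> X"
    then obtain \<kappa> where k: "\<kappa> \<in> stationary_kernels \<mu> X" and v: "v = (\<integral>x. x \<partial>(\<mu> \<bind> \<kappa>))"
      by (auto simp: Gamma_star_def)
    have XB': "\<forall>s\<in>space \<mu>. X s \<subseteq> \<B>" using XB by blast
    note law = stationary_law[OF \<mu> B(1) XB' k]
    show "v \<in> \<B>" unfolding v
      by (rule prob_space.expectation_in_closed_convex[OF law(1) B(2) compact_imp_closed[OF B(1)] law(4,3)])
  qed
qed

section \<open>The Frank-Wolfe gap\<close>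

locale smooth_objective =
  fixes \<B> :: "(real^'d) set" and f :: "real^'d \<Rightarrow> real" and Df :: "real^'d \<Rightarrow> real^'d"
    and L Mg K D :: real
  assumes domain: "compact \<B>" "convex \<B>"
    and gradient: "\<And>z. z \<in> \<B> \<Longrightarrow> (f has_derivative (\<lambda>h. Df z \<bullet> h)) (at z within \<B>)"
    and smooth: "L-lipschitz_on \<B> Df"
    and grad_bound: "\<And>z. z \<in> \<B> \<Longrightarrow> norm (Df z) \<le> Mg"
    and f_bound: "\<And>z. z \<in> \<B> \<Longrightarrow> \<bar>f z\<bar> \<le> K"
    and diameter: "\<And>z z'. z \<in> \<B> \<Longrightarrow> z' \<in> \<B> \<Longrightarrow> norm (z - z') \<le> D"
begin

lemma L_nonneg: "0 \<le> L" using smooth by (rule lipschitz_on_nonneg)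

lemma \<B>_borel [measurable]: "\<B> \<in> sets borel"
  using domain(1) by (intro borel_closed compact_imp_closed)

lemma gap_integrand_le:
  assumes "z \<in> \<B>" "v \<in> \<B>"
  shows "\<bar>Df z \<bullet> (z - v)\<bar> \<le> Mg * D"
proof -
  have "\<bar>Df z \<bullet> (z - v)\<bar> \<le> norm (Df z) * norm (z - v)" by (rule Cauchy_Schwarz_ineq2)
  also have "\<dots> \<le> Mg * D"
    using assms grad_bound diameter by (intro mult_mono) (auto intro: order_trans[OF norm_ge_zero])
  finally show ?thesis .
qed

lemma FW_gap_upper:
  assumes "C \<noteq> {}" "C \<subseteq> \<B>" "z \<in> \<B>" and "\<And>v. v \<in> C \<Longrightarrow> Df z \<bullet> (z - v) \<le> c"
  shows "FW_gap \<B> Df C z \<le> c"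
  using assms by (auto simp: FW_gap_def intro!: cSUP_least)

lemma FW_gap_ge:
  assumes "C \<subseteq> \<B>" "z \<in> \<B>" "v \<in> C"
  shows "Df z \<bullet> (z - v) \<le> FW_gap \<B> Df C z"
proof -
  have "bdd_above ((\<lambda>v. Df z \<bullet> (z - v)) ` C)"
    using gap_integrand_le[OF assms(2)] assms(1) by (intro bdd_aboveI2[of _ _ "Mg * D"]) fastforce
  then show ?thesis using assms by (auto simp: FW_gap_def intro!: cSUP_upper)
qed

lemma FW_gap_abs_le:
  assumes "C \<noteq> {}" "C \<subseteq> \<B>" "z \<in> \<B>"
  shows "\<bar>FW_gap \<B> Df C z\<bar> \<le> Mg * D"
proof -
  obtain v where v: "v \<in> C" using assms by auto
  have "FW_gap \<B> Df C z \<le> Mg * D"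
    using assms gap_integrand_le[OF assms(3)] by (intro FW_gap_upper) fastforce+
  moreover have "- (Mg * D) \<le> FW_gap \<B> Df C z"
    using FW_gap_ge[OF assms(2,3) v] gap_integrand_le[OF assms(3), of v] v assms(2) by force
  ultimately show ?thesis by linarith
qed

text \<open>
  For fixed \<open>v\<close>, moving the base point changes \<open>\<nabla>f(z) \<bullet> (z - v)\<close> by at most \<open>L \<parallel>z - z'\<parallel> D\<close>
  through the gradient and by at most \<open>M \<parallel>z - z'\<parallel>\<close> through the point.
\<close>

lemma FW_gap_le_add:
  assumes C: "C \<noteq> {}" "C \<subseteq> \<B>" and z: "z \<in> \<B>" "z' \<in> \<B>"
  shows "FW_gap \<B> Df C z \<le> FW_gap \<B> Df C z' + (L * D + Mg) * norm (z - z')"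
proof (rule FW_gap_upper[OF C z(1)])
  fix v assume v: "v \<in> C"
  then have vB: "v \<in> \<B>" using C by auto
  have "Df z \<bullet> (z - v) = Df z' \<bullet> (z' - v) + (Df z - Df z') \<bullet> (z - v) + Df z' \<bullet> (z - z')"
    by (simp add: inner_diff_left inner_diff_right)
  moreover have "(Df z - Df z') \<bullet> (z - v) \<le> L * norm (z - z') * D"
  proof -
    have "(Df z - Df z') \<bullet> (z - v) \<le> norm (Df z - Df z') * norm (z - v)" by (rule norm_cauchy_schwarz)
    also have "\<dots> \<le> L * norm (z - z') * D"
      using lipschitz_onD[OF smooth z] diameter[OF z(1) vB] L_nonneg
      by (intro mult_mono) (auto simp: dist_norm)
    finally show ?thesis .
  qed
  moreover have "Df z' \<bullet> (z - z') \<le> Mg * norm (z - z')"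
    using norm_cauchy_schwarz[of "Df z'" "z - z'"] mult_right_mono[OF grad_bound[OF z(2)], of "norm (z - z')"]
    by simp
  ultimately show "Df z \<bullet> (z - v) \<le> FW_gap \<B> Df C z' + (L * D + Mg) * norm (z - z')"
    using FW_gap_ge[OF C(2) z(2) v] by (simp add: algebra_simps)
qed

lemma FW_gap_measurable:
  assumes C: "C \<noteq> {}" "C \<subseteq> \<B>"
  shows "FW_gap \<B> Df C \<in> borel_measurable borel"
proof -
  have "(L * D + Mg)-lipschitz_on \<B> (FW_gap \<B> Df C)" if ne: "\<B> \<noteq> {}"
  proof (rule lipschitz_onI)
    show "0 \<le> L * D + Mg"
    proof -
      obtain z where "z \<in> \<B>" using ne by auto
      then show ?thesis using L_nonneg grad_bound[of z] diameter[of z z]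
        by (metis add_nonneg_nonneg mult_nonneg_nonneg norm_ge_zero order_trans)
    qed
    fix z z' assume "z \<in> \<B>" "z' \<in> \<B>"
    then show "dist (FW_gap \<B> Df C z) (FW_gap \<B> Df C z') \<le> (L * D + Mg) * dist z z'"
      using FW_gap_le_add[OF C, of z z'] FW_gap_le_add[OF C, of z' z]
      by (auto simp: dist_norm norm_minus_commute abs_le_iff)
  qed
  then have "continuous_on \<B> (FW_gap \<B> Df C)"
    using lipschitz_on_continuous_on by (cases "\<B> = {}") auto
  then have "(\<lambda>z. if z \<in> \<B> then FW_gap \<B> Df C z else 0) \<in> borel_measurable borel"
    by (intro borel_measurable_continuous_on_if) auto
  moreover have "(\<lambda>z. if z \<in> \<B> then FW_gap \<B> Df C z else 0) = FW_gap \<B> Df C"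
    by (auto simp: FW_gap_def)
  ultimately show ?thesis by simp
qed

end

section \<open>First phase: drift plus penalty\<close>

locale first_phase = iid_history M N S J \<alpha> + smooth_objective \<B> f Df L Mg K D
  for M :: "'w measure" and N :: "'s measure" and S J and \<alpha> :: "'w \<Rightarrow> 'k"
    and \<B> :: "(real^'d) set" and f Df L Mg K D +
  fixes X :: "'s \<Rightarrow> (real^'d) set" and A :: "real^'d^'n" and b :: "real^'n"
    and B V \<eta> :: real and T :: nat
    and \<phi> :: "nat \<Rightarrow> real^'d \<Rightarrow> real^'n \<Rightarrow> 's \<Rightarrow> real^'d"
    and x :: "nat \<Rightarrow> 'w \<Rightarrow> real^'d" and \<gamma> :: "int \<Rightarrow> 'w \<Rightarrow> real^'d" and Q :: "nat \<Rightarrow> 'w \<Rightarrow> real^'n"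
  assumes X_sub: "\<And>s. s \<in> space N \<Longrightarrow> X s \<subseteq> \<B>"
    and zero: "0 \<in> closure (Gamma_star (distr M N (S 0)) X)"
    and feasible: "feasible_set (Gamma_star (distr M N (S 0)) X) A b \<noteq> {}"
    and constr_bound: "\<And>z. z \<in> \<B> \<Longrightarrow> (\<Sum>i\<in>UNIV. \<bar>row i A \<bullet> z - b $ i\<bar>\<^sup>2) \<le> B\<^sup>2"
    and V_pos: "0 < V" and \<eta>_pos: "0 < \<eta>" and \<eta>_le: "\<eta> \<le> 1"
    and \<phi>_measurable: "\<And>t. t < T \<Longrightarrow>
          (\<lambda>(g, q, s). \<phi> t g q s) \<in> borel \<Otimes>\<^sub>M borel \<Otimes>\<^sub>M N \<rightarrow>\<^sub>M borel"
    and \<phi>_argmin: "\<And>t g q s. t < T \<Longrightarrow> g \<in> \<B> \<Longrightarrow> 0 \<le> q \<Longrightarrow> s \<in> space N \<Longrightarrow>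
          is_arg_min (\<lambda>z. V * (Df g \<bullet> z) + (\<Sum>i\<in>UNIV. q $ i * (row i A \<bullet> z)))
            (\<lambda>z. z \<in> X s) (\<phi> t g q s)"
    and \<gamma>_init: "\<And>\<omega>. \<omega> \<in> space M \<Longrightarrow> \<gamma> (-1) \<omega> = 0"
    and Q_init: "\<And>\<omega>. \<omega> \<in> space M \<Longrightarrow> Q 0 \<omega> = 0"
    and x_step: "\<And>t \<omega>. t < T \<Longrightarrow> \<omega> \<in> space M \<Longrightarrow>
          x t \<omega> = \<phi> t (\<gamma> (int t - 1) \<omega>) (Q t \<omega>) (S t \<omega>)"
    and \<gamma>_step: "\<And>t \<omega>. t < T \<Longrightarrow> \<omega> \<in> space M \<Longrightarrow>
          \<gamma> (int t) \<omega> = (1 - \<eta>) *\<^sub>R \<gamma> (int t - 1) \<omega> + \<eta> *\<^sub>R x t \<omega>"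
    and Q_step: "\<And>t \<omega> i. t < T \<Longrightarrow> \<omega> \<in> space M \<Longrightarrow>
          Q (Suc t) \<omega> $ i = max (Q t \<omega> $ i + row i A \<bullet> x t \<omega> - b $ i) 0"
begin

abbreviation "\<Gamma> \<equiv> Gamma_star \<mu> X"
abbreviation "\<G> \<equiv> FW_gap \<B> Df (feasible_set \<Gamma> A b)"

lemma closure_\<Gamma>_sub: "closure \<Gamma> \<subseteq> \<B>"
  using X_sub by (intro closure_Gamma_star_subset prob_space_\<mu> domain) simp

lemma feasible_sub: "feasible_set \<Gamma> A b \<subseteq> \<B>"
  using closure_\<Gamma>_sub by (auto simp: feasible_set_def)

lemma zero_in: "0 \<in> \<B>" using zero closure_\<Gamma>_sub by auto

lemma norm_le_D: "z \<in> \<B> \<Longrightarrow> norm z \<le> D"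
  using diameter[OF _ zero_in] by simp

lemma D_nonneg: "0 \<le> D" using norm_le_D[OF zero_in] by simp
lemma Mg_nonneg: "0 \<le> Mg" using grad_bound[OF zero_in] by (meson norm_ge_zero order_trans)
lemma K_nonneg: "0 \<le> K" using f_bound[OF zero_in] by (meson abs_ge_zero order_trans)

lemma \<phi>_in: "t < T \<Longrightarrow> g \<in> \<B> \<Longrightarrow> 0 \<le> q \<Longrightarrow> s \<in> space N \<Longrightarrow> \<phi> t g q s \<in> X s"
  using \<phi>_argmin by (simp add: is_arg_min_def)

lemma \<phi>_in_\<B>: "t < T \<Longrightarrow> g \<in> \<B> \<Longrightarrow> 0 \<le> q \<Longrightarrow> s \<in> space N \<Longrightarrow> \<phi> t g q s \<in> \<B>"
  using \<phi>_in X_sub by blast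

lemma iterates_in:
  assumes \<omega>: "\<omega> \<in> space M" and "t \<le> T"
  shows "\<gamma> (int t - 1) \<omega> \<in> \<B> \<and> 0 \<le> Q t \<omega>"
  using \<open>t \<le> T\<close>
proof (induction t)
  case 0
  then show ?case using \<gamma>_init[OF \<omega>] Q_init[OF \<omega>] zero_in by simp
next
  case (Suc t)
  then have t: "t < T" and IH: "\<gamma> (int t - 1) \<omega> \<in> \<B>" "0 \<le> Q t \<omega>" by auto
  have "x t \<omega> \<in> \<B>"
    using \<phi>_in[OF t IH S_in_space[OF \<omega>]] X_sub[OF S_in_space[OF \<omega>]] x_step[OF t \<omega>] by auto
  then have "\<gamma> (int t) \<omega> \<in> \<B>"
    unfolding \<gamma>_step[OF t \<omega>] using IH(1) \<eta>_pos \<eta>_le by (intro convexD[OF domain(2)]) auto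
  moreover have "0 \<le> Q (Suc t) \<omega>"
    using Q_step[OF t \<omega>] by (simp add: less_eq_vec_def)
  ultimately show ?case by simp
qed

lemma \<gamma>_in: "\<omega> \<in> space M \<Longrightarrow> t \<le> T \<Longrightarrow> \<gamma> (int t - 1) \<omega> \<in> \<B>"
  and Q_nonneg: "\<omega> \<in> space M \<Longrightarrow> t \<le> T \<Longrightarrow> 0 \<le> Q t \<omega>"
  using iterates_in by blast+

lemma x_in_X: "\<omega> \<in> space M \<Longrightarrow> t < T \<Longrightarrow> x t \<omega> \<in> X (S t \<omega>)"
  using \<phi>_in[OF _ \<gamma>_in Q_nonneg S_in_space] x_step by simp

lemma x_in: "\<omega> \<in> space M \<Longrightarrow> t < T \<Longrightarrow> x t \<omega> \<in> \<B>"
  using x_in_X X_sub[OF S_in_space] by blast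

lemma constraint_le: "z \<in> \<B> \<Longrightarrow> \<bar>row i A \<bullet> z - b $ i\<bar> \<le> \<bar>B\<bar>"
proof -
  assume "z \<in> \<B>"
  have "\<bar>row i A \<bullet> z - b $ i\<bar>\<^sup>2 \<le> (\<Sum>i\<in>UNIV. \<bar>row i A \<bullet> z - b $ i\<bar>\<^sup>2)"
    by (rule member_le_sum) auto
  also have "\<dots> \<le> \<bar>B\<bar>\<^sup>2" using constr_bound[OF \<open>z \<in> \<B>\<close>] by simp
  finally show ?thesis by (meson abs_ge_zero power2_le_imp_le)
qed

text \<open>
  Deterministic bounds on the queues, only used for integrability.
\<close>

lemma Q_le: "\<omega> \<in> space M \<Longrightarrow> t \<le> T \<Longrightarrow> Q t \<omega> $ i \<le> real t * \<bar>B\<bar>"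
proof (induction t)
  case (Suc t)
  then have t: "t < T" by simp
  have "0 \<le> Q t \<omega> $ i" using Q_nonneg[OF Suc.prems(1), of t] t by (simp add: less_eq_vec_def)
  then show ?case
    using Suc constraint_le[OF x_in[OF Suc.prems(1) t], of i] Q_step[OF t Suc.prems(1), of i]
    by (auto simp: algebra_simps)
qed (simp add: Q_init)

lemma norm_Q_le:
  assumes "\<omega> \<in> space M" "t \<le> T"
  shows "norm (Q t \<omega>) \<le> real CARD('n) * (real t * \<bar>B\<bar>)"
proof -
  have "norm (Q t \<omega>) \<le> (\<Sum>i\<in>UNIV. \<bar>Q t \<omega> $ i\<bar>)" by (rule norm_le_l1_cart)
  also have "\<dots> \<le> (\<Sum>i\<in>(UNIV::'n set). real t * \<bar>B\<bar>)"
    using Q_le[OF assms] Q_nonneg[OF assms] by (intro sum_mono) (auto simp: less_eq_vec_def)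
  finally show ?thesis by simp
qed

text \<open>
  Stated for an arbitrary algebra that knows the first \<open>t\<close> states, since the iterates must be seen as
  functions of the history, of the whole state sequence, and of the full sample point.
\<close>

lemma iterates_adapted:
  assumes sp: "space F = space M" and "t \<le> T" and "\<And>k. k < t \<Longrightarrow> S k \<in> F \<rightarrow>\<^sub>M N"
  shows "\<gamma> (int t - 1) \<in> borel_measurable F \<and> Q t \<in> borel_measurable F"
  using assms(2,3)
proof (induction t)
  case 0
  have "\<gamma> (-1) \<in> borel_measurable F" by (subst measurable_cong[where g="\<lambda>_. 0"]) (auto simp: sp \<gamma>_init)
  moreover have "Q 0 \<in> borel_measurable F" by (subst measurable_cong[where g="\<lambda>_. 0"]) (auto simp: sp Q_init)
  ultimately show ?case by simp
next
  case (Suc t)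
  then have t: "t < T" and g [measurable]: "\<gamma> (int t - 1) \<in> borel_measurable F"
    and q [measurable]: "Q t \<in> borel_measurable F" and [measurable]: "S t \<in> F \<rightarrow>\<^sub>M N" by auto
  have "(\<lambda>\<omega>. (\<gamma> (int t - 1) \<omega>, Q t \<omega>, S t \<omega>)) \<in> F \<rightarrow>\<^sub>M borel \<Otimes>\<^sub>M borel \<Otimes>\<^sub>M N" by measurable
  from measurable_compose[OF this \<phi>_measurable[OF t]]
  have x [measurable]: "x t \<in> borel_measurable F"
    by (subst measurable_cong[where g="\<lambda>\<omega>. \<phi> t (\<gamma> (int t - 1) \<omega>) (Q t \<omega>) (S t \<omega>)"])
       (auto simp: sp x_step t)
  have "\<gamma> (int t) \<in> borel_measurable F"
    by (subst measurable_cong[where g="\<lambda>\<omega>. (1 - \<eta>) *\<^sub>R \<gamma> (int t - 1) \<omega> + \<eta> *\<^sub>R x t \<omega>"])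
       (auto simp: sp \<gamma>_step t)
  moreover have "Q (Suc t) \<in> borel_measurable F"
  proof (subst borel_measurable_vec_iff, intro allI)
    fix i
    have "(\<lambda>\<omega>. max (Q t \<omega> $ i + row i A \<bullet> x t \<omega> - b $ i) 0) \<in> borel_measurable F" by measurable
    then show "(\<lambda>\<omega>. Q (Suc t) \<omega> $ i) \<in> borel_measurable F"
      by (subst measurable_cong[where g="\<lambda>\<omega>. max (Q t \<omega> $ i + row i A \<bullet> x t \<omega> - b $ i) 0"])
         (auto simp: sp Q_step t)
  qed
  ultimately show ?case by simp
qed

definition queue_state :: "((real^'d) \<times> (real^'n)) measure" where
  "queue_state = restrict_space borel \<B> \<Otimes>\<^sub>M restrict_space borel {q. 0 \<le> q}"

lemma space_queue_state: "space queue_state = \<B> \<times> {q. 0 \<le> q}"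
  by (simp add: queue_state_def space_pair_measure space_restrict_space)

lemma \<phi>_queue_state_measurable:
  assumes t: "t < T"
  shows "(\<lambda>((g, q), s). \<phi> t g q s) \<in> borel_measurable (queue_state \<Otimes>\<^sub>M N)"
  unfolding queue_state_def by (rule measurable_restrict_arguments[OF \<phi>_measurable[OF t]])

lemma queue_state_measurable:
  assumes sp: "space F = space M" and "t \<le> T" and "\<And>k. k < t \<Longrightarrow> S k \<in> F \<rightarrow>\<^sub>M N"
  shows "(\<lambda>\<omega>. (\<gamma> (int t - 1) \<omega>, Q t \<omega>)) \<in> F \<rightarrow>\<^sub>M queue_state"
  unfolding queue_state_def using iterates_adapted[OF assms] iterates_in[OF _ \<open>t \<le> T\<close>] sp
  by (intro measurable_Pair measurable_restrict_space2) auto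

text \<open>
  The mean of the decision \<open>x t\<close> given the past.
\<close>

definition mean_x :: "nat \<Rightarrow> 'w \<Rightarrow> real^'d" where
  "mean_x t \<omega> = (\<integral>s. \<phi> t (\<gamma> (int t - 1) \<omega>) (Q t \<omega>) s \<partial>\<mu>)"

lemma \<phi>_integrable:
  assumes t: "t < T" and g: "g \<in> \<B>" and q: "0 \<le> q"
  shows "integrable \<mu> (\<phi> t g q)" and "\<phi> t g q \<in> borel_measurable \<mu>"
proof -
  interpret \<mu>: prob_space \<mu> by (rule prob_space_\<mu>)
  have "(g, q) \<in> space queue_state" using g q by (simp add: space_queue_state)
  from measurable_compose_Pair1[OF this \<phi>_queue_state_measurable[OF t]]
  show m: "\<phi> t g q \<in> borel_measurable \<mu>" by simp
  show "integrable \<mu> (\<phi> t g q)"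
    using norm_le_D[OF \<phi>_in_\<B>[OF t g q]] m
    by (intro \<mu>.integrable_const_bound[of _ D]) (auto intro!: AE_I2)
qed

lemma mean_x_in:
  assumes \<omega>: "\<omega> \<in> space M" and t: "t < T"
  shows "mean_x t \<omega> \<in> \<B>"
proof -
  interpret \<mu>: prob_space \<mu> by (rule prob_space_\<mu>)
  have g: "\<gamma> (int t - 1) \<omega> \<in> \<B>" "0 \<le> Q t \<omega>" using iterates_in[OF \<omega>, of t] t by auto
  show ?thesis unfolding mean_x_def
    using \<phi>_in_\<B>[OF t g]
    by (intro \<mu>.expectation_in_closed_convex domain compact_imp_closed \<phi>_integrable t g) (auto intro!: AE_I2)
qed

lemma mean_x_measurable:
  assumes sp: "space F = space M" and t: "t < T" and S: "\<And>k. k < t \<Longrightarrow> S k \<in> F \<rightarrow>\<^sub>M N"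
  shows "mean_x t \<in> borel_measurable F"
proof -
  have "(\<lambda>((g, q), s). \<phi> t g q s) \<in> borel_measurable (queue_state \<Otimes>\<^sub>M \<mu>)"
    using \<phi>_queue_state_measurable[OF t] by simp
  from compensator_measurable[OF prob_space_\<mu> this queue_state_measurable[OF sp _ S]] t
  show ?thesis by (simp add: mean_x_def[abs_def])
qed

lemma compensate_x:
  assumes t: "t < T" and W: "W \<in> borel_measurable (H t)" "\<And>\<omega>. \<omega> \<in> space M \<Longrightarrow> norm (W \<omega>) \<le> C"
  shows "(\<integral>\<omega>. W \<omega> \<bullet> x t \<omega> \<partial>M) = (\<integral>\<omega>. W \<omega> \<bullet> mean_x t \<omega> \<partial>M)"
proof -
  have U: "(\<lambda>\<omega>. (\<gamma> (int t - 1) \<omega>, Q t \<omega>)) \<in> H t \<rightarrow>\<^sub>M queue_state"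
    using t H_measurable(1) by (intro queue_state_measurable) auto
  have "norm ((\<lambda>((g, q), s). \<phi> t g q s) (u, s)) \<le> D" if "u \<in> space queue_state" "s \<in> space N" for u s
    using that norm_le_D[OF \<phi>_in_\<B>[OF t]] by (auto simp: space_queue_state)
  from compensator[OF U \<phi>_queue_state_measurable[OF t] this W]
  have "(\<integral>\<omega>. W \<omega> \<bullet> \<phi> t (\<gamma> (int t - 1) \<omega>) (Q t \<omega>) (S t \<omega>) \<partial>M) = (\<integral>\<omega>. W \<omega> \<bullet> mean_x t \<omega> \<partial>M)"
    by (simp add: mean_x_def)
  then show ?thesis using x_step[OF t] by (simp cong: Bochner_Integration.integral_cong)
qed

text \<open>
  The drift-plus-penalty weight: the decision of slot \<open>t\<close> minimizes its inner product over the options.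
\<close>

definition dpp_weight :: "nat \<Rightarrow> 'w \<Rightarrow> real^'d" where
  "dpp_weight t \<omega> = V *\<^sub>R Df (\<gamma> (int t - 1) \<omega>) + (\<Sum>i\<in>UNIV. Q t \<omega> $ i *\<^sub>R row i A)"

lemma dpp_weight_inner:
  "dpp_weight t \<omega> \<bullet> u = V * (Df (\<gamma> (int t - 1) \<omega>) \<bullet> u) + (\<Sum>i\<in>UNIV. Q t \<omega> $ i * (row i A \<bullet> u))"
  by (simp add: dpp_weight_def inner_add_left inner_sum_left)

lemma selection_support:
  assumes g: "g \<in> borel_measurable \<mu>"
    and g_min: "\<And>s. s \<in> space N \<Longrightarrow> g s \<in> X s \<and> (\<forall>u\<in>X s. w \<bullet> g s \<le> w \<bullet> u)"
    and v: "v \<in> closure \<Gamma>"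
  shows "w \<bullet> (\<integral>s. g s \<partial>\<mu>) \<le> w \<bullet> v"
  using Gamma_star_support[OF prob_space_\<mu> domain(1) _ v g, of w] g_min X_sub by simp

lemma mean_x_support:
  assumes \<omega>: "\<omega> \<in> space M" and t: "t < T" and v: "v \<in> closure \<Gamma>"
  shows "dpp_weight t \<omega> \<bullet> mean_x t \<omega> \<le> dpp_weight t \<omega> \<bullet> v"
  unfolding mean_x_def
proof (rule selection_support[OF _ _ v])
  have g: "\<gamma> (int t - 1) \<omega> \<in> \<B>" "0 \<le> Q t \<omega>" using iterates_in[OF \<omega>, of t] t by auto
  show "\<phi> t (\<gamma> (int t - 1) \<omega>) (Q t \<omega>) \<in> borel_measurable \<mu>" by (rule \<phi>_integrable(2)[OF t g])
  show "\<phi> t (\<gamma> (int t - 1) \<omega>) (Q t \<omega>) s \<in> X s \<and>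
      (\<forall>u\<in>X s. dpp_weight t \<omega> \<bullet> \<phi> t (\<gamma> (int t - 1) \<omega>) (Q t \<omega>) s \<le> dpp_weight t \<omega> \<bullet> u)"
    if "s \<in> space N" for s
    using \<phi>_argmin[OF t g that] by (auto simp: is_arg_min_def dpp_weight_inner not_less)
qed

lemma feasible_constraint: "v \<in> feasible_set \<Gamma> A b \<Longrightarrow> row i A \<bullet> v \<le> b $ i"
  by (simp add: feasible_set_def less_eq_vec_def matrix_vector_mul_component row_def vec_lambda_eta)

text \<open>
  Compare \<open>mean_x t\<close> with a feasible \<open>v\<close>: the queue part of the weight contributes
  \<open>\<Sum> Q\<^sub>i (row\<^sub>i \<bullet> v) \<le> Q \<bullet> b\<close> since queues are nonnegative.  The inequality holds at each sample point and
  for all \<open>v\<close> at once, so the supremum may be taken.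
\<close>

lemma gap_le_slot:
  assumes \<omega>: "\<omega> \<in> space M" and t: "t < T"
  shows "V * \<G> (\<gamma> (int t - 1) \<omega>)
     \<le> V * (Df (\<gamma> (int t - 1) \<omega>) \<bullet> \<gamma> (int t - 1) \<omega>) + Q t \<omega> \<bullet> b - dpp_weight t \<omega> \<bullet> mean_x t \<omega>"
    (is "V * \<G> ?g \<le> ?r")
proof -
  have g: "?g \<in> \<B>" "0 \<le> Q t \<omega>" using iterates_in[OF \<omega>, of t] t by auto
  have "\<G> ?g \<le> ?r / V"
  proof (rule FW_gap_upper[OF feasible feasible_sub g(1)])
    fix v assume v: "v \<in> feasible_set \<Gamma> A b"
    then have vc: "v \<in> closure \<Gamma>" by (simp add: feasible_set_def)
    have "(\<Sum>i\<in>UNIV. Q t \<omega> $ i * (row i A \<bullet> v)) \<le> (\<Sum>i\<in>UNIV. Q t \<omega> $ i * b $ i)"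
      using feasible_constraint[OF v] g(2) by (intro sum_mono mult_left_mono) (auto simp: less_eq_vec_def)
    then have "V * (Df ?g \<bullet> (?g - v)) \<le> ?r"
      using mean_x_support[OF \<omega> t vc] by (simp add: dpp_weight_inner inner_vec_def[of "Q t \<omega>" b] inner_diff_right algebra_simps)
    then show "Df ?g \<bullet> (?g - v) \<le> ?r / V" using V_pos by (simp add: field_simps)
  qed
  then show ?thesis using V_pos by (simp add: field_simps)
qed

lemma queue_drift:
  assumes \<omega>: "\<omega> \<in> space M" and t: "t < T"
  shows "(norm (Q (Suc t) \<omega>))\<^sup>2 \<le> (norm (Q t \<omega>))\<^sup>2
     + 2 * (\<Sum>i\<in>UNIV. Q t \<omega> $ i * (row i A \<bullet> x t \<omega> - b $ i)) + B\<^sup>2"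
proof -
  have sq: "(norm u)\<^sup>2 = (\<Sum>i\<in>UNIV. (u $ i)\<^sup>2)" for u :: "real^'n"
    unfolding power2_norm_eq_inner by (simp add: inner_vec_def power2_eq_square)
  have m: "(max c 0)\<^sup>2 \<le> c\<^sup>2" for c :: real by (simp add: max_def)
  have "(norm (Q (Suc t) \<omega>))\<^sup>2 \<le> (\<Sum>i\<in>UNIV. (Q t \<omega> $ i + row i A \<bullet> x t \<omega> - b $ i)\<^sup>2)"
    unfolding sq Q_step[OF t \<omega>] by (intro sum_mono m)
  also have "\<dots> = (\<Sum>i\<in>UNIV. (Q t \<omega> $ i)\<^sup>2 + 2 * (Q t \<omega> $ i * (row i A \<bullet> x t \<omega> - b $ i))
      + \<bar>row i A \<bullet> x t \<omega> - b $ i\<bar>\<^sup>2)"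
    by (intro sum.cong refl) (simp add: power2_eq_square algebra_simps)
  also have "\<dots> \<le> (norm (Q t \<omega>))\<^sup>2
     + 2 * (\<Sum>i\<in>UNIV. Q t \<omega> $ i * (row i A \<bullet> x t \<omega> - b $ i)) + B\<^sup>2"
    using constr_bound[OF x_in[OF \<omega> t]] by (simp add: sum.distrib sum_distrib_left sq)
  finally show ?thesis .
qed

lemma objective_descent:
  assumes \<omega>: "\<omega> \<in> space M" and t: "t < T"
  shows "\<eta> * (Df (\<gamma> (int t - 1) \<omega>) \<bullet> (\<gamma> (int t - 1) \<omega> - x t \<omega>))
     \<le> f (\<gamma> (int t - 1) \<omega>) - f (\<gamma> (int t) \<omega>) + L / 2 * (\<eta>\<^sup>2 * D\<^sup>2)"
proof -
  let ?g = "\<gamma> (int t - 1) \<omega>" and ?g' = "\<gamma> (int t) \<omega>"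
  have g: "?g \<in> \<B>" "?g' \<in> \<B>" using \<gamma>_in[OF \<omega>, of t] \<gamma>_in[OF \<omega>, of "Suc t"] t by auto
  have d: "?g' - ?g = \<eta> *\<^sub>R (x t \<omega> - ?g)" using \<gamma>_step[OF t \<omega>] by (simp add: algebra_simps)
  have "(norm (?g' - ?g))\<^sup>2 \<le> \<eta>\<^sup>2 * D\<^sup>2"
    unfolding d using diameter[OF x_in[OF \<omega> t] g(1)]
    by (auto simp: power_mult_distrib intro!: mult_left_mono power_mono)
  then have "L / 2 * (norm (?g' - ?g))\<^sup>2 \<le> L / 2 * (\<eta>\<^sup>2 * D\<^sup>2)"
    using L_nonneg by (intro mult_left_mono) auto
  moreover have "f ?g' \<le> f ?g + Df ?g \<bullet> (?g' - ?g) + L / 2 * (norm (?g' - ?g))\<^sup>2"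
    by (rule smooth_descent[OF domain(2) g gradient smooth])
  moreover have "Df ?g \<bullet> (?g' - ?g) = - (\<eta> * (Df ?g \<bullet> (?g - x t \<omega>)))"
    unfolding d by (simp add: inner_diff_right algebra_simps)
  ultimately show ?thesis by linarith
qed

text \<open>
  The right-hand side of the previous comparison, now with the actual decision, is bounded by
  differences of \<open>V f / \<eta>\<close> and of \<open>\<parallel>Q\<parallel>\<^sup>2 / 2\<close>: the gradient part by the descent inequality for a
  step of length \<open>\<eta>\<close>, the queue part by expanding the square.
\<close>

lemma slot_bound:
  assumes \<omega>: "\<omega> \<in> space M" and t: "t < T"
  shows "V * (Df (\<gamma> (int t - 1) \<omega>) \<bullet> \<gamma> (int t - 1) \<omega>) + Q t \<omega> \<bullet> b - dpp_weight t \<omega> \<bullet> x t \<omega>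
     \<le> V / \<eta> * (f (\<gamma> (int t - 1) \<omega>) - f (\<gamma> (int t) \<omega>)) + (V * \<eta> * L * D\<^sup>2 / 2 + B\<^sup>2 / 2)
        - ((norm (Q (Suc t) \<omega>))\<^sup>2 - (norm (Q t \<omega>))\<^sup>2) / 2"
proof -
  let ?g = "\<gamma> (int t - 1) \<omega>"
  have "V / \<eta> * (\<eta> * (Df ?g \<bullet> (?g - x t \<omega>)))
      \<le> V / \<eta> * (f ?g - f (\<gamma> (int t) \<omega>) + L / 2 * (\<eta>\<^sup>2 * D\<^sup>2))"
    using V_pos \<eta>_pos objective_descent[OF assms] by (intro mult_left_mono) auto
  then have "V * (Df ?g \<bullet> (?g - x t \<omega>)) \<le> V / \<eta> * (f ?g - f (\<gamma> (int t) \<omega>)) + V * \<eta> * L * D\<^sup>2 / 2"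
    using \<eta>_pos by (simp add: algebra_simps power2_eq_square)
  moreover have "Q t \<omega> \<bullet> b - (\<Sum>i\<in>UNIV. Q t \<omega> $ i * (row i A \<bullet> x t \<omega>))
      = - (\<Sum>i\<in>UNIV. Q t \<omega> $ i * (row i A \<bullet> x t \<omega> - b $ i))"
    by (simp add: inner_vec_def algebra_simps sum_subtractf)
  moreover have "V * (Df ?g \<bullet> (?g - x t \<omega>)) = V * (Df ?g \<bullet> ?g) - V * (Df ?g \<bullet> x t \<omega>)"
    by (simp add: inner_diff_right algebra_simps)
  ultimately show ?thesis
    using queue_drift[OF assms] unfolding dpp_weight_inner by argo
qed

lemma slots_sum_bound:
  assumes \<omega>: "\<omega> \<in> space M" and "n \<le> T"
  shows "(\<Sum>t<n. V * (Df (\<gamma> (int t - 1) \<omega>) \<bullet> \<gamma> (int t - 1) \<omega>) + Q t \<omega> \<bullet> b - dpp_weight t \<omega> \<bullet> x t \<omega>)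
     \<le> V / \<eta> * (f (\<gamma> (-1) \<omega>) - f (\<gamma> (int n - 1) \<omega>)) + real n * (V * \<eta> * L * D\<^sup>2 / 2 + B\<^sup>2 / 2)
        - (norm (Q n \<omega>))\<^sup>2 / 2"
  using \<open>n \<le> T\<close>
proof (induction n)
  case 0
  then show ?case using Q_init[OF \<omega>] by simp
next
  case (Suc n)
  then have "n < T" and n: "n \<le> T" by auto
  have "V / \<eta> * (f (\<gamma> (-1) \<omega>) - f (\<gamma> (int n) \<omega>)) = V / \<eta> * (f (\<gamma> (-1) \<omega>) - f (\<gamma> (int n - 1) \<omega>))
      + V / \<eta> * (f (\<gamma> (int n - 1) \<omega>) - f (\<gamma> (int n) \<omega>))"
    by (simp add: algebra_simps diff_divide_distrib)
  moreover have "real (Suc n) * c = real n * c + c" for c by (simp add: algebra_simps)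
  moreover have "int (Suc n) - 1 = int n" by simp
  ultimately show ?case
    using Suc.IH[OF n] slot_bound[OF \<omega> \<open>n < T\<close>] by (simp only: sum.lessThan_Suc) argo
qed

lemma Df_\<gamma>_measurable:
  assumes sp: "space F = space M" and "t \<le> T" and "\<And>k. k < t \<Longrightarrow> S k \<in> F \<rightarrow>\<^sub>M N"
  shows "(\<lambda>\<omega>. Df (\<gamma> (int t - 1) \<omega>)) \<in> borel_measurable F"
proof -
  have "\<gamma> (int t - 1) \<in> F \<rightarrow>\<^sub>M restrict_space borel \<B>"
    using iterates_adapted[OF assms] \<gamma>_in[OF _ \<open>t \<le> T\<close>] sp by (intro measurable_restrict_space2) auto
  moreover have "Df \<in> borel_measurable (restrict_space borel \<B>)"
    using lipschitz_on_continuous_on[OF smooth] by (rule borel_measurable_continuous_on_restrict)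
  ultimately show ?thesis by (rule measurable_compose)
qed

lemma dpp_weight_measurable:
  assumes "space F = space M" and "t \<le> T" and "\<And>k. k < t \<Longrightarrow> S k \<in> F \<rightarrow>\<^sub>M N"
  shows "dpp_weight t \<in> borel_measurable F"
proof -
  note [measurable] = Df_\<gamma>_measurable[OF assms] conjunct2[OF iterates_adapted[OF assms]]
  show ?thesis unfolding dpp_weight_def[abs_def] by measurable
qed

lemma dpp_weight_bounded: "\<exists>C. \<forall>\<omega>\<in>space M. \<forall>t\<le>T. norm (dpp_weight t \<omega>) \<le> C"
proof (intro exI ballI allI impI)
  fix \<omega> t assume \<omega>: "\<omega> \<in> space M" and t: "t \<le> T"
  have "norm (dpp_weight t \<omega>) \<le> norm (V *\<^sub>R Df (\<gamma> (int t - 1) \<omega>)) + norm (\<Sum>i\<in>UNIV. Q t \<omega> $ i *\<^sub>R row i A)"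
    unfolding dpp_weight_def by (rule norm_triangle_ineq)
  also have "\<dots> \<le> V * Mg + (\<Sum>i\<in>UNIV. (real T * \<bar>B\<bar>) * norm (row i A))"
  proof (intro add_mono norm_sum[THEN order_trans] sum_mono)
    show "norm (V *\<^sub>R Df (\<gamma> (int t - 1) \<omega>)) \<le> V * Mg"
      using V_pos grad_bound[OF \<gamma>_in[OF \<omega> t]] by simp
    fix i
    have "Q t \<omega> $ i \<le> real t * \<bar>B\<bar>" by (rule Q_le[OF \<omega> t])
    also have "\<dots> \<le> real T * \<bar>B\<bar>" using t by (intro mult_right_mono) auto
    finally show "norm (Q t \<omega> $ i *\<^sub>R row i A) \<le> real T * \<bar>B\<bar> * norm (row i A)"
      using Q_nonneg[OF \<omega> t] by (auto simp: less_eq_vec_def intro!: mult_right_mono)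
  qed
  finally show "norm (dpp_weight t \<omega>) \<le> V * Mg + (\<Sum>i\<in>UNIV. (real T * \<bar>B\<bar>) * norm (row i A))" .
qed

lemma \<G>_\<gamma>_measurable:
  assumes "space F = space M" and "t \<le> T" and "\<And>k. k < t \<Longrightarrow> S k \<in> F \<rightarrow>\<^sub>M N"
  shows "(\<lambda>\<omega>. \<G> (\<gamma> (int t - 1) \<omega>)) \<in> borel_measurable F"
  using iterates_adapted[OF assms]
  by (intro measurable_compose[OF _ FW_gap_measurable[OF feasible feasible_sub]]) auto

lemma \<G>_abs_le: "u \<in> \<B> \<Longrightarrow> \<bar>\<G> u\<bar> \<le> Mg * D"
  by (rule FW_gap_abs_le[OF feasible feasible_sub])

text \<open>
  The step equation of \<open>\<gamma>\<close> is solved for \<open>x t\<close>.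
\<close>

lemma x_measurable:
  assumes t: "t < T"
  shows "x t \<in> borel_measurable M"
proof -
  have "x t \<omega> = (1 / \<eta>) *\<^sub>R (\<gamma> (int (Suc t) - 1) \<omega> - (1 - \<eta>) *\<^sub>R \<gamma> (int t - 1) \<omega>)" if "\<omega> \<in> space M" for \<omega>
    using \<gamma>_step[OF t that] \<eta>_pos by simp
  moreover have "(\<lambda>\<omega>. (1 / \<eta>) *\<^sub>R (\<gamma> (int (Suc t) - 1) \<omega> - (1 - \<eta>) *\<^sub>R \<gamma> (int t - 1) \<omega>)) \<in> borel_measurable M"
    using iterates_adapted[of M t] iterates_adapted[of M "Suc t"] S_measurable t
    by (intro borel_measurable_scaleR borel_measurable_diff) auto
  ultimately show ?thesis by (subst measurable_cong) auto
qed

lemma norm_Q_integrable: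
  shows "integrable M (\<lambda>\<omega>. (norm (Q T \<omega>))\<^sup>2)" and "integrable M (\<lambda>\<omega>. Q T \<omega> $ i)"
proof -
  have m [measurable]: "Q T \<in> borel_measurable M"
    using iterates_adapted[of M T] S_measurable by auto
  let ?C = "real CARD('n) * (real T * \<bar>B\<bar>)"
  show "integrable M (\<lambda>\<omega>. (norm (Q T \<omega>))\<^sup>2)"
    by (rule bounded_integrable[of _ "?C\<^sup>2"]) (use norm_Q_le[of _ T] in \<open>auto intro!: power_mono\<close>)
  have "norm (Q T \<omega> $ i) \<le> ?C" if "\<omega> \<in> space M" for \<omega>
    using norm_Q_le[OF that, of T] component_le_norm_cart[of "Q T \<omega>" i] by simp
  then show "integrable M (\<lambda>\<omega>. Q T \<omega> $ i)" by (intro bounded_integrable[of _ ?C]) auto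
qed

text \<open>
  The comparison with feasible points concerns the mean decisions, the telescoping bound the actual
  ones.  The weight is determined by the history, so both have the same expectation.
\<close>

lemma first_phase_drift:
  "V * (\<Sum>t<T. \<integral>\<omega>. \<G> (\<gamma> (int t - 1) \<omega>) \<partial>M) + (\<integral>\<omega>. (norm (Q T \<omega>))\<^sup>2 \<partial>M) / 2
     \<le> 2 * K * V / \<eta> + real T * (V * \<eta> * L * D\<^sup>2 / 2 + B\<^sup>2 / 2)"
proof -
  define a where "a t \<omega> = V * (Df (\<gamma> (int t - 1) \<omega>) \<bullet> \<gamma> (int t - 1) \<omega>) + Q t \<omega> \<bullet> b" for t \<omega>
  define c where "c = 2 * K * V / \<eta> + real T * (V * \<eta> * L * D\<^sup>2 / 2 + B\<^sup>2 / 2)"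
  obtain C where C: "\<And>\<omega> t. \<omega> \<in> space M \<Longrightarrow> t \<le> T \<Longrightarrow> norm (dpp_weight t \<omega>) \<le> C"
    using dpp_weight_bounded by blast
  have inner_le: "norm (u \<bullet> v) \<le> p * q" if "norm u \<le> p" "norm v \<le> q" for u v :: "'z::real_inner" and p q
  proof -
    have "norm (u \<bullet> v) \<le> norm u * norm v" by (simp add: Cauchy_Schwarz_ineq2)
    also have "\<dots> \<le> p * q" using that by (intro mult_mono) (auto intro: order_trans[OF norm_ge_zero])
    finally show ?thesis .
  qed
  have mM: "\<gamma> (int t - 1) \<in> borel_measurable M" "Q t \<in> borel_measurable M"
      "(\<lambda>\<omega>. Df (\<gamma> (int t - 1) \<omega>)) \<in> borel_measurable M" "dpp_weight t \<in> borel_measurable M" if "t \<le> T" for t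
    using iterates_adapted[of M t] Df_\<gamma>_measurable[of M t] dpp_weight_measurable[of M t] S_measurable that by auto
  have xz: "x t \<in> borel_measurable M" "mean_x t \<in> borel_measurable M" if t: "t < T" for t
    using x_measurable[OF t] S_measurable t by (auto intro: mean_x_measurable)
  have ia: "integrable M (a t)" if t: "t < T" for t
  proof (rule bounded_integrable)
    note [measurable] = mM[OF less_imp_le[OF t]]
    show "a t \<in> borel_measurable M" unfolding a_def[abs_def] by measurable
    fix \<omega> assume \<omega>: "\<omega> \<in> space M"
    have "norm (V * (Df (\<gamma> (int t - 1) \<omega>) \<bullet> \<gamma> (int t - 1) \<omega>)) \<le> V * (Mg * D)"
      using V_pos inner_le[OF grad_bound norm_le_D, OF \<gamma>_in \<gamma>_in] \<omega> t by (simp add: abs_mult)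
    moreover have "norm (Q t \<omega> \<bullet> b) \<le> real CARD('n) * (real t * \<bar>B\<bar>) * norm b"
      using norm_Q_le[OF \<omega>, of t] t by (intro inner_le) auto
    ultimately show "norm (a t \<omega>) \<le> V * (Mg * D) + real CARD('n) * (real t * \<bar>B\<bar>) * norm b"
      unfolding a_def by (intro norm_triangle_le add_mono)
  qed
  have id: "integrable M (\<lambda>\<omega>. dpp_weight t \<omega> \<bullet> x t \<omega>)" "integrable M (\<lambda>\<omega>. dpp_weight t \<omega> \<bullet> mean_x t \<omega>)" if t: "t < T" for t
  proof -
    have "norm (dpp_weight t \<omega> \<bullet> x t \<omega>) \<le> C * D" "norm (dpp_weight t \<omega> \<bullet> mean_x t \<omega>) \<le> C * D" if "\<omega> \<in> space M" for \<omega>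
      using C[OF that, of t] norm_le_D[OF x_in[OF that t]] norm_le_D[OF mean_x_in[OF that t]] t
      by (auto intro!: inner_le[unfolded real_norm_def])
    then show "integrable M (\<lambda>\<omega>. dpp_weight t \<omega> \<bullet> x t \<omega>)" "integrable M (\<lambda>\<omega>. dpp_weight t \<omega> \<bullet> mean_x t \<omega>)"
      using mM(4)[of t] xz[OF t] t by (auto intro!: bounded_integrable[of _ "C * D"])
  qed
  have iG: "integrable M (\<lambda>\<omega>. \<G> (\<gamma> (int t - 1) \<omega>))" if t: "t < T" for t
    using \<G>_\<gamma>_measurable[of M t] S_measurable \<G>_abs_le[OF \<gamma>_in[of _ t]] t
    by (intro bounded_integrable[of _ "Mg * D"]) auto
  have slot: "V * (\<integral>\<omega>. \<G> (\<gamma> (int t - 1) \<omega>) \<partial>M) \<le> (\<integral>\<omega>. a t \<omega> - dpp_weight t \<omega> \<bullet> x t \<omega> \<partial>M)" if t: "t < T" for t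
  proof -
    have "V * (\<integral>\<omega>. \<G> (\<gamma> (int t - 1) \<omega>) \<partial>M) = (\<integral>\<omega>. V * \<G> (\<gamma> (int t - 1) \<omega>) \<partial>M)" by simp
    also have "\<dots> \<le> (\<integral>\<omega>. a t \<omega> - dpp_weight t \<omega> \<bullet> mean_x t \<omega> \<partial>M)"
      using gap_le_slot[OF _ t, folded a_def] ia[OF t] id[OF t] iG[OF t] by (intro integral_mono) auto
    also have "\<dots> = (\<integral>\<omega>. a t \<omega> - dpp_weight t \<omega> \<bullet> x t \<omega> \<partial>M)"
      using compensate_x[OF t dpp_weight_measurable C, of t] H_measurable(1) t ia[OF t] id[OF t] by simp
    finally show ?thesis .
  qed
  have "V * (\<Sum>t<T. \<integral>\<omega>. \<G> (\<gamma> (int t - 1) \<omega>) \<partial>M) \<le> (\<Sum>t<T. \<integral>\<omega>. a t \<omega> - dpp_weight t \<omega> \<bullet> x t \<omega> \<partial>M)"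
    unfolding sum_distrib_left using slot by (intro sum_mono) auto
  also have "\<dots> = (\<integral>\<omega>. (\<Sum>t<T. a t \<omega> - dpp_weight t \<omega> \<bullet> x t \<omega>) \<partial>M)"
    using ia id by (intro Bochner_Integration.integral_sum[symmetric]) auto
  also have "\<dots> \<le> (\<integral>\<omega>. c - (norm (Q T \<omega>))\<^sup>2 / 2 \<partial>M)"
  proof (rule integral_mono)
    fix \<omega> assume \<omega>: "\<omega> \<in> space M"
    have "f (\<gamma> (-1) \<omega>) - f (\<gamma> (int T - 1) \<omega>) \<le> 2 * K"
      using f_bound[OF \<gamma>_in[OF \<omega>, of 0]] f_bound[OF \<gamma>_in[OF \<omega>, of T]] by auto
    then have "V / \<eta> * (f (\<gamma> (-1) \<omega>) - f (\<gamma> (int T - 1) \<omega>)) \<le> V / \<eta> * (2 * K)"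
      using V_pos \<eta>_pos by (intro mult_left_mono) auto
    then show "(\<Sum>t<T. a t \<omega> - dpp_weight t \<omega> \<bullet> x t \<omega>) \<le> c - (norm (Q T \<omega>))\<^sup>2 / 2"
      using slots_sum_bound[OF \<omega>, of T] by (simp add: a_def c_def algebra_simps)
  qed (use ia id norm_Q_integrable in auto)
  also have "\<dots> = c - (\<integral>\<omega>. (norm (Q T \<omega>))\<^sup>2 \<partial>M) / 2"
    using norm_Q_integrable by (simp add: prob_space)
  finally show ?thesis by (simp add: c_def)
qed

text \<open>
  The queue bounds the violation summed over the decisions \<open>x t\<close>; solving the step equation for \<open>x t\<close>
  shows that the sums of \<open>x t\<close> and of \<open>\<gamma> (t - 1)\<close> differ by the boundary term \<open>\<gamma> (T - 1) / \<eta>\<close>.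
\<close>

lemma average_constraint:
  assumes \<omega>: "\<omega> \<in> space M"
  shows "(\<Sum>t<T. row i A \<bullet> \<gamma> (int t - 1) \<omega> - b $ i) \<le> Q T \<omega> $ i + norm (row i A) * D / \<eta>"
proof -
  have "(\<Sum>t<n. row i A \<bullet> \<gamma> (int t - 1) \<omega> - b $ i) \<le> Q n \<omega> $ i - row i A \<bullet> \<gamma> (int n - 1) \<omega> / \<eta>"
    if "n \<le> T" for n
    using that
  proof (induction n)
    case 0
    then show ?case using Q_init[OF \<omega>] \<gamma>_init[OF \<omega>] by simp
  next
    case (Suc n)
    then have n: "n < T" by simp
    have "Q n \<omega> $ i + row i A \<bullet> x n \<omega> - b $ i \<le> Q (Suc n) \<omega> $ i"
      using Q_step[OF n \<omega>, of i] by simp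
    moreover have "row i A \<bullet> \<gamma> (int n) \<omega> / \<eta>
        = row i A \<bullet> \<gamma> (int n - 1) \<omega> / \<eta> - row i A \<bullet> \<gamma> (int n - 1) \<omega> + row i A \<bullet> x n \<omega>"
      unfolding \<gamma>_step[OF n \<omega>] using \<eta>_pos 
      by (simp add: inner_add_right add_divide_distrib) (simp add: field_simps)
    ultimately show ?case using Suc by simp
  qed
  from this[of T] have "(\<Sum>t<T. row i A \<bullet> \<gamma> (int t - 1) \<omega> - b $ i)
      \<le> Q T \<omega> $ i - row i A \<bullet> \<gamma> (int T - 1) \<omega> / \<eta>" by simp
  moreover have "- (row i A \<bullet> \<gamma> (int T - 1) \<omega>) \<le> norm (row i A) * D"
  proof -
    have "\<bar>row i A \<bullet> \<gamma> (int T - 1) \<omega>\<bar> \<le> norm (row i A) * norm (\<gamma> (int T - 1) \<omega>)"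
      by (rule Cauchy_Schwarz_ineq2)
    also have "\<dots> \<le> norm (row i A) * D"
      using norm_le_D[OF \<gamma>_in[OF \<omega>, of T]] by (intro mult_left_mono) auto
    finally show ?thesis by linarith
  qed
  then have "- (row i A \<bullet> \<gamma> (int T - 1) \<omega>) / \<eta> \<le> norm (row i A) * D / \<eta>"
    using \<eta>_pos by (intro divide_right_mono) auto
  ultimately show ?thesis by simp
qed

section \<open>The martingale part of the first-phase iterates\<close>

text \<open>
  The recursion of \<open>\<gamma>\<close> with each decision replaced by its mean; the index is shifted by one, so that
  \<open>mean_iterate t\<close> belongs to \<open>\<gamma> (t - 1)\<close>.
\<close>

primrec mean_iterate :: "nat \<Rightarrow> 'w \<Rightarrow> real^'d" where
  "mean_iterate 0 \<omega> = 0"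
| "mean_iterate (Suc t) \<omega> = (1 - \<eta>) *\<^sub>R mean_iterate t \<omega> + \<eta> *\<^sub>R mean_x t \<omega>"

lemma mean_iterate_in: "\<omega> \<in> space M \<Longrightarrow> n \<le> T \<Longrightarrow> mean_iterate n \<omega> \<in> \<B>"
proof (induction n)
  case (Suc n)
  then show ?case using mean_x_in[of \<omega> n] \<eta>_pos \<eta>_le by (auto intro!: convexD[OF domain(2)])
qed (simp add: zero_in)

lemma mean_iterate_measurable:
  assumes sp: "space F = space M" and "n \<le> T" and "\<And>k. k < n \<Longrightarrow> S k \<in> F \<rightarrow>\<^sub>M N"
  shows "mean_iterate n \<in> borel_measurable F"
  using assms(2,3)
proof (induction n)
  case 0
  have "mean_iterate 0 = (\<lambda>_. 0)" by auto
  then show ?case by simp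
next
  case (Suc n)
  have [measurable]: "mean_iterate n \<in> borel_measurable F" "mean_x n \<in> borel_measurable F"
    using Suc mean_x_measurable[OF sp, of n] by auto
  have "(\<lambda>\<omega>. (1 - \<eta>) *\<^sub>R mean_iterate n \<omega> + \<eta> *\<^sub>R mean_x n \<omega>) \<in> borel_measurable F" by measurable
  moreover have "mean_iterate (Suc n) = (\<lambda>\<omega>. (1 - \<eta>) *\<^sub>R mean_iterate n \<omega> + \<eta> *\<^sub>R mean_x n \<omega>)" by auto
  ultimately show ?case by simp
qed

text \<open>
  \<open>mean_iterate n \<omega>\<close> is a convex combination of \<open>0\<close> and of integrals of selections from the options.
  Each of these satisfies the support inequality, which is linear in the point.
\<close>

lemma mean_iterate_support:
  assumes \<omega>: "\<omega> \<in> space M" and "n \<le> T" and g: "g \<in> borel_measurable \<mu>"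
    and g_min: "\<And>s. s \<in> space N \<Longrightarrow> g s \<in> X s \<and> (\<forall>u\<in>X s. w \<bullet> g s \<le> w \<bullet> u)"
  shows "w \<bullet> (\<integral>s. g s \<partial>\<mu>) \<le> w \<bullet> mean_iterate n \<omega>"
  using \<open>n \<le> T\<close>
proof (induction n)
  case 0
  then show ?case using selection_support[OF g g_min zero] by simp
next
  case (Suc n)
  interpret \<mu>: prob_space \<mu> by (rule prob_space_\<mu>)
  have n: "n < T" using Suc by simp
  have gq: "\<gamma> (int n - 1) \<omega> \<in> \<B>" "0 \<le> Q n \<omega>" using iterates_in[OF \<omega>, of n] n by auto
  have gi: "integrable \<mu> g"
    using g g_min X_sub norm_le_D by (intro \<mu>.integrable_const_bound[of _ D]) (fastforce intro!: AE_I2)+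
  have "w \<bullet> (\<integral>s. g s \<partial>\<mu>) = (\<integral>s. w \<bullet> g s \<partial>\<mu>)" using gi by simp
  also have "\<dots> \<le> (\<integral>s. w \<bullet> \<phi> n (\<gamma> (int n - 1) \<omega>) (Q n \<omega>) s \<partial>\<mu>)"
    using gi \<phi>_integrable(1)[OF n gq] g_min \<phi>_in[OF n gq] by (intro integral_mono) auto
  also have "\<dots> = w \<bullet> mean_x n \<omega>" using \<phi>_integrable(1)[OF n gq] by (simp add: mean_x_def)
  finally have zz: "w \<bullet> (\<integral>s. g s \<partial>\<mu>) \<le> w \<bullet> mean_x n \<omega>" .
  have "w \<bullet> (\<integral>s. g s \<partial>\<mu>) = (1 - \<eta>) * (w \<bullet> (\<integral>s. g s \<partial>\<mu>)) + \<eta> * (w \<bullet> (\<integral>s. g s \<partial>\<mu>))"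
    by (simp add: algebra_simps)
  also have "\<dots> \<le> (1 - \<eta>) * (w \<bullet> mean_iterate n \<omega>) + \<eta> * (w \<bullet> mean_x n \<omega>)"
    using Suc zz \<eta>_pos \<eta>_le by (intro add_mono mult_left_mono) auto
  finally show ?case by (simp add: inner_add_right)
qed

text \<open>
  The error contracts by \<open>1 - \<eta>\<close> in each slot and receives \<open>\<eta>\<close> times a martingale difference of norm at
  most \<open>D\<close>.  Orthogonality leaves \<open>(1 - \<eta>)\<^sup>2 e + \<eta>\<^sup>2 D\<^sup>2\<close> for the mean square error \<open>e\<close>, and
  \<open>\<eta> D\<^sup>2\<close> is invariant under this recursion as \<open>(1 - \<eta>)\<^sup>2 + \<eta> \<le> 1\<close>.
\<close>

lemma mean_iterate_close:
  assumes "n \<le> T"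
  shows "(\<integral>\<omega>. (norm (\<gamma> (int n - 1) \<omega> - mean_iterate n \<omega>))\<^sup>2 \<partial>M) \<le> \<eta> * D\<^sup>2"
  using assms
proof (induction n)
  case 0
  then show ?case using \<gamma>_init \<eta>_pos by (simp cong: Bochner_Integration.integral_cong)
next
  case (Suc n)
  then have n: "n < T" "n \<le> T" by auto
  define e where "e \<omega> = \<gamma> (int n - 1) \<omega> - mean_iterate n \<omega>" for \<omega>
  have g: "\<gamma> (int n - 1) \<in> borel_measurable (H n)" "mean_iterate n \<in> borel_measurable (H n)"
    using iterates_adapted[of "H n" n] mean_iterate_measurable[of "H n" n] H_measurable(1) n by auto
  have eH: "e \<in> borel_measurable (H n)" unfolding e_def[abs_def] using g by measurable
  have eM [measurable]: "e \<in> borel_measurable M" by (rule H_imp_M[OF eH])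
  have eD: "norm (e \<omega>) \<le> D" if "\<omega> \<in> space M" for \<omega>
    unfolding e_def using that n by (intro diameter \<gamma>_in mean_iterate_in) auto
  note [measurable] = x_measurable[OF n(1)]
  have [measurable]: "mean_x n \<in> borel_measurable M" using S_measurable n by (intro mean_x_measurable) auto
  have i1: "integrable M (\<lambda>\<omega>. e \<omega> \<bullet> x n \<omega>)" "integrable M (\<lambda>\<omega>. e \<omega> \<bullet> mean_x n \<omega>)"
  proof -
    have "norm (e \<omega> \<bullet> x n \<omega>) \<le> D * D" "norm (e \<omega> \<bullet> mean_x n \<omega>) \<le> D * D" if \<omega>: "\<omega> \<in> space M" for \<omega>
      using eD[OF \<omega>] norm_le_D[OF x_in[OF \<omega> n(1)]] norm_le_D[OF mean_x_in[OF \<omega> n(1)]] D_nonneg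
      by (auto intro!: order_trans[OF Cauchy_Schwarz_ineq2] mult_mono)
    then show "integrable M (\<lambda>\<omega>. e \<omega> \<bullet> x n \<omega>)" "integrable M (\<lambda>\<omega>. e \<omega> \<bullet> mean_x n \<omega>)"
      by (auto intro!: bounded_integrable[of _ "D * D"])
  qed
  have i2: "integrable M (\<lambda>\<omega>. (norm (e \<omega>))\<^sup>2)" "integrable M (\<lambda>\<omega>. (norm (x n \<omega> - mean_x n \<omega>))\<^sup>2)"
    using eD diameter[OF x_in[OF _ n(1)] mean_x_in[OF _ n(1)]]
    by (auto intro!: bounded_integrable[of _ "D\<^sup>2"] power_mono)
  have zero: "(\<integral>\<omega>. e \<omega> \<bullet> x n \<omega> - e \<omega> \<bullet> mean_x n \<omega> \<partial>M) = 0"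
    using compensate_x[OF n(1) eH eD] i1 by simp
  have sq: "(norm (\<gamma> (int (Suc n) - 1) \<omega> - mean_iterate (Suc n) \<omega>))\<^sup>2 =
      (1 - \<eta>)\<^sup>2 * (norm (e \<omega>))\<^sup>2 + 2 * \<eta> * (1 - \<eta>) * (e \<omega> \<bullet> x n \<omega> - e \<omega> \<bullet> mean_x n \<omega>)
        + \<eta>\<^sup>2 * (norm (x n \<omega> - mean_x n \<omega>))\<^sup>2" if \<omega>: "\<omega> \<in> space M" for \<omega>
  proof -
    have *: "\<gamma> (int (Suc n) - 1) \<omega> - mean_iterate (Suc n) \<omega> = (1 - \<eta>) *\<^sub>R e \<omega> + \<eta> *\<^sub>R (x n \<omega> - mean_x n \<omega>)"
      using \<gamma>_step[OF n(1) \<omega>] by (simp add: e_def algebra_simps)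
    show ?thesis
      unfolding * power2_norm_eq_inner
      by (simp add: inner_add_left inner_add_right inner_diff_left inner_diff_right inner_commute
            power2_eq_square algebra_simps)
  qed
  have "(\<integral>\<omega>. (norm (\<gamma> (int (Suc n) - 1) \<omega> - mean_iterate (Suc n) \<omega>))\<^sup>2 \<partial>M) =
      (\<integral>\<omega>. (1 - \<eta>)\<^sup>2 * (norm (e \<omega>))\<^sup>2 + 2 * \<eta> * (1 - \<eta>) * (e \<omega> \<bullet> x n \<omega> - e \<omega> \<bullet> mean_x n \<omega>)
        + \<eta>\<^sup>2 * (norm (x n \<omega> - mean_x n \<omega>))\<^sup>2 \<partial>M)"
    by (intro Bochner_Integration.integral_cong refl sq)
  also have "\<dots> = (1 - \<eta>)\<^sup>2 * (\<integral>\<omega>. (norm (e \<omega>))\<^sup>2 \<partial>M)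
        + 2 * \<eta> * (1 - \<eta>) * (\<integral>\<omega>. e \<omega> \<bullet> x n \<omega> - e \<omega> \<bullet> mean_x n \<omega> \<partial>M)
        + \<eta>\<^sup>2 * (\<integral>\<omega>. (norm (x n \<omega> - mean_x n \<omega>))\<^sup>2 \<partial>M)"
    using i1 i2 by (simp del: Bochner_Integration.integral_diff)
  also have "\<dots> \<le> (1 - \<eta>)\<^sup>2 * (\<eta> * D\<^sup>2) + 0 + \<eta>\<^sup>2 * D\<^sup>2"
  proof (intro add_mono mult_left_mono)
    show "(\<integral>\<omega>. (norm (e \<omega>))\<^sup>2 \<partial>M) \<le> \<eta> * D\<^sup>2" using Suc.IH n by (simp add: e_def)
    have "(\<integral>\<omega>. (norm (x n \<omega> - mean_x n \<omega>))\<^sup>2 \<partial>M) \<le> (\<integral>\<omega>. D\<^sup>2 \<partial>M)"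
      using i2 diameter[OF x_in[OF _ n(1)] mean_x_in[OF _ n(1)]] by (intro integral_mono) (auto intro!: power_mono)
    then show "(\<integral>\<omega>. (norm (x n \<omega> - mean_x n \<omega>))\<^sup>2 \<partial>M) \<le> D\<^sup>2" by (simp add: prob_space)
  qed (simp_all add: zero)
  also have "\<dots> = \<eta> * D\<^sup>2 * ((1 - \<eta>)\<^sup>2 + \<eta>)" by (simp add: power2_eq_square algebra_simps)
  also have "\<dots> \<le> \<eta> * D\<^sup>2 * 1"
  proof (rule mult_left_mono)
    have "(1 - \<eta>)\<^sup>2 + \<eta> = 1 - \<eta> * (1 - \<eta>)" by (simp add: power2_eq_square algebra_simps)
    then show "(1 - \<eta>)\<^sup>2 + \<eta> \<le> 1" using \<eta>_pos \<eta>_le by simp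
  qed (use \<eta>_pos in simp)
  finally show ?case by simp
qed

end

section \<open>Second phase: tracking the output of the first\<close>

locale two_phase = first_phase M N S "count_space {-1..int T - 2}" \<alpha> \<B> f Df L Mg K D X A b B V \<eta> T \<phi> x \<gamma> Q
  for M :: "'w measure" and N :: "'s measure" and S and \<alpha> :: "'w \<Rightarrow> int"
    and \<B> :: "(real^'d) set" and f Df L Mg K D and X :: "'s \<Rightarrow> (real^'d) set"
    and A :: "real^'d^'n" and b B V \<eta> T \<phi> x \<gamma> Q +
  fixes \<psi> :: "nat \<Rightarrow> real^'d \<Rightarrow> real^'d \<Rightarrow> 's \<Rightarrow> real^'d"
    and y :: "nat \<Rightarrow> 'w \<Rightarrow> real^'d" and \<beta> :: "int \<Rightarrow> 'w \<Rightarrow> real^'d"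
  assumes T_pos: "0 < T"
    and \<alpha>_uniform: "distr M (count_space {-1..int T - 2}) \<alpha>
          = uniform_count_measure {-1..int T - 2}"
    and \<psi>_measurable: "\<And>t. t < T \<Longrightarrow>
          (\<lambda>(g, h, s). \<psi> t g h s) \<in> borel \<Otimes>\<^sub>M borel \<Otimes>\<^sub>M N \<rightarrow>\<^sub>M borel"
    and \<psi>_argmin: "\<And>t g h s. t < T \<Longrightarrow> g \<in> \<B> \<Longrightarrow> h \<in> \<B> \<Longrightarrow> s \<in> space N \<Longrightarrow>
          is_arg_min (\<lambda>z. (g - h) \<bullet> z) (\<lambda>z. z \<in> X s) (\<psi> t g h s)"
    and \<beta>_init: "\<And>\<omega>. \<omega> \<in> space M \<Longrightarrow> \<beta> (-1) \<omega> = 0"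
    and y_step: "\<And>t \<omega>. t < T \<Longrightarrow> \<omega> \<in> space M \<Longrightarrow>
          y t \<omega> = \<psi> t (\<beta> (int t - 1) \<omega>) (\<gamma> (\<alpha> \<omega>) \<omega>) (S (T + t) \<omega>)"
    and \<beta>_step: "\<And>t \<omega>. t < T \<Longrightarrow> \<omega> \<in> space M \<Longrightarrow>
          \<beta> (int t) \<omega> = (1 - 1 / (real t + 1)) *\<^sub>R \<beta> (int t - 1) \<omega> + (1 / (real t + 1)) *\<^sub>R y t \<omega>"
begin

definition sampled_slot :: "'w \<Rightarrow> nat" where "sampled_slot \<omega> = nat (\<alpha> \<omega> + 1)"

abbreviation target :: "'w \<Rightarrow> real^'d" where "target \<omega> \<equiv> \<gamma> (\<alpha> \<omega>) \<omega>"

lemma sampled_slot_less: "\<omega> \<in> space M \<Longrightarrow> sampled_slot \<omega> < T" and \<alpha>_eq: "\<omega> \<in> space M \<Longrightarrow> \<alpha> \<omega> = int (sampled_slot \<omega>) - 1"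
  using measurable_space[OF \<alpha>_measurable] by (fastforce simp: sampled_slot_def)+

lemma sampled_slot_measurable: "sampled_slot \<in> H n \<rightarrow>\<^sub>M count_space {..<T}"
proof (rule measurable_compose[OF H_measurable(2), of "\<lambda>k. nat (k + 1)" _ n, folded sampled_slot_def[abs_def]])
  show "(\<lambda>k. nat (k + 1)) \<in> count_space {- 1..int T - 2} \<rightarrow>\<^sub>M count_space {..<T}" by auto
qed

text \<open>
  The independent uniform index is integrated out first, with the states frozen.
\<close>

lemma expectation_at_sampled_slot:
  fixes g :: "nat \<Rightarrow> 'w \<Rightarrow> real"
  assumes g: "\<And>t. t < T \<Longrightarrow>
      g t \<in> borel_measurable (vimage_algebra (space M) (\<lambda>\<omega> t. S t \<omega>) (PiM UNIV (\<lambda>_. N)))"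
    and bound: "\<And>t \<omega>. t < T \<Longrightarrow> \<omega> \<in> space M \<Longrightarrow> \<bar>g t \<omega>\<bar> \<le> C"
  shows "(\<integral>\<omega>. g (sampled_slot \<omega>) \<omega> \<partial>M) = (\<Sum>t<T. \<integral>\<omega>. g t \<omega> \<partial>M) / real T"
proof -
  define G where "G = vimage_algebra (space M) (\<lambda>\<omega> t. S t \<omega>) (PiM UNIV (\<lambda>_. N))"
  let ?K = "{-1..int T - 2}"
  have seq: "(\<lambda>\<omega> t. S t \<omega>) \<in> M \<rightarrow>\<^sub>M PiM UNIV (\<lambda>_. N)"
    using S_measurable by (intro measurable_PiM_single') (auto dest: measurable_space[OF S_measurable] simp: space_PiM)
  have G: "subalgebra M G"
    unfolding subalgebra_def G_def using measurable_sets[OF seq] measurable_space[OF seq]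
    by (auto simp: sets_vimage_algebra2)
  have sp [simp]: "space G = space M" by (simp add: G_def)
  have ind: "indep_set (sets G) (sets (vimage_algebra (space M) \<alpha> (count_space ?K)))"
    using \<alpha>_indep unfolding indep_sets2_eq G_def by (metis Int_commute mult.commute)
  have gK: "(\<lambda>p. g (nat (snd p + 1)) (fst p)) \<in> borel_measurable (G \<Otimes>\<^sub>M count_space ?K)"
  proof (rule measurable_compose_countable'[where I = ?K and g = snd and f = "\<lambda>k p. g (nat (k + 1)) (fst p)"])
    fix k assume "k \<in> ?K"
    then have "nat (k + 1) < T" using T_pos by auto
    then show "(\<lambda>p. g (nat (k + 1)) (fst p)) \<in> borel_measurable (G \<Otimes>\<^sub>M count_space ?K)"
      using g unfolding G_def by (intro measurable_compose[OF measurable_fst]) auto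
  qed auto
  have bK: "\<bar>g (nat (snd p + 1)) (fst p)\<bar> \<le> C" if "p \<in> space (G \<Otimes>\<^sub>M count_space ?K)" for p
    using that T_pos by (intro bound) (auto simp: space_pair_measure)
  have gi: "integrable M (g t)" if "t < T" for t
    using measurable_from_subalg[OF G] g[OF that] bound[OF that]
    by (intro bounded_integrable[of _ C]) (auto simp: G_def)
  \<comment> \<open>The history variable is the sample point itself, observed through the algebra of all states.\<close>
  have U: "(\<lambda>\<omega>. \<omega>) \<in> G \<rightarrow>\<^sub>M G" by simp
  have "(\<integral>\<omega>. g (sampled_slot \<omega>) \<omega> \<partial>M) = (\<integral>\<omega>. (\<integral>k. g (nat (k + 1)) \<omega> \<partial>uniform_count_measure ?K) \<partial>M)"
    using integral_indep_pair[OF ind G U \<alpha>_measurable gK bK] by (simp add: sampled_slot_def \<alpha>_uniform)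
  also have "\<dots> = (\<integral>\<omega>. (\<Sum>t<T. g t \<omega>) / real T \<partial>M)"
  proof (rule Bochner_Integration.integral_cong[OF refl])
    fix \<omega>
    have "(\<Sum>k\<in>?K. g (nat (k + 1)) \<omega>) = (\<Sum>t<T. g t \<omega>)"
      by (rule sum.reindex_bij_witness[of _ "\<lambda>t. int t - 1" "\<lambda>k. nat (k + 1)"]) auto
    then show "(\<integral>k. g (nat (k + 1)) \<omega> \<partial>uniform_count_measure ?K) = (\<Sum>t<T. g t \<omega>) / real T"
      by (simp add: integral_uniform_count_measure)
  qed
  also have "\<dots> = (\<Sum>t<T. \<integral>\<omega>. g t \<omega> \<partial>M) / real T"
    using gi by (simp add: Bochner_Integration.integral_sum)
  finally show ?thesis .
qed

lemma S_sequence_measurable: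
  "S k \<in> vimage_algebra (space M) (\<lambda>\<omega> t. S t \<omega>) (PiM UNIV (\<lambda>_. N)) \<rightarrow>\<^sub>M N"
proof -
  have "(\<lambda>\<omega> t. S t \<omega>) \<in> vimage_algebra (space M) (\<lambda>\<omega> t. S t \<omega>) (PiM UNIV (\<lambda>_. N)) \<rightarrow>\<^sub>M PiM UNIV (\<lambda>_. N)"
    using S_in_space by (intro measurable_vimage_algebra1) (auto simp: space_PiM)
  from measurable_compose[OF this measurable_component_singleton[of k]] show ?thesis by simp
qed

lemma target_in: "\<omega> \<in> space M \<Longrightarrow> target \<omega> \<in> \<B>"
  using \<gamma>_in[of \<omega> "sampled_slot \<omega>"] sampled_slot_less[of \<omega>] \<alpha>_eq[of \<omega>] by simp

lemma target_measurable: "T \<le> n \<Longrightarrow> target \<in> borel_measurable (H n)"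
proof -
  assume n: "T \<le> n"
  have "(\<lambda>\<omega>. \<gamma> (int (sampled_slot \<omega>) - 1) \<omega>) \<in> borel_measurable (H n)"
  proof (rule measurable_compose_countable'[OF _ sampled_slot_measurable])
    fix t assume "t \<in> {..<T}"
    then show "\<gamma> (int t - 1) \<in> borel_measurable (H n)"
      using iterates_adapted[of "H n" t] H_measurable(1) n by auto
  qed auto
  then show ?thesis by (subst measurable_cong[where g="\<lambda>\<omega>. \<gamma> (int (sampled_slot \<omega>) - 1) \<omega>"]) (auto simp: \<alpha>_eq)
qed

text \<open>
  The achievable stand-in for the target, against which the second-phase decisions are compared.
\<close>

definition mean_target :: "'w \<Rightarrow> real^'d" where "mean_target \<omega> = mean_iterate (sampled_slot \<omega>) \<omega>"

lemma mean_target_in: "\<omega> \<in> space M \<Longrightarrow> mean_target \<omega> \<in> \<B>"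
  using mean_iterate_in sampled_slot_less by (simp add: mean_target_def less_imp_le)

lemma mean_target_measurable: "T \<le> n \<Longrightarrow> mean_target \<in> borel_measurable (H n)"
  unfolding mean_target_def[abs_def]
proof (rule measurable_compose_countable'[OF _ sampled_slot_measurable])
  fix t assume "t \<in> {..<T}" "T \<le> n"
  then show "mean_iterate t \<in> borel_measurable (H n)"
    using H_measurable(1) by (intro mean_iterate_measurable) auto
qed auto

lemma mean_target_close: "(\<integral>\<omega>. (norm (mean_target \<omega> - target \<omega>))\<^sup>2 \<partial>M) \<le> \<eta> * D\<^sup>2"
proof -
  let ?g = "\<lambda>t \<omega>. (norm (\<gamma> (int t - 1) \<omega> - mean_iterate t \<omega>))\<^sup>2"
  let ?G = "vimage_algebra (space M) (\<lambda>\<omega> t. S t \<omega>) (PiM UNIV (\<lambda>_. N))"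
  have "(\<integral>\<omega>. (norm (mean_target \<omega> - target \<omega>))\<^sup>2 \<partial>M) = (\<integral>\<omega>. ?g (sampled_slot \<omega>) \<omega> \<partial>M)"
    by (intro Bochner_Integration.integral_cong) (auto simp: mean_target_def \<alpha>_eq norm_minus_commute)
  also have "\<dots> = (\<Sum>t<T. \<integral>\<omega>. ?g t \<omega> \<partial>M) / real T"
  proof (rule expectation_at_sampled_slot)
    fix t assume t: "t < T"
    have [measurable]: "\<gamma> (int t - 1) \<in> borel_measurable ?G" "mean_iterate t \<in> borel_measurable ?G"
      using iterates_adapted[of ?G t] mean_iterate_measurable[of ?G t] S_sequence_measurable t by auto
    show "?g t \<in> borel_measurable ?G" by measurable
    show "\<bar>?g t \<omega>\<bar> \<le> D\<^sup>2" if "\<omega> \<in> space M" for \<omega>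
      using diameter[OF \<gamma>_in mean_iterate_in, OF that _ that, of t t] t by (auto intro!: power_mono)
  qed
  also have "\<dots> \<le> (\<Sum>t<T. \<eta> * D\<^sup>2) / real T"
    using mean_iterate_close by (intro divide_right_mono sum_mono) auto
  also have "\<dots> = \<eta> * D\<^sup>2" using T_pos by simp
  finally show ?thesis .
qed

lemma \<psi>_in: "t < T \<Longrightarrow> g \<in> \<B> \<Longrightarrow> u \<in> \<B> \<Longrightarrow> s \<in> space N \<Longrightarrow> \<psi> t g u s \<in> X s"
  using \<psi>_argmin by (simp add: is_arg_min_def)

lemma \<psi>_in_\<B>: "t < T \<Longrightarrow> g \<in> \<B> \<Longrightarrow> u \<in> \<B> \<Longrightarrow> s \<in> space N \<Longrightarrow> \<psi> t g u s \<in> \<B>"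
  using \<psi>_in X_sub by blast

lemma \<beta>_in: "\<omega> \<in> space M \<Longrightarrow> t \<le> T \<Longrightarrow> \<beta> (int t - 1) \<omega> \<in> \<B>"
proof (induction t)
  case 0
  then show ?case using \<beta>_init zero_in by simp
next
  case (Suc t)
  then have t: "t < T" and IH: "\<beta> (int t - 1) \<omega> \<in> \<B>" by auto
  have "y t \<omega> \<in> \<B>"
    unfolding y_step[OF t Suc.prems(1)] using Suc.prems t IH by (intro \<psi>_in_\<B> target_in S_in_space)
  then have "\<beta> (int t) \<omega> \<in> \<B>"
    unfolding \<beta>_step[OF t Suc.prems(1)] using IH by (intro convexD[OF domain(2)]) auto
  then show ?case by simp
qed

lemma y_in: "\<omega> \<in> space M \<Longrightarrow> t < T \<Longrightarrow> y t \<omega> \<in> \<B>"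
  using \<psi>_in_\<B>[OF _ \<beta>_in target_in S_in_space] y_step by simp

lemma y_measurable_step:
  assumes t: "t < T" and n: "T \<le> n" "T + t < n" and \<beta>: "\<beta> (int t - 1) \<in> borel_measurable (H n)"
  shows "y t \<in> borel_measurable (H n)"
proof -
  note [measurable] = \<beta> target_measurable[OF n(1)] H_measurable(1)[OF n(2)]
  have "(\<lambda>\<omega>. (\<beta> (int t - 1) \<omega>, target \<omega>, S (T + t) \<omega>)) \<in> H n \<rightarrow>\<^sub>M borel \<Otimes>\<^sub>M borel \<Otimes>\<^sub>M N" by measurable
  from measurable_compose[OF this \<psi>_measurable[OF t]] show ?thesis
    by (subst measurable_cong[where g="\<lambda>\<omega>. \<psi> t (\<beta> (int t - 1) \<omega>) (target \<omega>) (S (T + t) \<omega>)"])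
       (auto simp: y_step t)
qed

lemma \<beta>_measurable: "t \<le> T \<Longrightarrow> T + t \<le> n \<Longrightarrow> \<beta> (int t - 1) \<in> borel_measurable (H n)"
proof (induction t)
  case 0
  show ?case by (subst measurable_cong[where g="\<lambda>_. 0"]) (auto simp: \<beta>_init)
next
  case (Suc t)
  then have t: "t < T" and [measurable]: "\<beta> (int t - 1) \<in> borel_measurable (H n)" by auto
  have [measurable]: "y t \<in> borel_measurable (H n)" using Suc t by (intro y_measurable_step) auto
  have "\<beta> (int t) \<in> borel_measurable (H n)"
    by (subst measurable_cong[where g="\<lambda>\<omega>. (1 - 1 / (real t + 1)) *\<^sub>R \<beta> (int t - 1) \<omega> + (1 / (real t + 1)) *\<^sub>R y t \<omega>"])
       (auto simp: \<beta>_step t)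
  then show ?case by simp
qed

lemma y_measurable: "t < T \<Longrightarrow> y t \<in> borel_measurable M"
  by (rule H_imp_M[of _ "Suc (T + t)"]) (auto intro!: y_measurable_step \<beta>_measurable)

text \<open>
  The mean of the second-phase decision \<open>y t\<close> given the past.
\<close>

definition mean_y :: "nat \<Rightarrow> 'w \<Rightarrow> real^'d" where
  "mean_y t \<omega> = (\<integral>s. \<psi> t (\<beta> (int t - 1) \<omega>) (target \<omega>) s \<partial>\<mu>)"

definition tracking_state :: "((real^'d) \<times> (real^'d)) measure" where
  "tracking_state = restrict_space borel \<B> \<Otimes>\<^sub>M restrict_space borel \<B>"

lemma space_tracking_state: "space tracking_state = \<B> \<times> \<B>"
  by (simp add: tracking_state_def space_pair_measure space_restrict_space)

lemma \<psi>_tracking_state_measurable: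
  assumes t: "t < T"
  shows "(\<lambda>((g, u), s). \<psi> t g u s) \<in> borel_measurable (tracking_state \<Otimes>\<^sub>M N)"
  unfolding tracking_state_def by (rule measurable_restrict_arguments[OF \<psi>_measurable[OF t]])

lemma tracking_state_measurable: "t \<le> T \<Longrightarrow> (\<lambda>\<omega>. (\<beta> (int t - 1) \<omega>, target \<omega>)) \<in> H (T + t) \<rightarrow>\<^sub>M tracking_state"
  unfolding tracking_state_def using \<beta>_measurable[of t "T + t"] target_measurable[of "T + t"] \<beta>_in target_in
  by (intro measurable_Pair measurable_restrict_space2) auto

lemma compensate_y:
  assumes t: "t < T" and W: "W \<in> borel_measurable (H (T + t))" "\<And>\<omega>. \<omega> \<in> space M \<Longrightarrow> norm (W \<omega>) \<le> C"
  shows "(\<integral>\<omega>. W \<omega> \<bullet> y t \<omega> \<partial>M) = (\<integral>\<omega>. W \<omega> \<bullet> mean_y t \<omega> \<partial>M)"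
proof -
  have "norm ((\<lambda>((g, q), s). \<psi> t g q s) (u, s)) \<le> D" if "u \<in> space tracking_state" "s \<in> space N" for u s
    using that norm_le_D[OF \<psi>_in_\<B>[OF t]] by (auto simp: space_tracking_state)
  from compensator[OF tracking_state_measurable[OF less_imp_le[OF t]] \<psi>_tracking_state_measurable[OF t] this W]
  have "(\<integral>\<omega>. W \<omega> \<bullet> \<psi> t (\<beta> (int t - 1) \<omega>) (target \<omega>) (S (T + t) \<omega>) \<partial>M) = (\<integral>\<omega>. W \<omega> \<bullet> mean_y t \<omega> \<partial>M)"
    by (simp add: mean_y_def)
  then show ?thesis using y_step[OF t] by (simp cong: Bochner_Integration.integral_cong)
qed

lemma mean_y_measurable: "t < T \<Longrightarrow> mean_y t \<in> borel_measurable M"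
  using compensator_measurable[OF prob_space_\<mu>, of "\<lambda>((g, u), s). \<psi> t g u s" tracking_state
      "\<lambda>\<omega>. (\<beta> (int t - 1) \<omega>, target \<omega>)" "H (T + t)"] \<psi>_tracking_state_measurable[of t] tracking_state_measurable[of t]
  by (intro H_imp_M[of _ "T + t"]) (simp add: mean_y_def[abs_def])

lemma \<psi>_measurable_\<mu>:
  assumes t: "t < T" and "g \<in> \<B>" "u \<in> \<B>"
  shows "\<psi> t g u \<in> borel_measurable \<mu>"
  using measurable_compose_Pair1[OF _ \<psi>_tracking_state_measurable[OF t], of "(g, u)"] assms
  by (simp add: space_tracking_state)

lemma mean_y_in:
  assumes \<omega>: "\<omega> \<in> space M" and t: "t < T"
  shows "mean_y t \<omega> \<in> \<B>"
proof -
  interpret \<mu>: prob_space \<mu> by (rule prob_space_\<mu>)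
  have \<beta>: "\<beta> (int t - 1) \<omega> \<in> \<B>" using \<beta>_in[OF \<omega>, of t] t by simp
  show ?thesis unfolding mean_y_def
  proof (rule \<mu>.expectation_in_closed_convex[OF domain(2) compact_imp_closed[OF domain(1)]])
    show "integrable \<mu> (\<psi> t (\<beta> (int t - 1) \<omega>) (target \<omega>))"
      using \<psi>_measurable_\<mu>[OF t \<beta> target_in[OF \<omega>]] norm_le_D[OF \<psi>_in_\<B>[OF t \<beta> target_in[OF \<omega>]]]
      by (intro \<mu>.integrable_const_bound[of _ D]) (auto intro!: AE_I2)
  qed (use \<psi>_in_\<B>[OF t \<beta> target_in[OF \<omega>]] in \<open>auto intro!: AE_I2\<close>)
qed

lemma mean_y_support:
  assumes \<omega>: "\<omega> \<in> space M" and t: "t < T"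
  shows "(\<beta> (int t - 1) \<omega> - target \<omega>) \<bullet> mean_y t \<omega> \<le> (\<beta> (int t - 1) \<omega> - target \<omega>) \<bullet> mean_target \<omega>"
  unfolding mean_y_def mean_target_def
proof (rule mean_iterate_support[OF \<omega>])
  have \<beta>: "\<beta> (int t - 1) \<omega> \<in> \<B>" using \<beta>_in[OF \<omega>, of t] t by simp
  show "sampled_slot \<omega> \<le> T" using sampled_slot_less[OF \<omega>] by simp
  show "\<psi> t (\<beta> (int t - 1) \<omega>) (target \<omega>) \<in> borel_measurable \<mu>" by (rule \<psi>_measurable_\<mu>[OF t \<beta> target_in[OF \<omega>]])
  show "\<psi> t (\<beta> (int t - 1) \<omega>) (target \<omega>) s \<in> X s \<and> (\<forall>u\<in>X s. (\<beta> (int t - 1) \<omega> - target \<omega>) \<bullet>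
      \<psi> t (\<beta> (int t - 1) \<omega>) (target \<omega>) s \<le> (\<beta> (int t - 1) \<omega> - target \<omega>) \<bullet> u)" if "s \<in> space N" for s
    using \<psi>_argmin[OF t \<beta> target_in[OF \<omega>] that] by (auto simp: is_arg_min_def not_less)
qed

text \<open>
  Scaled by \<open>t\<close>, the deviation of the running average is the sum of \<open>y s - target\<close> over \<open>s < t\<close>; the step
  sizes disappear from the recursion.
\<close>

definition deviation :: "nat \<Rightarrow> 'w \<Rightarrow> real^'d" where
  "deviation t \<omega> = real t *\<^sub>R (\<beta> (int t - 1) \<omega> - target \<omega>)"

lemma scaled_\<beta>_step:
  assumes "t < T" "\<omega> \<in> space M"
  shows "real (Suc t) *\<^sub>R \<beta> (int t) \<omega> = real t *\<^sub>R \<beta> (int t - 1) \<omega> + y t \<omega>"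
proof -
  have "real (Suc t) * (1 - 1 / (real t + 1)) = real t" "real (Suc t) * (1 / (real t + 1)) = 1"
    by (simp_all add: field_simps)
  then show ?thesis unfolding \<beta>_step[OF assms] by (simp only: scaleR_add_right scaleR_scaleR scaleR_one)
qed

lemma deviation_Suc: "t < T \<Longrightarrow> \<omega> \<in> space M \<Longrightarrow> deviation (Suc t) \<omega> = deviation t \<omega> + (y t \<omega> - target \<omega>)"
  using scaled_\<beta>_step[of t \<omega>] by (simp add: deviation_def scaleR_diff_right algebra_simps)

lemma deviation_bound:
  assumes "\<omega> \<in> space M" "t \<le> T"
  shows "norm (deviation t \<omega>) \<le> real t * D"
  using diameter[OF \<beta>_in[OF assms] target_in[OF assms(1)]] by (simp add: deviation_def mult_left_mono)

lemma deviation_measurable: "t \<le> T \<Longrightarrow> deviation t \<in> borel_measurable (H (T + t))"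
  using \<beta>_measurable[of t "T + t"] target_measurable[of "T + t"] unfolding deviation_def[abs_def] by measurable

text \<open>
  Let \<open>u\<close> be the \<open>L\<^sup>2\<close> norm of the deviation and \<open>\<delta> = \<surd>\<eta> D\<close>.  Expanding the square of the next
  deviation, the cross term is at most \<open>2 u \<delta>\<close>: given the past, \<open>y t\<close> is at least as good as
  \<open>mean_target\<close> in the direction of the deviation, and \<open>mean_target\<close> is within \<open>\<delta>\<close> of the target.
  So \<open>u\<^sup>2\<close> grows to at most \<open>(u + \<delta>)\<^sup>2 + D\<^sup>2\<close>, and \<open>t \<delta> + \<surd>t D\<close> is a supersolution of this recursion.
\<close>

lemma deviation_second_moment:
  assumes "t \<le> T"
  shows "(\<integral>\<omega>. (norm (deviation t \<omega>))\<^sup>2 \<partial>M) \<le> (real t * (sqrt \<eta> * D) + sqrt (real t) * D)\<^sup>2"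
  using assms
proof (induction t)
  case 0
  show ?case by (simp add: deviation_def)
next
  case (Suc t)
  then have t: "t < T" by simp
  let ?\<delta> = "sqrt \<eta> * D" and ?u = "sqrt (\<integral>\<omega>. (norm (deviation t \<omega>))\<^sup>2 \<partial>M)"
  let ?c = "real t * (sqrt \<eta> * D) + sqrt (real t) * D"
  have pH: "deviation t \<in> borel_measurable (H (T + t))" using t by (intro deviation_measurable) simp
  have hM: "target \<in> borel_measurable M" "mean_target \<in> borel_measurable M"
    using H_imp_M[OF target_measurable[OF order_refl]] H_imp_M[OF mean_target_measurable[OF order_refl]] by auto
  note [measurable] = H_imp_M[OF pH] y_measurable[OF t] mean_y_measurable[OF t] hM
  have pb: "norm (deviation t \<omega>) \<le> real t * D" if "\<omega> \<in> space M" for \<omega> using deviation_bound[OF that, of t] t by simp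
  have inner_int: "integrable M (\<lambda>\<omega>. deviation t \<omega> \<bullet> v \<omega>)"
    if "v \<in> borel_measurable M" "\<And>\<omega>. \<omega> \<in> space M \<Longrightarrow> v \<omega> \<in> \<B>" for v
  proof (rule bounded_integrable)
    show "(\<lambda>\<omega>. deviation t \<omega> \<bullet> v \<omega>) \<in> borel_measurable M" using that(1) by measurable
    show "norm (deviation t \<omega> \<bullet> v \<omega>) \<le> (real t * D) * D" if \<omega>: "\<omega> \<in> space M" for \<omega>
      using pb[OF \<omega>] norm_le_D[OF \<open>\<And>\<omega>. \<omega> \<in> space M \<Longrightarrow> v \<omega> \<in> \<B>\<close>[OF \<omega>]] D_nonneg
      by (auto intro!: order_trans[OF Cauchy_Schwarz_ineq2] mult_mono)
  qed
  have ints: "integrable M (\<lambda>\<omega>. deviation t \<omega> \<bullet> y t \<omega>)" "integrable M (\<lambda>\<omega>. deviation t \<omega> \<bullet> target \<omega>)"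
    "integrable M (\<lambda>\<omega>. deviation t \<omega> \<bullet> mean_target \<omega>)" "integrable M (\<lambda>\<omega>. deviation t \<omega> \<bullet> mean_y t \<omega>)"
    using y_in t target_in mean_target_in mean_y_in by (auto intro!: inner_int)
  have sq_int: "integrable M (\<lambda>\<omega>. (norm (deviation t \<omega>))\<^sup>2)"
    by (rule bounded_integrable[of _ "(real t * D)\<^sup>2"]) (use pb in \<open>auto intro!: power_mono simp del: power_mult_distrib\<close>)
  have yh_int: "integrable M (\<lambda>\<omega>. (norm (y t \<omega> - target \<omega>))\<^sup>2)"
    by (rule bounded_integrable[of _ "D\<^sup>2"]) (use diameter y_in t target_in in \<open>auto intro!: power_mono\<close>)
  have hh_int: "integrable M (\<lambda>\<omega>. (norm (mean_target \<omega> - target \<omega>))\<^sup>2)"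
    by (rule bounded_integrable[of _ "D\<^sup>2"]) (use diameter target_in mean_target_in in \<open>auto intro!: power_mono\<close>)
  have "(\<integral>\<omega>. deviation t \<omega> \<bullet> y t \<omega> - deviation t \<omega> \<bullet> target \<omega> \<partial>M) = (\<integral>\<omega>. deviation t \<omega> \<bullet> mean_y t \<omega> - deviation t \<omega> \<bullet> target \<omega> \<partial>M)"
    using compensate_y[OF t pH pb] ints by simp
  also have "\<dots> \<le> (\<integral>\<omega>. deviation t \<omega> \<bullet> (mean_target \<omega> - target \<omega>) \<partial>M)"
  proof (rule integral_mono)
    fix \<omega> assume "\<omega> \<in> space M"
    from mult_left_mono[OF mean_y_support[OF this t], of "real t"]
    show "deviation t \<omega> \<bullet> mean_y t \<omega> - deviation t \<omega> \<bullet> target \<omega> \<le> deviation t \<omega> \<bullet> (mean_target \<omega> - target \<omega>)"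
      by (simp add: deviation_def inner_diff_right)
  qed (use ints in \<open>auto simp: inner_diff_right\<close>)
  also have "\<dots> \<le> ?u * sqrt (\<integral>\<omega>. (norm (mean_target \<omega> - target \<omega>))\<^sup>2 \<partial>M)"
    by (rule integral_inner_le_L2) (use ints sq_int hh_int in \<open>auto simp: inner_diff_right\<close>)
  also have "\<dots> \<le> ?u * ?\<delta>"
  proof (rule mult_left_mono)
    have "sqrt (\<integral>\<omega>. (norm (mean_target \<omega> - target \<omega>))\<^sup>2 \<partial>M) \<le> sqrt (\<eta> * D\<^sup>2)" using mean_target_close by simp
    then show "sqrt (\<integral>\<omega>. (norm (mean_target \<omega> - target \<omega>))\<^sup>2 \<partial>M) \<le> ?\<delta>"
      using D_nonneg by (simp add: real_sqrt_mult)
  qed simp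
  finally have cross: "(\<integral>\<omega>. deviation t \<omega> \<bullet> y t \<omega> - deviation t \<omega> \<bullet> target \<omega> \<partial>M) \<le> ?u * ?\<delta>" .
  have c0: "0 \<le> ?c" using D_nonneg \<eta>_pos by simp
  have uc: "?u \<le> ?c" using Suc.IH t c0 by (intro real_le_lsqrt) auto
  have \<delta>0: "0 \<le> ?\<delta>" using D_nonneg \<eta>_pos by simp
  have "(\<integral>\<omega>. (norm (deviation (Suc t) \<omega>))\<^sup>2 \<partial>M) =
      (\<integral>\<omega>. (norm (deviation t \<omega>))\<^sup>2 + 2 * (deviation t \<omega> \<bullet> y t \<omega> - deviation t \<omega> \<bullet> target \<omega>) + (norm (y t \<omega> - target \<omega>))\<^sup>2 \<partial>M)"
    unfolding power2_norm_eq_inner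
    by (intro Bochner_Integration.integral_cong refl)
       (simp add: deviation_Suc t inner_add_left inner_add_right inner_diff_left inner_diff_right inner_commute algebra_simps)
  also have "\<dots> = (\<integral>\<omega>. (norm (deviation t \<omega>))\<^sup>2 \<partial>M) + 2 * (\<integral>\<omega>. deviation t \<omega> \<bullet> y t \<omega> - deviation t \<omega> \<bullet> target \<omega> \<partial>M)
      + (\<integral>\<omega>. (norm (y t \<omega> - target \<omega>))\<^sup>2 \<partial>M)"
    using ints sq_int yh_int by (simp del: Bochner_Integration.integral_diff right_diff_distrib_numeral)
  also have "\<dots> \<le> ?u\<^sup>2 + 2 * (?u * ?\<delta>) + D\<^sup>2"
  proof (intro add_mono mult_left_mono cross)
    have "(\<integral>\<omega>. (norm (y t \<omega> - target \<omega>))\<^sup>2 \<partial>M) \<le> (\<integral>\<omega>. D\<^sup>2 \<partial>M)"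
      using yh_int diameter y_in t target_in by (intro integral_mono) (auto intro!: power_mono)
    then show "(\<integral>\<omega>. (norm (y t \<omega> - target \<omega>))\<^sup>2 \<partial>M) \<le> D\<^sup>2" by (simp add: prob_space)
  qed auto
  also have "\<dots> \<le> (?u + ?\<delta>)\<^sup>2 + D\<^sup>2" by (simp add: power2_sum)
  also have "\<dots> \<le> (?c + ?\<delta>)\<^sup>2 + D\<^sup>2"
    using uc \<delta>0 by (intro add_right_mono power_mono) auto
  also have "\<dots> \<le> (real (Suc t) * ?\<delta> + sqrt (real (Suc t)) * D)\<^sup>2"
  proof -
    let ?m = "real (Suc t) * ?\<delta>"
    have "(?c + ?\<delta>)\<^sup>2 + D\<^sup>2 = (?m + sqrt (real t) * D)\<^sup>2 + D\<^sup>2" by (simp add: algebra_simps)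
    also have "\<dots> = ?m\<^sup>2 + 2 * (?m * (sqrt (real t) * D)) + real (Suc t) * D\<^sup>2"
      by (simp add: power2_sum power_mult_distrib algebra_simps)
    also have "\<dots> \<le> ?m\<^sup>2 + 2 * (?m * (sqrt (real (Suc t)) * D)) + real (Suc t) * D\<^sup>2"
      using \<delta>0 D_nonneg by (intro add_mono mult_left_mono mult_right_mono order_refl) auto
    also have "\<dots> = (?m + sqrt (real (Suc t)) * D)\<^sup>2"
      by (simp add: power2_sum power_mult_distrib)
    finally show ?thesis .
  qed
  finally show ?case .
qed

text \<open>
  The output of the second phase; the step sizes \<open>1 / (t + 1)\<close> make it the last iterate.
\<close>

definition time_average :: "'w \<Rightarrow> real^'d" where
  "time_average \<omega> = (1 / real T) *\<^sub>R (\<Sum>t<T. y t \<omega>)"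

lemma time_average_eq: "\<omega> \<in> space M \<Longrightarrow> time_average \<omega> = \<beta> (int T - 1) \<omega>"
proof -
  assume \<omega>: "\<omega> \<in> space M"
  have "(\<Sum>t<n. y t \<omega>) = real n *\<^sub>R \<beta> (int n - 1) \<omega>" if "n \<le> T" for n
    using that
  proof (induction n)
    case (Suc n)
    then show ?case using scaled_\<beta>_step[of n \<omega>] \<omega> by simp
  qed simp
  then show ?thesis using T_pos by (simp add: time_average_def)
qed

lemma time_average_in: "\<omega> \<in> space M \<Longrightarrow> time_average \<omega> \<in> \<B>"
  using \<beta>_in[of \<omega> T] by (simp add: time_average_eq)

lemma time_average_measurable: "time_average \<in> borel_measurable M"
  unfolding time_average_def[abs_def] using y_measurable by measurable

lemma target_measurable_M: "target \<in> borel_measurable M"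
  by (rule H_imp_M[OF target_measurable[OF order_refl]])

lemma time_average_close: "(\<integral>\<omega>. (norm (time_average \<omega> - target \<omega>))\<^sup>2 \<partial>M) \<le> (sqrt \<eta> * D + D / sqrt (real T))\<^sup>2"
proof -
  have T: "real T > 0" using T_pos by simp
  have "(\<integral>\<omega>. (norm (time_average \<omega> - target \<omega>))\<^sup>2 \<partial>M) = (\<integral>\<omega>. (norm (deviation T \<omega>))\<^sup>2 / (real T)\<^sup>2 \<partial>M)"
    using T by (intro Bochner_Integration.integral_cong) (auto simp: deviation_def time_average_eq power_mult_distrib)
  also have "\<dots> \<le> (real T * (sqrt \<eta> * D) + sqrt (real T) * D)\<^sup>2 / (real T)\<^sup>2"
    using deviation_second_moment[of T] by (simp add: divide_right_mono)
  also have "\<dots> = ((real T * (sqrt \<eta> * D) + sqrt (real T) * D) / real T)\<^sup>2"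
    by (simp add: power_divide)
  also have "(real T * (sqrt \<eta> * D) + sqrt (real T) * D) / real T = sqrt \<eta> * D + D / sqrt (real T)"
  proof -
    have "sqrt (real T) / real T = 1 / sqrt (real T)"
      using T real_sqrt_mult_self[of "real T"] by (simp add: field_simps)
    then have "sqrt (real T) * D / real T = D / sqrt (real T)"
      by (metis mult.commute mult.left_neutral times_divide_eq_left)
    then show ?thesis using T by (simp add: add_divide_distrib)
  qed
  finally show ?thesis .
qed

abbreviation "cond_average \<equiv> vec_cond_exp M (H T) time_average"
abbreviation "\<epsilon> \<equiv> sqrt \<eta> * D + D / sqrt (real T)"

lemma \<epsilon>_nonneg: "0 \<le> \<epsilon>" using D_nonneg \<eta>_pos by simp

text \<open>
  The queue term of the drift bound is nonnegative and is dropped.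
\<close>

lemma expected_gap_target:
  "(\<integral>\<omega>. \<G> (target \<omega>) \<partial>M) \<le> 2 * K / (\<eta> * real T) + \<eta> * L * D\<^sup>2 / 2 + B\<^sup>2 / (2 * V)"
proof -
  let ?G = "vimage_algebra (space M) (\<lambda>\<omega> t. S t \<omega>) (PiM UNIV (\<lambda>_. N))"
  have "(\<integral>\<omega>. \<G> (target \<omega>) \<partial>M) = (\<integral>\<omega>. (\<lambda>t \<omega>. \<G> (\<gamma> (int t - 1) \<omega>)) (sampled_slot \<omega>) \<omega> \<partial>M)"
    by (intro Bochner_Integration.integral_cong) (auto simp: \<alpha>_eq)
  also have "\<dots> = (\<Sum>t<T. \<integral>\<omega>. \<G> (\<gamma> (int t - 1) \<omega>) \<partial>M) / real T"
    using \<G>_\<gamma>_measurable[of ?G] S_sequence_measurable \<G>_abs_le[OF \<gamma>_in]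
    by (intro expectation_at_sampled_slot[where C = "Mg * D"]) auto
  finally have eq: "(\<integral>\<omega>. \<G> (target \<omega>) \<partial>M) = (\<Sum>t<T. \<integral>\<omega>. \<G> (\<gamma> (int t - 1) \<omega>) \<partial>M) / real T" .
  have "0 \<le> (\<integral>\<omega>. (norm (Q T \<omega>))\<^sup>2 \<partial>M)" by simp
  then have "V * (\<Sum>t<T. \<integral>\<omega>. \<G> (\<gamma> (int t - 1) \<omega>) \<partial>M)
      \<le> 2 * K * V / \<eta> + real T * (V * \<eta> * L * D\<^sup>2 / 2 + B\<^sup>2 / 2)"
    using first_phase_drift by linarith
  then have "V * (\<Sum>t<T. \<integral>\<omega>. \<G> (\<gamma> (int t - 1) \<omega>) \<partial>M) / (V * real T)
      \<le> (2 * K * V / \<eta> + real T * (V * \<eta> * L * D\<^sup>2 / 2 + B\<^sup>2 / 2)) / (V * real T)"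
    using V_pos T_pos by (intro divide_right_mono) auto
  also have "\<dots> = 2 * K / (\<eta> * real T) + \<eta> * L * D\<^sup>2 / 2 + B\<^sup>2 / (2 * V)"
    using V_pos T_pos \<eta>_pos by (simp add: field_simps)
  finally show ?thesis using V_pos by (simp add: eq)
qed

text \<open>
  The target is known after the first phase, so conditioning does not increase the distance to it, and
  the gap pays its Lipschitz constant \<open>L D + M\<close> times that distance.
\<close>

lemma expected_gap_cond_average:
  "integrable M (\<lambda>\<omega>. \<G> (cond_average \<omega>))"
  "(\<integral>\<omega>. \<G> (cond_average \<omega>) \<partial>M)
     \<le> 2 * K / (\<eta> * real T) + \<eta> * L * D\<^sup>2 / 2 + B\<^sup>2 / (2 * V) + (L * D + Mg) * \<epsilon>"
proof -
  interpret finite_measure_subalgebra M "H T"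
    by unfold_locales (rule H_measurable(3))
  have xb: "\<forall>\<omega>\<in>space M. norm (time_average \<omega>) \<le> D" "\<forall>\<omega>\<in>space M. norm (target \<omega>) \<le> D"
    using norm_le_D time_average_in target_in by auto
  have cM [measurable]: "cond_average \<in> borel_measurable M" by (rule H_imp_M[OF vec_cond_exp_measurable])
  note hM [measurable] = target_measurable_M
  note Gm = FW_gap_measurable[OF feasible feasible_sub]
  have cin: "AE \<omega> in M. cond_average \<omega> \<in> \<B>"
    by (rule vec_cond_exp_in_convex[OF time_average_measurable time_average_in domain]) (use zero_in in auto)
  note contraction = vec_cond_exp_contraction[OF time_average_measurable xb(1) target_measurable[OF order_refl] xb(2)]
  show Gi: "integrable M (\<lambda>\<omega>. \<G> (cond_average \<omega>))"
  proof (rule integrable_const_bound[of _ "Mg * D"])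
    show "AE \<omega> in M. norm (\<G> (cond_average \<omega>)) \<le> Mg * D"
      using cin by eventually_elim (simp add: \<G>_abs_le)
  qed (rule measurable_compose[OF cM Gm])
  have Gh: "integrable M (\<lambda>\<omega>. \<G> (target \<omega>))"
    using measurable_compose[OF hM Gm] \<G>_abs_le[OF target_in] by (intro bounded_integrable[of _ "Mg * D"]) auto
  have ni: "integrable M (\<lambda>\<omega>. norm (cond_average \<omega> - target \<omega>))"
  proof (rule integrable_const_bound[of _ D])
    show "AE \<omega> in M. norm (norm (cond_average \<omega> - target \<omega>)) \<le> D"
      using cin AE_space by eventually_elim (simp add: diameter target_in)
  qed measurable
  have "(\<integral>\<omega>. norm (cond_average \<omega> - target \<omega>) \<partial>M) \<le> sqrt (\<integral>\<omega>. (norm (cond_average \<omega> - target \<omega>))\<^sup>2 \<partial>M)"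
    by (rule integral_le_sqrt_integral_square[OF ni contraction(1)])
  also have "\<dots> \<le> sqrt (\<epsilon>\<^sup>2)"
    using contraction(2) time_average_close by (intro real_sqrt_le_mono) linarith
  also have "\<dots> = \<epsilon>" using \<epsilon>_nonneg by (rule real_sqrt_unique[OF refl])
  finally have dist: "(\<integral>\<omega>. norm (cond_average \<omega> - target \<omega>) \<partial>M) \<le> \<epsilon>" .
  have "(\<integral>\<omega>. \<G> (cond_average \<omega>) \<partial>M) \<le> (\<integral>\<omega>. \<G> (target \<omega>) + (L * D + Mg) * norm (cond_average \<omega> - target \<omega>) \<partial>M)"
  proof (rule integral_mono_AE)
    show "AE \<omega> in M. \<G> (cond_average \<omega>) \<le> \<G> (target \<omega>) + (L * D + Mg) * norm (cond_average \<omega> - target \<omega>)"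
      using cin AE_space by eventually_elim (rule FW_gap_le_add[OF feasible feasible_sub _ target_in])
  qed (use Gi Gh ni in auto)
  also have "\<dots> = (\<integral>\<omega>. \<G> (target \<omega>) \<partial>M) + (L * D + Mg) * (\<integral>\<omega>. norm (cond_average \<omega> - target \<omega>) \<partial>M)"
    using Gh ni by simp
  also have "\<dots> \<le> (2 * K / (\<eta> * real T) + \<eta> * L * D\<^sup>2 / 2 + B\<^sup>2 / (2 * V)) + (L * D + Mg) * \<epsilon>"
    using expected_gap_target dist L_nonneg D_nonneg Mg_nonneg by (intro add_mono mult_left_mono) auto
  finally show "(\<integral>\<omega>. \<G> (cond_average \<omega>) \<partial>M)
     \<le> 2 * K / (\<eta> * real T) + \<eta> * L * D\<^sup>2 / 2 + B\<^sup>2 / (2 * V) + (L * D + Mg) * \<epsilon>" .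
qed

text \<open>
  The gap at an iterate can be negative, because an iterate need not be feasible; its lower bound
  \<open>- M D\<close> is the origin of the term \<open>2 V M D\<close>.
\<close>

lemma expected_queue:
  "(\<integral>\<omega>. Q T \<omega> $ i \<partial>M) \<le> sqrt (4 * K * V / \<eta> + real T * (V * \<eta> * L * D\<^sup>2 + B\<^sup>2 + 2 * V * Mg * D))"
proof -
  have "- (Mg * D) \<le> (\<integral>\<omega>. \<G> (\<gamma> (int t - 1) \<omega>) \<partial>M)" if t: "t < T" for t
  proof -
    have "(\<integral>\<omega>. - (Mg * D) \<partial>M) \<le> (\<integral>\<omega>. \<G> (\<gamma> (int t - 1) \<omega>) \<partial>M)"
    proof (rule integral_mono)
      have G: "\<bar>\<G> (\<gamma> (int t - 1) \<omega>)\<bar> \<le> Mg * D" if "\<omega> \<in> space M" for \<omega>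
        using \<G>_abs_le[OF \<gamma>_in[OF that, of t]] t by simp
      show "- (Mg * D) \<le> \<G> (\<gamma> (int t - 1) \<omega>)" if "\<omega> \<in> space M" for \<omega>
        using G[OF that] by linarith
      show "integrable M (\<lambda>\<omega>. \<G> (\<gamma> (int t - 1) \<omega>))"
        using \<G>_\<gamma>_measurable[of M t] S_measurable G t by (intro bounded_integrable[of _ "Mg * D"]) auto
    qed auto
    then show ?thesis by (simp add: prob_space)
  qed
  then have "(\<Sum>t<T. - (Mg * D)) \<le> (\<Sum>t<T. \<integral>\<omega>. \<G> (\<gamma> (int t - 1) \<omega>) \<partial>M)"
    by (intro sum_mono) auto
  then have "V * (\<Sum>t<T. - (Mg * D)) \<le> V * (\<Sum>t<T. \<integral>\<omega>. \<G> (\<gamma> (int t - 1) \<omega>) \<partial>M)"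
    using V_pos by (intro mult_left_mono) auto
  then have "(\<integral>\<omega>. (norm (Q T \<omega>))\<^sup>2 \<partial>M)
      \<le> 2 * (2 * K * V / \<eta> + real T * (V * \<eta> * L * D\<^sup>2 / 2 + B\<^sup>2 / 2) + V * (real T * (Mg * D)))"
    using first_phase_drift by simp
  also have "\<dots> = 4 * K * V / \<eta> + real T * (V * \<eta> * L * D\<^sup>2 + B\<^sup>2 + 2 * V * Mg * D)"
    by (simp add: algebra_simps)
  finally have q: "(\<integral>\<omega>. (norm (Q T \<omega>))\<^sup>2 \<partial>M) \<le> \<dots>" .
  have le: "(Q T \<omega> $ i)\<^sup>2 \<le> (norm (Q T \<omega>))\<^sup>2" for \<omega>
    using component_le_norm_cart[of "Q T \<omega>" i] by (simp flip: abs_le_square_iff)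
  have Qm: "(\<lambda>\<omega>. Q T \<omega> $ i) \<in> borel_measurable M" using norm_Q_integrable(2) by auto
  have i2: "integrable M (\<lambda>\<omega>. (Q T \<omega> $ i)\<^sup>2)"
    by (rule Bochner_Integration.integrable_bound[OF norm_Q_integrable(1)]) (use Qm le in auto)
  have "(\<integral>\<omega>. Q T \<omega> $ i \<partial>M) \<le> sqrt (\<integral>\<omega>. (Q T \<omega> $ i)\<^sup>2 \<partial>M)"
    by (rule integral_le_sqrt_integral_square[OF norm_Q_integrable(2) i2])
  also have "\<dots> \<le> sqrt (\<integral>\<omega>. (norm (Q T \<omega>))\<^sup>2 \<partial>M)"
    using i2 norm_Q_integrable(1) le by (intro real_sqrt_le_mono integral_mono) auto
  also have "\<dots> \<le> sqrt (4 * K * V / \<eta> + real T * (V * \<eta> * L * D\<^sup>2 + B\<^sup>2 + 2 * V * Mg * D))"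
    using q by simp
  finally show ?thesis .
qed

text \<open>
  Three errors add up: the final queue, the boundary term between decisions and iterates of the first
  phase, and the tracking error of the second phase.
\<close>

lemma expected_constraint:
  "row i A \<bullet> (\<integral>\<omega>. time_average \<omega> \<partial>M) - b $ i
     \<le> sqrt (4 * K * V / \<eta> + real T * (V * \<eta> * L * D\<^sup>2 + B\<^sup>2 + 2 * V * Mg * D)) / real T
       + norm (row i A) * D / (\<eta> * real T) + norm (row i A) * \<epsilon>"
proof -
  let ?G = "vimage_algebra (space M) (\<lambda>\<omega> t. S t \<omega>) (PiM UNIV (\<lambda>_. N))"
  let ?r = "row i A" and ?q = "sqrt (4 * K * V / \<eta> + real T * (V * \<eta> * L * D\<^sup>2 + B\<^sup>2 + 2 * V * Mg * D))"
  note hM [measurable] = target_measurable_M and xM [measurable] = time_average_measurable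
  have xi: "integrable M time_average" and hi: "integrable M target"
    using norm_le_D[OF time_average_in] norm_le_D[OF target_in] by (auto intro!: bounded_integrable[of _ D])
  have gm: "(\<lambda>\<omega>. ?r \<bullet> \<gamma> (int t - 1) \<omega> - b $ i) \<in> borel_measurable F"
    if "t < T" "space F = space M" "\<And>k. S k \<in> F \<rightarrow>\<^sub>M N" for t F
    using iterates_adapted[of F t] that by (intro borel_measurable_diff borel_measurable_inner) auto
  have gb: "\<bar>?r \<bullet> \<gamma> (int t - 1) \<omega> - b $ i\<bar> \<le> \<bar>B\<bar>" if "t < T" "\<omega> \<in> space M" for t \<omega>
    using constraint_le[OF \<gamma>_in] that by simp
  have gi: "integrable M (\<lambda>\<omega>. ?r \<bullet> \<gamma> (int t - 1) \<omega> - b $ i)" if "t < T" for t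
    using gm[OF that, of M] gb[OF that] S_measurable by (intro bounded_integrable[of _ "\<bar>B\<bar>"]) auto
  have "?r \<bullet> (\<integral>\<omega>. target \<omega> \<partial>M) - b $ i = (\<integral>\<omega>. ?r \<bullet> target \<omega> - b $ i \<partial>M)"
    using hi by (simp add: prob_space)
  also have "\<dots> = (\<integral>\<omega>. (\<lambda>t \<omega>. ?r \<bullet> \<gamma> (int t - 1) \<omega> - b $ i) (sampled_slot \<omega>) \<omega> \<partial>M)"
    by (intro Bochner_Integration.integral_cong) (auto simp: \<alpha>_eq)
  also have "\<dots> = (\<Sum>t<T. \<integral>\<omega>. ?r \<bullet> \<gamma> (int t - 1) \<omega> - b $ i \<partial>M) / real T"
    using gm[of _ ?G] S_sequence_measurable gb by (intro expectation_at_sampled_slot[where C = "\<bar>B\<bar>"]) auto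
  also have "\<dots> = (\<integral>\<omega>. (\<Sum>t<T. ?r \<bullet> \<gamma> (int t - 1) \<omega> - b $ i) \<partial>M) / real T"
    using gi by (simp add: Bochner_Integration.integral_sum del: Bochner_Integration.integral_diff)
  also have "\<dots> \<le> (\<integral>\<omega>. Q T \<omega> $ i + norm ?r * D / \<eta> \<partial>M) / real T"
    using gi norm_Q_integrable(2) average_constraint
    by (intro divide_right_mono integral_mono Bochner_Integration.integrable_sum) auto
  also have "\<dots> \<le> (?q + norm ?r * D / \<eta>) / real T"
    using norm_Q_integrable(2) expected_queue by (intro divide_right_mono) (auto simp: prob_space)
  finally have target: "?r \<bullet> (\<integral>\<omega>. target \<omega> \<partial>M) - b $ i \<le> ?q / real T + norm ?r * D / (\<eta> * real T)"
    by (simp add: add_divide_distrib)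
  have ni: "integrable M (\<lambda>\<omega>. norm (time_average \<omega> - target \<omega>))" "integrable M (\<lambda>\<omega>. (norm (time_average \<omega> - target \<omega>))\<^sup>2)"
    using diameter[OF time_average_in target_in]
    by (auto intro!: bounded_integrable[of _ D] bounded_integrable[of "\<lambda>\<omega>. (norm (time_average \<omega> - target \<omega>))\<^sup>2" "D\<^sup>2"] power_mono)
  have "?r \<bullet> (\<integral>\<omega>. time_average \<omega> \<partial>M) - ?r \<bullet> (\<integral>\<omega>. target \<omega> \<partial>M) = (\<integral>\<omega>. ?r \<bullet> (time_average \<omega> - target \<omega>) \<partial>M)"
    using xi hi by (simp add: inner_diff_right)
  also have "\<dots> \<le> (\<integral>\<omega>. norm ?r * norm (time_average \<omega> - target \<omega>) \<partial>M)"
    using xi hi ni by (intro integral_mono norm_cauchy_schwarz) auto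
  also have "\<dots> = norm ?r * (\<integral>\<omega>. norm (time_average \<omega> - target \<omega>) \<partial>M)" by simp
  also have "\<dots> \<le> norm ?r * \<epsilon>"
  proof (rule mult_left_mono)
    have "(\<integral>\<omega>. norm (time_average \<omega> - target \<omega>) \<partial>M) \<le> sqrt (\<integral>\<omega>. (norm (time_average \<omega> - target \<omega>))\<^sup>2 \<partial>M)"
      by (rule integral_le_sqrt_integral_square[OF ni])
    also have "\<dots> \<le> sqrt (\<epsilon>\<^sup>2)" using time_average_close by (rule real_sqrt_le_mono)
    also have "\<dots> = \<epsilon>" using \<epsilon>_nonneg by (rule real_sqrt_unique[OF refl])
    finally show "(\<integral>\<omega>. norm (time_average \<omega> - target \<omega>) \<partial>M) \<le> \<epsilon>" .
  qed simp
  finally show ?thesis using target by linarith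
qed

end

section \<open>The two-phase guarantee\<close>

theorem corollary4p3:
  fixes M :: "'w measure"
    and \<S> :: "(real^'m) set" and X :: "real^'m \<Rightarrow> (real^'d) set" and \<B> :: "(real^'d) set"
    and A :: "real^'d^'n" and b :: "real^'n"
    and f :: "real^'d \<Rightarrow> real" and Df :: "real^'d \<Rightarrow> real^'d"
    and L Mg K B D V \<eta> :: real and T :: nat
    and S :: "nat \<Rightarrow> 'w \<Rightarrow> real^'m" and \<alpha> :: "'w \<Rightarrow> int"
    and \<phi> :: "nat \<Rightarrow> real^'d \<Rightarrow> real^'n \<Rightarrow> real^'m \<Rightarrow> real^'d"
    and \<psi> :: "nat \<Rightarrow> real^'d \<Rightarrow> real^'d \<Rightarrow> real^'m \<Rightarrow> real^'d"
    and x y :: "nat \<Rightarrow> 'w \<Rightarrow> real^'d" and \<gamma> \<beta> :: "int \<Rightarrow> 'w \<Rightarrow> real^'d"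
    and Q :: "nat \<Rightarrow> 'w \<Rightarrow> real^'n"
  defines "\<Sigma> \<equiv> restrict_space borel \<S>"
  defines "\<Gamma> \<equiv> Gamma_star (distr M \<Sigma> (S 0)) X"
  defines "xbar \<equiv> (\<lambda>\<omega>. (1 / real T) *\<^sub>R (\<Sum>t<T. y t \<omega>))"
  defines "E\<alpha> \<equiv> vec_cond_exp M (first_phase_algebra M T \<Sigma> S \<alpha>)"
  defines "\<G> \<equiv> FW_gap \<B> Df (feasible_set \<Gamma> A b)"
  assumes prob: "prob_space M"
    and domain: "compact \<B>" "convex \<B>"
    and options: "\<And>s. s \<in> \<S> \<Longrightarrow> X s \<noteq> {} \<and> compact (X s) \<and> X s \<subseteq> \<B>"
    \<comment> \<open>i.i.d. states; slots \<open>0..<T\<close> drive the first phase, slots \<open>T..<2*T\<close> the second\<close>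
    and S_indep: "prob_space.indep_vars M (\<lambda>_. \<Sigma>) S UNIV"
    and S_ident: "\<And>t. distr M \<Sigma> (S t) = distr M \<Sigma> (S 0)"
    and zero: "0 \<in> closure \<Gamma>"
    and feasible: "feasible_set \<Gamma> A b \<noteq> {}"
    \<comment> \<open>the objective and its constants\<close>
    and gradient: "\<And>z. z \<in> \<B> \<Longrightarrow> (f has_derivative (\<lambda>h. Df z \<bullet> h)) (at z within \<B>)"
    and smooth: "L-lipschitz_on \<B> Df"
    and grad_bound: "\<And>z. z \<in> \<B> \<Longrightarrow> norm (Df z) \<le> Mg"
    and f_bound: "\<And>z. z \<in> \<B> \<Longrightarrow> \<bar>f z\<bar> \<le> K"
    and constr_bound: "\<And>z. z \<in> \<B> \<Longrightarrow> (\<Sum>i\<in>UNIV. \<bar>row i A \<bullet> z - b $ i\<bar>\<^sup>2) \<le> B\<^sup>2"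
    and diameter: "\<And>z z'. z \<in> \<B> \<Longrightarrow> z' \<in> \<B> \<Longrightarrow> norm (z - z') \<le> D"
    \<comment> \<open>parameters\<close>
    and T: "T > 1"
    and V: "V = real T powr (1/3)" and \<eta>: "\<eta> = real T powr (-2/3)"
    \<comment> \<open>first phase: decision rule and iterates\<close>
    and \<phi>_measurable: "\<And>t. t < T \<Longrightarrow>
          (\<lambda>(g, q, s). \<phi> t g q s) \<in> borel \<Otimes>\<^sub>M borel \<Otimes>\<^sub>M \<Sigma> \<rightarrow>\<^sub>M borel"
    and \<phi>_argmin: "\<And>t g q s. t < T \<Longrightarrow> g \<in> \<B> \<Longrightarrow> 0 \<le> q \<Longrightarrow> s \<in> \<S> \<Longrightarrow>
          is_arg_min (\<lambda>z. V * (Df g \<bullet> z) + (\<Sum>i\<in>UNIV. q $ i * (row i A \<bullet> z)))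
            (\<lambda>z. z \<in> X s) (\<phi> t g q s)"
    and \<gamma>_init: "\<And>\<omega>. \<omega> \<in> space M \<Longrightarrow> \<gamma> (-1) \<omega> = 0"
    and Q_init: "\<And>\<omega>. \<omega> \<in> space M \<Longrightarrow> Q 0 \<omega> = 0"
    and x_step: "\<And>t \<omega>. t < T \<Longrightarrow> \<omega> \<in> space M \<Longrightarrow>
          x t \<omega> = \<phi> t (\<gamma> (int t - 1) \<omega>) (Q t \<omega>) (S t \<omega>)"
    and \<gamma>_step: "\<And>t \<omega>. t < T \<Longrightarrow> \<omega> \<in> space M \<Longrightarrow>
          \<gamma> (int t) \<omega> = (1 - \<eta>) *\<^sub>R \<gamma> (int t - 1) \<omega> + \<eta> *\<^sub>R x t \<omega>"
    and Q_step: "\<And>t \<omega> i. t < T \<Longrightarrow> \<omega> \<in> space M \<Longrightarrow>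
          Q (Suc t) \<omega> $ i = max (Q t \<omega> $ i + row i A \<bullet> x t \<omega> - b $ i) 0"
    \<comment> \<open>\<open>\<alpha>\<close> is uniform on \<open>{-1, ..., T - 2}\<close> and independent of all states\<close>
    and \<alpha>_measurable: "\<alpha> \<in> M \<rightarrow>\<^sub>M count_space {-1..int T - 2}"
    and \<alpha>_uniform: "distr M (count_space {-1..int T - 2}) \<alpha>
          = uniform_count_measure {-1..int T - 2}"
    and \<alpha>_indep: "prob_space.indep_set M
          (sets (vimage_algebra (space M) \<alpha> (count_space {-1..int T - 2})))
          (sets (vimage_algebra (space M) (\<lambda>\<omega> t. S t \<omega>) (PiM UNIV (\<lambda>_. \<Sigma>))))"
    \<comment> \<open>second phase: decision rule, decisions \<open>y\<close> and iterates \<open>\<beta>\<close>; the target is \<open>\<gamma> (\<alpha> \<omega>) \<omega>\<close>\<close>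
    and \<psi>_measurable: "\<And>t. t < T \<Longrightarrow>
          (\<lambda>(g, h, s). \<psi> t g h s) \<in> borel \<Otimes>\<^sub>M borel \<Otimes>\<^sub>M \<Sigma> \<rightarrow>\<^sub>M borel"
    and \<psi>_argmin: "\<And>t g h s. t < T \<Longrightarrow> g \<in> \<B> \<Longrightarrow> h \<in> \<B> \<Longrightarrow> s \<in> \<S> \<Longrightarrow>
          is_arg_min (\<lambda>z. (g - h) \<bullet> z) (\<lambda>z. z \<in> X s) (\<psi> t g h s)"
    and \<beta>_init: "\<And>\<omega>. \<omega> \<in> space M \<Longrightarrow> \<beta> (-1) \<omega> = 0"
    and y_step: "\<And>t \<omega>. t < T \<Longrightarrow> \<omega> \<in> space M \<Longrightarrow>
          y t \<omega> = \<psi> t (\<beta> (int t - 1) \<omega>) (\<gamma> (\<alpha> \<omega>) \<omega>) (S (T + t) \<omega>)"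
    and \<beta>_step: "\<And>t \<omega>. t < T \<Longrightarrow> \<omega> \<in> space M \<Longrightarrow>
          \<beta> (int t) \<omega> = (1 - 1 / (real t + 1)) *\<^sub>R \<beta> (int t - 1) \<omega> + (1 / (real t + 1)) *\<^sub>R y t \<omega>"
  shows "integrable M (\<lambda>\<omega>. \<G> (E\<alpha> xbar \<omega>))
    \<and> (\<integral>\<omega>. \<G> (E\<alpha> xbar \<omega>) \<partial>M)
        \<le> (2 * K + B\<^sup>2 + L * D\<^sup>2 / 2 + (2 * D * L + Mg) * (sqrt 2 + 1) * D) * (1 / real T powr (1/3))
    \<and> (\<forall>i. row i A \<bullet> (\<integral>\<omega>. xbar \<omega> \<partial>M) - b $ i
        \<le> (sqrt (2 * Mg * D + 4 * K + B\<^sup>2 + L * D\<^sup>2) + norm (row i A) * (sqrt 2 + 2) * D)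
            * (1 / real T powr (1/3)))"
proof -
  have sp: "space \<Sigma> = \<S>" by (simp add: \<Sigma>_def space_restrict_space)
  have T1: "1 < real T" and V_pos: "0 < V" and \<eta>_pos: "0 < \<eta>"
    using T by (simp_all add: V \<eta>)
  have \<eta>_le: "\<eta> \<le> 1" using T1 powr_mono[of "-2/3" 0 "real T"] by (simp add: \<eta>)
  interpret two_phase M \<Sigma> S \<alpha> \<B> f Df L Mg K D X A b B V \<eta> T \<phi> x \<gamma> Q \<psi> y \<beta>
  proof (intro two_phase.intro first_phase.intro iid_history.intro smooth_objective.intro
      iid_history_axioms.intro first_phase_axioms.intro two_phase_axioms.intro)
    show "X s \<subseteq> \<B>" if "s \<in> space \<Sigma>" for s using options that by (simp add: sp)
    show "0 < T" using T by simp
    show "is_arg_min (\<lambda>z. V * (Df g \<bullet> z) + (\<Sum>i\<in>UNIV. q $ i * (row i A \<bullet> z))) (\<lambda>z. z \<in> X s) (\<phi> t g q s)"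
      if "t < T" "g \<in> \<B>" "0 \<le> q" "s \<in> space \<Sigma>" for t g q s
      using \<phi>_argmin that by (simp add: sp)
    show "is_arg_min (\<lambda>z. (g - h) \<bullet> z) (\<lambda>z. z \<in> X s) (\<psi> t g h s)"
      if "t < T" "g \<in> \<B>" "h \<in> \<B>" "s \<in> space \<Sigma>" for t g h s
      using \<psi>_argmin that by (simp add: sp)
  qed (fact prob S_indep S_ident \<alpha>_measurable \<alpha>_indep domain gradient smooth grad_bound f_bound diameter
      zero[unfolded \<Gamma>_def] feasible[unfolded \<Gamma>_def] constr_bound V_pos \<eta>_pos \<eta>_le \<phi>_measurable
      \<gamma>_init Q_init x_step \<gamma>_step Q_step \<alpha>_uniform \<psi>_measurable \<beta>_init y_step \<beta>_step)+
  have xbar_eq: "xbar = time_average"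
    by (simp add: xbar_def time_average_def fun_eq_iff)
  have alg: "first_phase_algebra M T \<Sigma> S \<alpha> = H T"
    by (simp add: first_phase_algebra_def history_def)
  have E: "E\<alpha> xbar = cond_average" by (simp add: E\<alpha>_def alg xbar_eq)
  have G: "\<G> = FW_gap \<B> Df (feasible_set (Gamma_star \<mu> X) A b)" by (simp add: \<G>_def \<Gamma>_def)

  \<comment> \<open>All rates are written in powers of \<open>r\<close>, with \<open>T = r\<^sup>3\<close>, \<open>V = r\<close>, \<open>\<eta> = 1 / r\<^sup>2\<close>.\<close>
  define r where "r = real T powr (1/3)"
  have r1: "1 \<le> r" using T1 by (simp add: r_def ge_one_powr_ge_zero)
  have Tr: "real T = r ^ 3" using T1 by (simp add: r_def powr_power)
  have Vr: "V = r" by (simp add: V r_def)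
  have \<eta>r: "\<eta> = 1 / r\<^sup>2" using T1 by (simp add: \<eta> r_def powr_power powr_minus_divide)
  \<comment> \<open>The two parts of \<open>\<epsilon>\<close> are \<open>D / r\<close> and \<open>D / \<surd>T\<close>, and \<open>\<surd>T \<ge> r\<close>; moreover \<open>2 \<le> \<surd>2 + 1\<close>.\<close>
  have \<epsilon>_le: "\<epsilon> \<le> (sqrt 2 + 1) * D / r"
  proof -
    have "sqrt \<eta> = 1 / r" using r1 by (simp add: \<eta>r real_sqrt_divide)
    moreover have "r \<le> sqrt (real T)"
      using r1 power_increasing[of 2 3 r] by (intro real_le_rsqrt) (simp add: Tr)
    then have "D / sqrt (real T) \<le> D / r" using r1 D_nonneg T1 by (intro divide_left_mono mult_pos_pos) auto
    ultimately have "\<epsilon> \<le> 2 * D / r" by simp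
    also have "\<dots> \<le> (sqrt 2 + 1) * D / r"
      using r1 D_nonneg by (intro divide_right_mono mult_right_mono) auto
    finally show ?thesis .
  qed
  have \<eta>T: "\<eta> * real T = r" using r1 by (simp add: \<eta>r Tr power2_eq_square power3_eq_cube)
  have inv_le: "c / r\<^sup>2 \<le> c / r" if "0 \<le> c" for c
    using r1 that by (intro divide_left_mono) (auto simp: power2_eq_square)
  have gap: "2 * K / (\<eta> * real T) + \<eta> * L * D\<^sup>2 / 2 + B\<^sup>2 / (2 * V) + (L * D + Mg) * \<epsilon>
      \<le> (2 * K + B\<^sup>2 + L * D\<^sup>2 / 2 + (2 * D * L + Mg) * (sqrt 2 + 1) * D) * (1 / r)"
  proof -
    have "\<eta> * L * D\<^sup>2 / 2 \<le> (L * D\<^sup>2 / 2) / r"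
      using inv_le[of "L * D\<^sup>2 / 2"] L_nonneg by (simp add: \<eta>r)
    moreover have "B\<^sup>2 / (2 * V) \<le> B\<^sup>2 / r" using r1 by (simp add: Vr divide_left_mono)
    moreover have "(L * D + Mg) * \<epsilon> \<le> (2 * D * L + Mg) * ((sqrt 2 + 1) * D / r)"
      using \<epsilon>_le \<epsilon>_nonneg L_nonneg D_nonneg Mg_nonneg by (intro mult_mono) (auto simp: algebra_simps)
    moreover have "(2 * K + B\<^sup>2 + L * D\<^sup>2 / 2 + (2 * D * L + Mg) * (sqrt 2 + 1) * D) * (1 / r)
        = 2 * K / r + B\<^sup>2 / r + (L * D\<^sup>2 / 2) / r + (2 * D * L + Mg) * ((sqrt 2 + 1) * D / r)"
      by (simp add: add_divide_distrib)
    ultimately show ?thesis by (simp only: \<eta>T)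
  qed
  have constraint: "sqrt (4 * K * V / \<eta> + real T * (V * \<eta> * L * D\<^sup>2 + B\<^sup>2 + 2 * V * Mg * D)) / real T
       + norm (row i A) * D / (\<eta> * real T) + norm (row i A) * \<epsilon>
      \<le> (sqrt (2 * Mg * D + 4 * K + B\<^sup>2 + L * D\<^sup>2) + norm (row i A) * (sqrt 2 + 2) * D) * (1 / r)" for i
  proof -
    let ?C = "2 * Mg * D + 4 * K + B\<^sup>2 + L * D\<^sup>2"
    have "4 * K * V / \<eta> + real T * (V * \<eta> * L * D\<^sup>2 + B\<^sup>2 + 2 * V * Mg * D)
        = r ^ 3 * (4 * K) + r\<^sup>2 * (L * D\<^sup>2) + r ^ 3 * B\<^sup>2 + r ^ 4 * (2 * Mg * D)"
      using r1 by (simp add: \<eta>r Vr Tr field_simps eval_nat_numeral)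
    \<comment> \<open>As \<open>r \<ge> 1\<close>, all summands are raised to the order \<open>r\<^sup>4\<close> of the dominant one.\<close>
    also have "\<dots> \<le> r ^ 4 * (4 * K) + r ^ 4 * (L * D\<^sup>2) + r ^ 4 * B\<^sup>2 + r ^ 4 * (2 * Mg * D)"
      using r1 K_nonneg L_nonneg
      by (intro add_mono mult_right_mono power_increasing order_refl) auto
    also have "\<dots> = (r\<^sup>2)\<^sup>2 * ?C" by (simp add: algebra_simps)
    finally have "sqrt (4 * K * V / \<eta> + real T * (V * \<eta> * L * D\<^sup>2 + B\<^sup>2 + 2 * V * Mg * D)) \<le> sqrt ((r\<^sup>2)\<^sup>2 * ?C)"
      by (rule real_sqrt_le_mono)
    also have "\<dots> = r\<^sup>2 * sqrt ?C" using r1 by (simp only: real_sqrt_mult real_sqrt_abs) simp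
    finally have "sqrt (4 * K * V / \<eta> + real T * (V * \<eta> * L * D\<^sup>2 + B\<^sup>2 + 2 * V * Mg * D)) / real T
        \<le> r\<^sup>2 * sqrt ?C / real T" by (rule divide_right_mono) simp
    also have "\<dots> = sqrt ?C / r" using r1 by (simp add: Tr eval_nat_numeral)
    finally have "sqrt (4 * K * V / \<eta> + real T * (V * \<eta> * L * D\<^sup>2 + B\<^sup>2 + 2 * V * Mg * D)) / real T
        \<le> sqrt ?C / r" .
    moreover have "norm (row i A) * \<epsilon> \<le> norm (row i A) * ((sqrt 2 + 1) * D / r)"
      by (intro mult_left_mono \<epsilon>_le) simp
    moreover have "(sqrt ?C + norm (row i A) * (sqrt 2 + 2) * D) * (1 / r)
        = sqrt ?C / r + norm (row i A) * D / r + norm (row i A) * ((sqrt 2 + 1) * D / r)"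
      by (simp add: add_divide_distrib algebra_simps)
    ultimately show ?thesis by (simp only: \<eta>T)
  qed
  have int: "(\<integral>\<omega>. xbar \<omega> \<partial>M) = (\<integral>\<omega>. time_average \<omega> \<partial>M)" by (simp add: xbar_eq)
  show ?thesis
    unfolding E G int r_def[symmetric]
    using expected_gap_cond_average order_trans[OF expected_gap_cond_average(2) gap]
      order_trans[OF expected_constraint constraint] by blast
qed

end
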